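(* Let $\{\mathbf Z^{(n)}\}_{n\ge0}$ be a linear-fractional multi-type Bienaym\'e-Galton-Watson process with parameters $(\mathbf H,\mathbf g,m)$, starting from a single particle, whose mean matrix $\mathbf M=\mathbf H+m\mathbf H\mathbf 1^{\mathrm t}\mathbf g$ is irreducible and aperiodic, and assume $\beta<\infty$. Suppose that $\rho=1$ (the critical positively recurrent case). Then, as $n\to\infty$, $$\mathbb P(\mathbf Z^{(n)}\ne\mathbf 0)\sim n^{-1}(1+m)^{-1}\beta\,\mathbf u^{\mathrm t},$$ where $\mathbb P(\mathbf Z^{(n)}\ne\mathbf 0)$ denotes the column vector with elements $\mathbb P(\mathbf Z^{(n)}\ne\mathbf 0\mid\mathbf Z^{(0)}=\mathbf e_i)$, $i\ge1$, and $\sim$ is understood component-wise. If a vector $\mathbf w=(w_1,w_2,\ldots)$ has bounded components ($\sup_{j\ge1}|w_j|<\infty$) and $\mathbf v\mathbf w^{\mathrm t}>0$, then for all $x>0$ and $i\ge1$ $$\mathbb P\big(\mathbf Z^{(n)}\mathbf w^{\mathrm t}>nx\mid\mathbf Z^{(n)}\ne\mathbf 0,\mathbf Z^{(0)}=\mathbf e_i\big)\to e^{-x/c_w},\qquad c_w=(1+m)\beta^{-1}\mathbf v\mathbf w^{\mathrm t}.$$ In other words, conditionally on non-extinction, $n^{-1}\mathbf Z^{(n)}$ weakly converges to $X\mathbf v$, where $X$ is exponentially distributed with mean $(1+m)\beta^{-1}$.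
   Context: Vectors are row vectors indexed by $\{1,2,\ldots\}$; $\mathbf x^{\mathrm t}$ denotes the transpose; $\mathbf 1=(1,1,\ldots)$; $\mathbf 0=(0,0,\ldots)$; $\mathbf e_i$ is the $i$-th unit vector; $\mathbf s^{\mathbf x}=s_1^{x_1}s_2^{x_2}\cdots$. Parameters: $\mathbf H=(h_{ij})_{i,j\ge1}$ is a sub-stochastic matrix (non-negative entries, row sums at most $1$), $\mathbf g=(g_1,g_2,\ldots)$ a probability distribution on $\{1,2,\ldots\}$, $m>0$ a constant. Linear-fractional distribution: for a probability distribution $(h_0,h_1,h_2,\ldots)$ on $\{0,1,2,\ldots\}$ with $\mathbf h=(h_1,h_2,\ldots)$, a random vector $\mathbf Z$ with non-negative integer components and finite sum has distribution $\mathrm{LF}(\mathbf h,\mathbf g,m)$ if $$\mathbb E(\mathbf s^{\mathbf Z})=h_0+\frac{\sum_{i\ge1}h_is_i}{1+m-m\sum_{i\ge1}g_is_i},\qquad\mathbf s\in[0,1]^\infty.$$ Process: in a multi-type Bienaym\'e-Galton-Watson process with types $1,2,\ldots$ each particle lives one unit of time and at death produces offspring independently of all other particles, with law depending only on its type; $\mathbf Z^{(n)}=(Z_1^{(n)},Z_2^{(n)},\ldots)$, where $Z_j^{(n)}$ is the number of type $j$ particles at time $n$. It is linear-fractional with parameters $(\mathbf H,\mathbf g,m)$ if, for each $i$, the offspring vector of a type $i$ particle has distribution $\mathrm{LF}(\mathbf h_i,\mathbf g,m)$, $\mathbf h_i$ being the $i$-th row of $\mathbf H$. Its mean matrix, with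 entries $\mathbb E(Z_j^{(1)}\mid\mathbf Z^{(0)}=\mathbf e_i)$, is $\mathbf M$. Irreducible: for every $(i,j)$ some power $\mathbf M^n$, $n\ge1$, has positive $(i,j)$ entry; aperiodic: the greatest common divisor of all $n\ge1$ such that $(\mathbf M^n)_{ii}>0$ equals $1$. Further quantities: $d_n=\mathbf g\mathbf H^n\mathbf 1^{\mathrm t}$ ($n\ge1$); $f(s)=\sum_{n\ge1}d_ns^n$; $R_f=\inf\{s>0:f(s)=\infty\}$ (with $\inf\emptyset=\infty$, $f(\infty)=\lim_{s\to\infty}f(s)$). If $f(R_f)\ge1/m$, then $\alpha$ is the unique real solution of $mf(e^{-\alpha})=1$ and $\beta=m\sum_{n\ge1}nd_ne^{-\alpha n}$; if $f(R_f)<1/m$, then $\alpha=-\infty$ and $\beta=\infty$. When $\alpha>-\infty$: $R=e^{-\alpha}$ and $\rho=R^{-1}=e^{\alpha}$. Finally $$\mathbf u^{\mathrm t}=(1+m)\beta^{-1}\sum_{k=1}^\infty R^k\mathbf H^k\mathbf 1^{\mathrm t},\qquad\mathbf v=\frac m{1+m}\sum_{k=0}^\infty R^k\mathbf g\mathbf H^k.$$ The concluding weak convergence of $n^{-1}\mathbf Z^{(n)}$ is a reformulation of the preceding convergence of the conditional distributions of $n^{-1}\mathbf Z^{(n)}\mathbf w^{\mathrm t}$ for all such $\mathbf w$. *)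

theory Defs
  imports
    "HOL-Probability.Probability"
    "HOL-Library.Poly_Mapping"
    "HOL-Library.Landau_Symbols"
begin

(* Poly_Mapping brings in a second meaning of the notation for infinite sums. *)
no_syntax
  "_Sum_any" :: "pttrn \<Rightarrow> 'a \<Rightarrow> 'a::comm_monoid_add"  (\<open>(\<open>indent=2 notation=\<open>binder \<Sum>\<close>\<close>\<Sum>_. _)\<close> [0, 10] 10)

text \<open>
  Types are indexed by \<^typ>\<open>nat\<close>, so type \<open>i\<close> here is type \<open>i + 1\<close> when counting starts
  at one.  Real vectors and matrices are functions on \<^typ>\<open>nat\<close>; a population, that is a vector
  of non-negative integers with finite sum, is a finitely supported function.
\<close>

type_synonym population = "nat \<Rightarrow>\<^sub>0 nat"

definition counts :: "population \<Rightarrow> nat \<Rightarrow> real" where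
  "counts z = (\<lambda>j. real (Poly_Mapping.lookup z j))"

definition dot :: "(nat \<Rightarrow> real) \<Rightarrow> (nat \<Rightarrow> real) \<Rightarrow> real" where
  "dot a b = (\<Sum>j. a j * b j)"

primrec mat_pow :: "(nat \<Rightarrow> nat \<Rightarrow> real) \<Rightarrow> nat \<Rightarrow> nat \<Rightarrow> nat \<Rightarrow> real" where
  "mat_pow A 0 = (\<lambda>i j. if i = j then 1 else 0)"
| "mat_pow A (Suc n) = (\<lambda>i j. dot (A i) (\<lambda>k. mat_pow A n k j))"

definition irreducible_mat :: "(nat \<Rightarrow> nat \<Rightarrow> real) \<Rightarrow> bool" where
  "irreducible_mat A \<longleftrightarrow> (\<forall>i j. \<exists>n\<ge>1. mat_pow A n i j > 0)"

definition aperiodic_mat :: "(nat \<Rightarrow> nat \<Rightarrow> real) \<Rightarrow> bool" where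
  "aperiodic_mat A \<longleftrightarrow> (\<forall>i. Gcd {n. n \<ge> 1 \<and> mat_pow A n i i > 0} = 1)"

definition substochastic :: "(nat \<Rightarrow> nat \<Rightarrow> real) \<Rightarrow> bool" where
  "substochastic H \<longleftrightarrow> (\<forall>i j. 0 \<le> H i j) \<and> (\<forall>i. summable (H i) \<and> (\<Sum>j. H i j) \<le> 1)"

definition prob_vector :: "(nat \<Rightarrow> real) \<Rightarrow> bool" where
  "prob_vector g \<longleftrightarrow> (\<forall>j. 0 \<le> g j) \<and> g sums 1"


subsection \<open>Linear-fractional branching processes\<close>

definition monomial_at :: "(nat \<Rightarrow> real) \<Rightarrow> population \<Rightarrow> real" where
  "monomial_at s z = (\<Prod>j\<in>Poly_Mapping.keys z. s j ^ Poly_Mapping.lookup z j)"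

text \<open>The mass at zero of the distribution with positive part \<open>h\<close> is \<open>1 - (\<Sum>i. h i)\<close>.\<close>

definition linear_fractional ::
    "(nat \<Rightarrow> real) \<Rightarrow> (nat \<Rightarrow> real) \<Rightarrow> real \<Rightarrow> population pmf \<Rightarrow> bool" where
  "linear_fractional h g m q \<longleftrightarrow>
     (\<forall>s. (\<forall>j. 0 \<le> s j \<and> s j \<le> 1) \<longrightarrow>
        measure_pmf.expectation q (monomial_at s) =
          (1 - (\<Sum>i. h i)) + dot h s / (1 + m - m * dot g s))"

text \<open>The pair \<open>(i, k)\<close> stands for the \<open>k\<close>-th particle of type \<open>i\<close>.\<close>

definition particles :: "population \<Rightarrow> (nat \<times> nat) set" where
  "particles z = (SIGMA i:Poly_Mapping.keys z. {..<Poly_Mapping.lookup z i})"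

text \<open>
  Law of the generation following \<open>z\<close>: \<^const>\<open>Pi_pmf\<close> makes the offspring \<open>\<xi> p\<close> of the particles
  \<open>p\<close> independent, with law \<open>q i\<close> if \<open>p\<close> has type \<open>i\<close>.
\<close>

definition next_generation :: "(nat \<Rightarrow> population pmf) \<Rightarrow> population \<Rightarrow> population pmf" where
  "next_generation q z =
     map_pmf (\<lambda>\<xi>. \<Sum>p\<in>particles z. \<xi> p) (Pi_pmf (particles z) 0 (\<lambda>(i, k). q i))"

text \<open>
  \<open>Z\<close> is a Markov chain on the countable set of populations, started from \<open>z0\<close>, with transition
  law \<^const>\<open>next_generation\<close>.
\<close>

definition branching_process ::
    "'a measure \<Rightarrow> (nat \<Rightarrow> population pmf) \<Rightarrow> population \<Rightarrow> (nat \<Rightarrow> 'a \<Rightarrow> population) \<Rightarrow> bool" where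
  "branching_process M q z0 Z \<longleftrightarrow>
     prob_space M \<and>
     (\<forall>n. Z n \<in> measurable M (count_space UNIV)) \<and>
     (AE \<omega> in M. Z 0 \<omega> = z0) \<and>
     (\<forall>n z. \<P>(\<omega> in M. \<forall>k\<le>Suc n. Z k \<omega> = z k) =
              \<P>(\<omega> in M. \<forall>k\<le>n. Z k \<omega> = z k) * pmf (next_generation q (z n)) (z (Suc n)))"

text \<open>
  The measure \<open>P i\<close> plays the role of the conditional probability given that the process starts
  from a single particle of type \<open>i\<close>.
\<close>

definition lf_branching_process ::
    "(nat \<Rightarrow> 'a measure) \<Rightarrow> (nat \<Rightarrow> 'a \<Rightarrow> population) \<Rightarrow>
     (nat \<Rightarrow> nat \<Rightarrow> real) \<Rightarrow> (nat \<Rightarrow> real) \<Rightarrow> real \<Rightarrow> bool" where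
  "lf_branching_process P Z H g m \<longleftrightarrow>
     (\<exists>q. (\<forall>i. linear_fractional (H i) g m (q i)) \<and>
          (\<forall>i. branching_process (P i) q (Poly_Mapping.single i 1) Z))"

definition mean_matrix ::
    "(nat \<Rightarrow> 'a measure) \<Rightarrow> (nat \<Rightarrow> 'a \<Rightarrow> population) \<Rightarrow> nat \<Rightarrow> nat \<Rightarrow> real" where
  "mean_matrix P Z i j = (LINT \<omega>|P i. counts (Z 1 \<omega>) j)"


subsection \<open>The Malthusian parameter and related quantities\<close>

definition row_sum :: "(nat \<Rightarrow> nat \<Rightarrow> real) \<Rightarrow> nat \<Rightarrow> nat \<Rightarrow> real" where
  "row_sum H n i = (\<Sum>j. mat_pow H n i j)"

definition d_seq :: "(nat \<Rightarrow> nat \<Rightarrow> real) \<Rightarrow> (nat \<Rightarrow> real) \<Rightarrow> nat \<Rightarrow> real" where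
  "d_seq H g n = dot g (row_sum H n)"

text \<open>
  At \<open>s = \<infinity>\<close> this formula agrees with the limit for \<open>s \<rightarrow> \<infinity>\<close>: it is \<open>0\<close> if all
  coefficients vanish and \<open>\<infinity>\<close> otherwise.
\<close>

definition f_gen :: "(nat \<Rightarrow> nat \<Rightarrow> real) \<Rightarrow> (nat \<Rightarrow> real) \<Rightarrow> ennreal \<Rightarrow> ennreal" where
  "f_gen H g s = (\<Sum>n. ennreal (d_seq H g (Suc n)) * s ^ Suc n)"

definition R_f :: "(nat \<Rightarrow> nat \<Rightarrow> real) \<Rightarrow> (nat \<Rightarrow> real) \<Rightarrow> ennreal" where
  "R_f H g = Inf {s. 0 < s \<and> s < \<infinity> \<and> f_gen H g s = \<infinity>}"

definition malthusian ::
    "(nat \<Rightarrow> nat \<Rightarrow> real) \<Rightarrow> (nat \<Rightarrow> real) \<Rightarrow> real \<Rightarrow> ereal" where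
  "malthusian H g m =
     (if f_gen H g (R_f H g) \<ge> ennreal (1 / m)
      then ereal (THE a. ennreal m * f_gen H g (ennreal (exp (- a))) = 1)
      else - \<infinity>)"

definition beta ::
    "(nat \<Rightarrow> nat \<Rightarrow> real) \<Rightarrow> (nat \<Rightarrow> real) \<Rightarrow> real \<Rightarrow> ennreal" where
  "beta H g m =
     (if f_gen H g (R_f H g) \<ge> ennreal (1 / m)
      then ennreal m * (\<Sum>n. ennreal (real (Suc n) * d_seq H g (Suc n) *
                               exp (- real_of_ereal (malthusian H g m) * real (Suc n))))
      else \<infinity>)"

text \<open>
  The quantities below are meaningful only if \<^const>\<open>malthusian\<close> is not \<open>- \<infinity>\<close>, which holds
  whenever \<^const>\<open>beta\<close> is finite.
\<close>

definition R_conv :: "(nat \<Rightarrow> nat \<Rightarrow> real) \<Rightarrow> (nat \<Rightarrow> real) \<Rightarrow> real \<Rightarrow> real" where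
  "R_conv H g m = exp (- real_of_ereal (malthusian H g m))"

definition rho :: "(nat \<Rightarrow> nat \<Rightarrow> real) \<Rightarrow> (nat \<Rightarrow> real) \<Rightarrow> real \<Rightarrow> real" where
  "rho H g m = inverse (R_conv H g m)"

definition u_vec :: "(nat \<Rightarrow> nat \<Rightarrow> real) \<Rightarrow> (nat \<Rightarrow> real) \<Rightarrow> real \<Rightarrow> nat \<Rightarrow> real" where
  "u_vec H g m i =
     (1 + m) / enn2real (beta H g m) * (\<Sum>k. R_conv H g m ^ Suc k * row_sum H (Suc k) i)"

definition v_vec :: "(nat \<Rightarrow> nat \<Rightarrow> real) \<Rightarrow> (nat \<Rightarrow> real) \<Rightarrow> real \<Rightarrow> nat \<Rightarrow> real" where
  "v_vec H g m j =
     m / (1 + m) * (\<Sum>k. R_conv H g m ^ k * dot g (\<lambda>i. mat_pow H k i j))"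

definition exponential_law :: "real \<Rightarrow> real measure" where
  "exponential_law \<mu> = density lborel (\<lambda>x. ennreal (exponential_density (1 / \<mu>) x))"

end

theory Submission
  imports Defs
begin

text \<open>
  Writing \<open>s = 1 - t\<close>, the offspring generating functions become the projective linear map
  \<open>t \<mapsto> M t / (1 + m g t)\<close>, so that the \<open>n\<close>-th generation satisfies
  \<open>1 - E\<^sub>i s\<^sup>Z = (M\<^sup>n t)\<^sub>i / (1 + m (\<Sum>k<n. g M\<^sup>k t))\<close>.  The numbers
  \<open>g M\<^sup>n t\<close> solve a renewal equation with step law \<open>p\<^sub>k = m d\<^sub>k\<close>, which for \<open>\<rho> = 1\<close> is an aperiodic
  probability distribution with mean \<open>\<beta>\<close>; hence they converge, and so does \<open>M\<^sup>n t\<close>.  Taking \<open>t = 1\<close>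
  gives the survival probability, and \<open>t = 1 - exp (- \<tau> / n)\<close> the limit
  \<open>1 / (1 + \<mu> v \<tau>)\<close>, with \<open>\<mu> = (1 + m) / \<beta>\<close>, of the conditional Laplace transforms at
  non-negative \<open>\<tau>\<close>.  A weight \<open>w\<close> of arbitrary sign is a difference of two non-negative weights; joint
  Laplace transforms determine the limit of the difference by polynomial approximation in
  \<open>exp (- N)\<close> and \<open>exp (- W)\<close>.
\<close>

section \<open>The renewal theorem\<close>

text \<open>The renewal structure comes from \<open>mean\<close> being \<open>H\<close> plus the
  rank-one matrix m H 1 g: cutting a product of n factors at its first rank-one factor leaves a
  fresh start from \<open>g\<close>. Irreducibility and aperiodicity are given for
  \<open>mean\<close> only and have to be carried over to the step law. Since there are infinitely
  many types, rows are treated as finite measures and columns as bounded functions. At t = 1 - exp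
  (- \<tau> / n) the numerator of the fraction is of order 1/n, while its denominator contains n
  terms of order 1/n and so has a finite limit. Division by the survival probability, also of order
  1/n, leaves 1 - y / (1 + y) with y = m V \<tau> / \<beta>, whatever the starting type. For a
  signed \<open>w\<close> the Laplace transform of the weighted population may be infinite. The pair
  of the total population and the population weighted by w + K avoids this, and both components,
  divided by n, tend to multiples of the same exponential variable, so that their joint transform is
  again an exponential one.\<close>

text \<open>Take the least positive difference \<open>d\<close> of two elements \<open>a\<close> and
  \<open>a + d\<close>. If \<open>s\<close> has quotient k and remainder r modulo \<open>d\<close>,
  then k (a + d) + r = s + k a would make a positive r a smaller difference; so \<open>d\<close>
  divides all of \<open>S\<close> and equals 1. From \<open>a\<close> and \<open>a + 1\<close>,
  every n \<ge> a * a is (q - r) a + r (a + 1), with q and r the quotient and remainder modulo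
  \<open>a\<close>.\<close>

lemma numerical_semigroup_cofinite:
  fixes S :: "nat set"
  assumes zero: "0 \<in> S" and add: "\<And>a b. a \<in> S \<Longrightarrow> b \<in> S \<Longrightarrow> a + b \<in> S"
    and gcd: "\<And>d. (\<And>s. s \<in> S \<Longrightarrow> d dvd s) \<Longrightarrow> d = 1"
  shows "\<exists>N. \<forall>n\<ge>N. n \<in> S"
proof -
  have mult: "k * a \<in> S" if "a \<in> S" for a k
    using that by (induction k) (auto simp: zero add)
  define D where "D d \<longleftrightarrow> d > 0 \<and> (\<exists>a\<in>S. a + d \<in> S)" for d
  have "\<exists>d. D d"
  proof (rule ccontr)
    assume "\<not> ?thesis"
    have "s = 0" if "s \<in> S" for s
    proof (rule ccontr)
      assume "s \<noteq> 0"
      then have "D s"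
        unfolding D_def using zero that by (intro conjI bexI[of _ 0]) auto
      then show False
        using \<open>\<not> (\<exists>d. D d)\<close> by blast
    qed
    \<comment> \<open>If 0 were the only element, 0 itself would divide all of
      \<open>S\<close>.\<close>
    then have "(0::nat) = 1"
      by (intro gcd) simp
    then show False by simp
  qed
  then have d: "D (LEAST d. D d)" and least: "\<And>d'. D d' \<Longrightarrow> (LEAST d. D d) \<le> d'"
    by (auto intro: LeastI_ex Least_le)
  define d where "d = (LEAST d. D d)"
  have d: "D d" and least: "\<And>d'. D d' \<Longrightarrow> d \<le> d'"
    using d least by (auto simp: d_def)
  from d obtain a where a: "a \<in> S" "a + d \<in> S" by (auto simp: D_def)
  have "d dvd s" if s: "s \<in> S" for s
  proof (rule ccontr)
    assume "\<not> d dvd s"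
    then have pos: "s mod d > 0" by (simp add: mod_greater_zero_iff_not_dvd)
    let ?k = "s div d"
    have "?k * (a + d) + s mod d = ?k * a + (?k * d + s mod d)"
      by (simp add: add_mult_distrib2)
    then have "?k * (a + d) + s mod d = s + ?k * a"
      by simp
    then have "?k * (a + d) + s mod d \<in> S"
      using add[OF s mult[OF a(1), of ?k]] by simp
    then have "D (s mod d)"
      unfolding D_def using pos mult[OF a(2), of ?k] by blast
    then have "d \<le> s mod d" by (rule least)
    moreover have "s mod d < d" using d by (simp add: D_def)
    ultimately show False by linarith
  qed
  then have d1: "d = 1" by (rule gcd)
  have "n \<in> S" if n: "n \<ge> a * a" for n
  proof (cases "a = 0")
    case True
    then show ?thesis using mult[of 1 n] a d1 by simp
  next
    case False
    have "a \<le> n div a"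
      using div_le_mono[OF n, of a] False by simp
    then have le: "n mod a \<le> n div a"
      using mod_less_divisor[of a n] False by linarith
    have "(n div a - n mod a) * a + (n mod a) * (a + 1) = (n div a - n mod a + n mod a) * a + n mod a"
      by (simp only: add_mult_distrib add_mult_distrib2 mult_1_right add.assoc)
    also have "\<dots> = n"
      using le by (simp only: le_add_diff_inverse2 div_mult_mod_eq)
    finally show ?thesis
      using add[OF mult[OF a(1), of "n div a - n mod a"] mult[OF a(2)[unfolded d1], of "n mod a"]] by (simp only:)
  qed
  then show ?thesis by blast
qed

text \<open>Summation by parts: the first \<open>n\<close> tails add up to the truncated mean plus
  \<open>n\<close> times the mass from \<open>n\<close> on, and this remainder is dominated by the
  tail of the convergent mean series.\<close>

lemma tail_sum_sums_mean:
  fixes p :: "nat \<Rightarrow> real"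
  assumes p0: "\<And>k. 0 \<le> p k" and p: "p sums 1" and mean: "(\<lambda>k. real k * p k) sums \<mu>"
  shows "(\<lambda>n. 1 - (\<Sum>k\<le>n. p k)) sums \<mu>"
proof -
  define q where "q n = 1 - (\<Sum>k\<le>n. p k)" for n
  have tail: "q n = (\<Sum>k. p (k + Suc n))" for n
    using suminf_minus_initial_segment[OF sums_summable[OF p], of "Suc n"] sums_unique[OF p]
    by (simp add: q_def lessThan_Suc_atMost)
  have partial: "(\<Sum>k<n. q k) = (\<Sum>k<n. real k * p k) + real n * (\<Sum>k. p (k + n))" for n
  proof (induction n)
    case (Suc n)
    have "(\<Sum>k. p (k + n)) = p n + q n"
      using suminf_split_head[of "\<lambda>k. p (k + n)"] sums_summable[OF p]
      by (simp add: tail)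
    then show ?case
      using Suc tail[of n] by (simp add: algebra_simps)
  qed simp
  have bound: "0 \<le> real n * (\<Sum>k. p (k + n)) \<and> real n * (\<Sum>k. p (k + n)) \<le> \<mu> - (\<Sum>k<n. real k * p k)" for n
  proof
    show "0 \<le> real n * (\<Sum>k. p (k + n))"
      using p p0 by (intro mult_nonneg_nonneg suminf_nonneg) (auto simp: sums_iff)
    have tp: "summable (\<lambda>k. p (k + n))"
      using sums_summable[OF p] by (rule summable_ignore_initial_segment)
    have tm: "summable (\<lambda>k. real (k + n) * p (k + n))"
      using summable_ignore_initial_segment[OF sums_summable[OF mean], of n] .
    have "real n * (\<Sum>k. p (k + n)) = (\<Sum>k. real n * p (k + n))"
      using tp by (rule suminf_mult[symmetric])
    also have "\<dots> \<le> (\<Sum>k. real (k + n) * p (k + n))"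
    proof (rule suminf_le[OF _ summable_mult[OF tp] tm])
      show "real n * p (k + n) \<le> real (k + n) * p (k + n)" for k
        by (rule mult_right_mono) (use p0 in auto)
    qed
    also have "\<dots> = \<mu> - (\<Sum>k<n. real k * p k)"
      using suminf_minus_initial_segment[OF sums_summable[OF mean], of n] sums_unique[OF mean]
      by simp
    finally show "real n * (\<Sum>k. p (k + n)) \<le> \<mu> - (\<Sum>k<n. real k * p k)" .
  qed
  have lim: "(\<lambda>n. \<Sum>k<n. real k * p k) \<longlonglongrightarrow> \<mu>"
    using mean by (simp add: sums_def)
  then have "(\<lambda>n. \<mu> - (\<Sum>k<n. real k * p k)) \<longlonglongrightarrow> 0"
    using tendsto_diff[OF tendsto_const lim, of \<mu>] by simp
  then have "(\<lambda>n. real n * (\<Sum>k. p (k + n))) \<longlonglongrightarrow> 0"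
    by (rule tendsto_sandwich[OF _ _ tendsto_const, rotated 2]) (use bound in auto)
  from tendsto_add[OF lim this] show ?thesis
    unfolding sums_def partial q_def[symmetric] by simp
qed

text \<open>Dominated convergence with majorant \<open>q k * B\<close>. The index runs along an
  arbitrary \<open>h\<close> tending to infinity because the renewal argument passes to
  subsequences.\<close>

lemma convolution_tendsto:
  fixes q :: "nat \<Rightarrow> real" and x :: "nat \<Rightarrow> real"
  assumes "\<And>k. 0 \<le> q k" and "summable q" and "\<And>n. \<bar>x n\<bar> \<le> B"
    and h: "filterlim h at_top sequentially"
    and lim: "\<And>k. (\<lambda>r. x (h r - k)) \<longlonglongrightarrow> L"
  shows "(\<lambda>r. \<Sum>k\<le>h r. q k * x (h r - k)) \<longlonglongrightarrow> (\<Sum>k. q k) * L"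
proof -
  have B: "0 \<le> B" using assms(3)[of 0] by linarith
  have "(\<lambda>r. \<Sum>k. (if k \<le> h r then q k * x (h r - k) else 0)) \<longlonglongrightarrow> (\<Sum>k. q k * L)"
  proof (rule tannerys_theorem[where M = "\<lambda>k. q k * B", THEN conjunct2, THEN conjunct2])
    fix k
    have "eventually (\<lambda>r. k \<le> h r) sequentially"
      using h by (simp add: filterlim_at_top)
    then have "eventually (\<lambda>r. q k * x (h r - k) = (if k \<le> h r then q k * x (h r - k) else 0)) sequentially"
      by eventually_elim simp
    moreover have "(\<lambda>r. q k * x (h r - k)) \<longlonglongrightarrow> q k * L"
      by (intro tendsto_intros lim)
    ultimately show "(\<lambda>r. if k \<le> h r then q k * x (h r - k) else 0) \<longlonglongrightarrow> q k * L"
      by (rule Lim_transform_eventually[rotated])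
  next
    show "\<forall>\<^sub>F (k, n) in at_top \<times>\<^sub>F sequentially.
        norm (if k \<le> h n then q k * x (h n - k) else 0) \<le> q k * B"
      using assms(1,3) B by (intro always_eventually) (auto simp: abs_mult intro!: mult_left_mono)
  qed (use assms in \<open>auto intro: summable_mult2\<close>)
  moreover have "(\<Sum>k. (if k \<le> h r then q k * x (h r - k) else 0)) = (\<Sum>k\<le>h r. q k * x (h r - k))" for r
    by (subst suminf_finite[of "{..h r}"]) auto
  ultimately show ?thesis
    using assms(2) by (simp add: suminf_mult2)
qed


text \<open>In generating functions, a (1 - p) = b is divided by 1 - z, and (1 - p) / (1 - z) has
  the tails of \<open>p\<close> as coefficients. The recursion has disappeared, so bounds and limits
  can be read off.\<close>

lemma renewal_sum_identity:
  fixes p a b :: "nat \<Rightarrow> real"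
  assumes "p 0 = 0" and "\<And>n. a n = b n + (\<Sum>k\<le>n. p k * a (n - k))"
  shows "(\<Sum>k\<le>n. (1 - (\<Sum>j\<le>k. p j)) * a (n - k)) = (\<Sum>k\<le>n. b k)"
proof (induction n)
  case 0
  then show ?case using assms(2)[of 0] assms(1) by simp
next
  case (Suc n)
  have "(\<Sum>k\<le>Suc n. (1 - (\<Sum>j\<le>k. p j)) * a (Suc n - k)) =
      a (Suc n) + (\<Sum>k\<le>n. (1 - (\<Sum>j\<le>k. p j)) * a (n - k)) - (\<Sum>k\<le>n. p (Suc k) * a (n - k))"
    unfolding sum.atMost_Suc_shift[where n = n] using assms(1)
    by (simp add: sum_subtractf sum.distrib algebra_simps)
  moreover have "a (Suc n) = b (Suc n) + (\<Sum>k\<le>n. p (Suc k) * a (n - k))"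
    using assms(2)[of "Suc n"] assms(1) by (simp add: sum.atMost_Suc_shift del: sum.atMost_Suc)
  ultimately show ?case using Suc by simp
qed

lemma bounded_sequence_limsup:
  fixes a :: "nat \<Rightarrow> real"
  assumes B: "\<And>n. \<bar>a n\<bar> \<le> B"
  obtains L r where "strict_mono r" "(\<lambda>n. a (r n)) \<longlonglongrightarrow> L" "limsup (\<lambda>n. ereal (a n)) = ereal L"
    "(\<lambda>n. max (a n - L) 0) \<longlonglongrightarrow> 0"
proof -
  let ?u = "\<lambda>n. ereal (a n)"
  have "a n \<le> B" "- B \<le> a n" for n
    using B[of n] by (simp_all add: abs_le_iff)
  then have "limsup ?u \<le> ereal B" "ereal (- B) \<le> liminf ?u"
    by (simp_all add: Limsup_bounded Liminf_bounded)
  moreover have "liminf ?u \<le> limsup ?u"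
    by (rule Liminf_le_Limsup) simp
  ultimately obtain L where L: "limsup ?u = ereal L"
    by (cases "limsup ?u") auto
  obtain r where r: "strict_mono r" "(?u \<circ> r) \<longlonglongrightarrow> limsup ?u"
    using limsup_subseq_lim by blast
  have "(\<lambda>n. max (a n - L) 0) \<longlonglongrightarrow> 0"
  proof (rule order_tendstoI)
    fix e :: real assume "0 < e"
    then have "limsup ?u < ereal (L + e)" using L by simp
    then show "\<forall>\<^sub>F n in sequentially. max (a n - L) 0 < e"
      using \<open>0 < e\<close> by (elim eventually_mono[OF Limsup_lessD]) auto
  qed (auto intro: always_eventually simp: less_max_iff_disj)
  with that r L show ?thesis by (simp add: o_def)
qed

text \<open>The argument of Erdos, Feller and Pollard: along indices where the solution approaches its upper limit, it
  also does so after shifting by every \<open>k\<close> with \<open>p k > 0\<close>.\<close>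

lemma renewal_shift:
  fixes p a b :: "nat \<Rightarrow> real"
  assumes p: "\<And>k. 0 \<le> p k" "p sums 1"
    and B: "\<And>n. \<bar>a n\<bar> \<le> B" and b: "b \<longlonglongrightarrow> 0"
    and renewal: "\<And>n. a n = b n + (\<Sum>k\<le>n. p k * a (n - k))"
    and upper: "(\<lambda>n. max (a n - L) 0) \<longlonglongrightarrow> 0"
    and h: "filterlim h at_top sequentially" and lim: "(\<lambda>n. a (h n)) \<longlonglongrightarrow> L"
    and k: "p k > 0"
  shows "(\<lambda>n. a (h n - k)) \<longlonglongrightarrow> L"
proof -
  define x where "x n = max (a n - L) 0" for n
  define e where "e n = (\<Sum>j\<le>n. p j * x (n - j))" for n
  have x0: "0 \<le> x n" and xB: "\<bar>x n\<bar> \<le> B + \<bar>L\<bar>" for n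
    using B[of n] by (auto simp: x_def)
  have hk: "filterlim (\<lambda>n. h n - j) at_top sequentially" for j
    using filterlim_compose[OF filterlim_minus_const_nat_at_top h] .
  have xh: "(\<lambda>n. x (h n - j)) \<longlonglongrightarrow> 0" for j
    using filterlim_compose[OF upper[folded x_def] hk] .
  have "(\<lambda>n. e (h n)) \<longlonglongrightarrow> (\<Sum>k. p k) * 0"
    unfolding e_def by (rule convolution_tendsto[OF p(1) sums_summable[OF p(2)] xB h xh])
  moreover have "(\<lambda>n. \<Sum>j\<le>h n. p j) \<longlonglongrightarrow> 1"
    using filterlim_compose[OF p(2)[unfolded sums_def_le] h] .
  then have "(\<lambda>n. L * (\<Sum>j\<le>h n. p j) - a (h n) + b (h n)) \<longlonglongrightarrow> L * 1 - L + 0"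
    by (intro tendsto_intros lim filterlim_compose[OF b h])
  ultimately have up: "(\<lambda>n. (L * (\<Sum>j\<le>h n. p j) - a (h n) + b (h n)) + e (h n)) \<longlonglongrightarrow> 0"
    using tendsto_add by fastforce
  have lo: "(\<lambda>n. - (p k * x (h n - k))) \<longlonglongrightarrow> 0"
    using tendsto_minus[OF tendsto_mult[OF tendsto_const xh]] by simp
  \<comment> \<open>Adding the excess \<open>x\<close> makes all summands
    \<open>p j * (L - a (h n - j) + x (h n - j))\<close> non-negative, so the one with index
    \<open>k\<close> is at most their sum. By the renewal equation that sum is \<open>L\<close>
    times a partial mass of \<open>p\<close>, minus a - b, plus \<open>e\<close>, and tends to zero
    along \<open>h\<close>.\<close>
  have "(\<lambda>n. p k * (L - a (h n - k))) \<longlonglongrightarrow> 0"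
  proof (rule tendsto_sandwich[OF _ _ lo up])
    have "- x m \<le> L - a m" for m by (simp add: x_def)
    then show "\<forall>\<^sub>F n in sequentially. - (p k * x (h n - k)) \<le> p k * (L - a (h n - k))"
      using mult_left_mono[OF _ p(1)] by (auto intro!: always_eventually) (metis mult_minus_right)
    have "\<forall>\<^sub>F n in sequentially. k \<le> h n"
      using h by (simp add: filterlim_at_top)
    then show "\<forall>\<^sub>F n in sequentially. p k * (L - a (h n - k)) \<le>
        (L * (\<Sum>j\<le>h n. p j) - a (h n) + b (h n)) + e (h n)"
    proof eventually_elim
      case (elim n)
      let ?N = "h n"
      have "p k * (L - a (?N - k)) \<le> p k * (L - a (?N - k) + x (?N - k))"
        using p(1) x0 by (intro mult_left_mono) auto
      also have "\<dots> \<le> (\<Sum>j\<le>?N. p j * (L - a (?N - j) + x (?N - j)))"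
        using elim p(1) by (intro member_le_sum[where f = "\<lambda>j. p j * (L - a (?N - j) + x (?N - j))"])
          (auto simp: x_def intro!: mult_nonneg_nonneg)
      also have "\<dots> = L * (\<Sum>j\<le>?N. p j) - (\<Sum>j\<le>?N. p j * a (?N - j)) + e ?N"
        by (simp add: e_def algebra_simps sum.distrib sum_subtractf sum_distrib_left)
      also have "(\<Sum>j\<le>?N. p j * a (?N - j)) = a ?N - b ?N"
        using renewal[of ?N] by simp
      finally show ?case by simp
    qed
  qed
  from tendsto_mult[OF tendsto_const[of "1 / p k"] this]
  have "(\<lambda>n. L - a (h n - k)) \<longlonglongrightarrow> 0"
    using k by simp
  from tendsto_diff[OF tendsto_const[of L] this] show ?thesis by simp
qed

text \<open>The shift lemma spreads the upper limit to all large shifts of a subsequence;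
  \<open>renewal_sum_identity\<close> then passes to the limit there and determines its value. The
  same for \<open>- a\<close> gives the lower limit.\<close>

theorem renewal_theorem:
  fixes p a b :: "nat \<Rightarrow> real"
  assumes p: "\<And>k. 0 \<le> p k" "p 0 = 0" "p sums 1"
    and mean: "(\<lambda>k. real k * p k) sums \<mu>"
    and aperiodic: "\<And>d. (\<And>k. p k > 0 \<Longrightarrow> d dvd k) \<Longrightarrow> d = 1"
    and b: "summable (\<lambda>n. \<bar>b n\<bar>)"
    and renewal: "\<And>n. a n = b n + (\<Sum>k\<le>n. p k * a (n - k))"
  shows "a \<longlonglongrightarrow> suminf b / \<mu>"
proof -
  define q where "q k = 1 - (\<Sum>j\<le>k. p j)" for k
  have q: "q sums \<mu>"
    using tail_sum_sums_mean[OF p(1,3) mean] by (simp add: q_def[abs_def])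
  have q0: "0 \<le> q k" for k
    using sum_le_suminf[OF sums_summable[OF p(3)], of "{..k}"] p sums_unique[OF p(3)]
    by (auto simp: q_def)
  have "q 0 = 1" using p(2) by (simp add: q_def)
  then have \<mu>: "\<mu> \<ge> 1"
    using sum_le_suminf[OF sums_summable[OF q], of "{0}"] q0 sums_unique[OF q] by auto
  have bounded: "\<bar>a n\<bar> \<le> (\<Sum>k. \<bar>b k\<bar>)" for n
  proof -
    \<comment> \<open>The absolute values solve a renewal equation with forcing term at most
      \<open>\<bar>b n\<bar>\<close>. In the tail identity the term with \<open>k = 0\<close> has
      weight \<open>q 0 = 1\<close> and the others are non-negative.\<close>
    define b' where "b' n = \<bar>a n\<bar> - (\<Sum>k\<le>n. p k * \<bar>a (n - k)\<bar>)" for n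
    have "b' n \<le> \<bar>b n\<bar>" for n
    proof -
      have "\<bar>a n\<bar> \<le> \<bar>b n\<bar> + \<bar>\<Sum>k\<le>n. p k * a (n - k)\<bar>"
        using renewal[of n] by linarith
      also have "\<bar>\<Sum>k\<le>n. p k * a (n - k)\<bar> \<le> (\<Sum>k\<le>n. p k * \<bar>a (n - k)\<bar>)"
        using p(1) by (intro order.trans[OF sum_abs]) (simp add: abs_mult)
      finally show ?thesis by (simp add: b'_def)
    qed
    then have "(\<Sum>k\<le>n. b' k) \<le> (\<Sum>k\<le>n. \<bar>b k\<bar>)"
      by (rule sum_mono)
    also have "\<dots> \<le> (\<Sum>k. \<bar>b k\<bar>)"
      by (rule sum_le_suminf[OF b]) auto
    also have "(\<Sum>k\<le>n. b' k) = (\<Sum>k\<le>n. q k * \<bar>a (n - k)\<bar>)"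
      unfolding q_def
      by (rule renewal_sum_identity[of p "\<lambda>n. \<bar>a n\<bar>" b', symmetric]) (auto simp: p b'_def)
    finally have "(\<Sum>k\<le>n. q k * \<bar>a (n - k)\<bar>) \<le> (\<Sum>k. \<bar>b k\<bar>)" .
    moreover have "q 0 * \<bar>a (n - 0)\<bar> \<le> (\<Sum>k\<le>n. q k * \<bar>a (n - k)\<bar>)"
      using q0 by (intro member_le_sum[where f = "\<lambda>k. q k * \<bar>a (n - k)\<bar>"]) auto
    ultimately show ?thesis using \<open>q 0 = 1\<close> by simp
  qed
  have limsup: "limsup (\<lambda>n. ereal (a' n)) = ereal (suminf b' / \<mu>)"
    if bd: "\<And>n. \<bar>a' n\<bar> \<le> B" and b': "summable b'"
      and ren: "\<And>n. a' n = b' n + (\<Sum>k\<le>n. p k * a' (n - k))" for a' b' :: "nat \<Rightarrow> real" and B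
  proof -
    from bounded_sequence_limsup[of a' B, OF bd] obtain L r where
      L: "strict_mono r" "(\<lambda>n. a' (r n)) \<longlonglongrightarrow> L" "limsup (\<lambda>n. ereal (a' n)) = ereal L"
         "(\<lambda>n. max (a' n - L) 0) \<longlonglongrightarrow> 0" by metis
    \<comment> \<open>The shifts that preserve convergence to \<open>L\<close>. Quantifying over all
      index sequences \<open>h\<close> makes this set closed under addition.\<close>
    define S where "S = {j. \<forall>h. filterlim h at_top sequentially \<longrightarrow>
      (\<lambda>n. a' (h n)) \<longlonglongrightarrow> L \<longrightarrow> (\<lambda>n. a' (h n - j)) \<longlonglongrightarrow> L}"
    have "\<exists>N. \<forall>n\<ge>N. n \<in> S"
    proof (rule numerical_semigroup_cofinite)
      show "0 \<in> S" by (simp add: S_def)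
      show "i + j \<in> S" if "i \<in> S" "j \<in> S" for i j
      proof -
        have "(\<lambda>n. a' (h n - (i + j))) \<longlonglongrightarrow> L"
          if h: "filterlim h at_top sequentially" "(\<lambda>n. a' (h n)) \<longlonglongrightarrow> L" for h
        proof -
          have "filterlim (\<lambda>n. h n - i) at_top sequentially"
            using filterlim_compose[OF filterlim_minus_const_nat_at_top h(1)] .
          moreover have "(\<lambda>n. a' (h n - i)) \<longlonglongrightarrow> L"
            using \<open>i \<in> S\<close> h by (auto simp: S_def)
          ultimately have "(\<lambda>n. a' (h n - i - j)) \<longlonglongrightarrow> L"
            using \<open>j \<in> S\<close> by (auto simp: S_def)
          then show ?thesis by simp
        qed
        then show ?thesis by (simp add: S_def)
      qed
      show "d = 1" if d: "\<And>s. s \<in> S \<Longrightarrow> d dvd s" for d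
      proof (rule aperiodic)
        fix k assume "p k > 0"
        then have "k \<in> S"
          unfolding S_def
          using renewal_shift[OF p(1,3) bd summable_LIMSEQ_zero[OF b'] ren L(4)] by blast
        then show "d dvd k" by (rule d)
      qed
    qed
    then obtain J where J: "\<And>j. j \<ge> J \<Longrightarrow> j \<in> S" by blast
    have r: "filterlim r at_top sequentially"
      using L(1) by (rule filterlim_subseq)
    \<comment> \<open>Starting \<open>J\<close> below the subsequence turns each shift by
      \<open>k\<close> into a shift of \<open>r\<close> by \<open>J + k\<close>, which lies in
      \<open>S\<close>.\<close>
    define h where "h n = r n - J" for n
    have h: "filterlim h at_top sequentially"
      unfolding h_def using filterlim_compose[OF filterlim_minus_const_nat_at_top r] .
    have "(\<lambda>n. a' (h n - k)) \<longlonglongrightarrow> L" for k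
      using J[of "J + k"] r L(2) by (simp add: S_def h_def)
    then have "(\<lambda>n. \<Sum>k\<le>h n. q k * a' (h n - k)) \<longlonglongrightarrow> suminf q * L"
      by (intro convolution_tendsto[where x = a', OF q0 sums_summable[OF q] bd h])
    moreover have "(\<Sum>k\<le>n. q k * a' (n - k)) = (\<Sum>k\<le>n. b' k)" for n
      unfolding q_def using renewal_sum_identity[of p a' b'] p ren by blast
    moreover have "(\<lambda>n. \<Sum>k\<le>h n. b' k) \<longlonglongrightarrow> suminf b'"
      using filterlim_compose[OF summable_sums[OF b', unfolded sums_def_le] h] .
    ultimately have "suminf q * L = suminf b'"
      using LIMSEQ_unique by auto
    then have "L = suminf b' / \<mu>"
      using \<mu> sums_unique[OF q] by (simp add: field_simps)
    then show ?thesis using L(3) by simp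
  qed
  have sb: "summable b" using b by (rule summable_rabs_cancel)
  have up: "limsup (\<lambda>n. ereal (a n)) = ereal (suminf b / \<mu>)"
    by (rule limsup[OF bounded sb renewal])
  have "limsup (\<lambda>n. ereal (- a n)) = ereal (suminf (\<lambda>n. - b n) / \<mu>)"
  proof (rule limsup)
    show "\<bar>- a n\<bar> \<le> (\<Sum>k. \<bar>b k\<bar>)" for n using bounded by simp
    show "summable (\<lambda>n. - b n)" using sb by (rule summable_minus)
    show "- a n = - b n + (\<Sum>k\<le>n. p k * - a (n - k))" for n
      using renewal[of n] by (simp add: sum_negf)
  qed
  then have "liminf (\<lambda>n. ereal (a n)) = ereal (suminf b / \<mu>)"
    using ereal_Limsup_uminus[of sequentially "\<lambda>n. ereal (a n)"] suminf_minus[OF sb]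
    by (cases "liminf (\<lambda>n. ereal (a n))") auto
  from Liminf_eq_Limsup[OF _ this up] show ?thesis
    by simp
qed

section \<open>Weighted sums and non-negative matrices\<close>

lemma infsum_eq_suminf_real:
  fixes f :: "nat \<Rightarrow> real"
  assumes "summable (\<lambda>n. \<bar>f n\<bar>)"
  shows "infsum f UNIV = suminf f"
  using assms norm_summable_imp_has_sum[of f "suminf f"] summable_rabs_cancel[OF assms]
  by (auto intro!: infsumI simp: summable_sums)

text \<open>Fubini for double series, obtained from unconditional summability over pairs of
  indices.\<close>

lemma
  fixes f :: "nat \<Rightarrow> nat \<Rightarrow> real"
  assumes row: "\<And>k. summable (\<lambda>j. \<bar>f k j\<bar>)" and total: "summable (\<lambda>k. \<Sum>j. \<bar>f k j\<bar>)"
  shows summable_double_column: "summable (\<lambda>k. \<bar>f k j\<bar>)"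
    and summable_double_swap: "summable (\<lambda>j. \<Sum>k. \<bar>f k j\<bar>)"
    and suminf_double_swap: "(\<Sum>j. \<Sum>k. f k j) = (\<Sum>k. \<Sum>j. f k j)"
proof -
  have on_iff: "(\<lambda>n. \<bar>g n\<bar>) summable_on UNIV \<longleftrightarrow> summable (\<lambda>n. \<bar>g n\<bar>)" for g :: "nat \<Rightarrow> real"
    using summable_on_UNIV_nonneg_real_iff[of "\<lambda>n. \<bar>g n\<bar>"] by simp
  have inf_abs: "(\<Sum>\<^sub>\<infinity>n. \<bar>g n\<bar>) = (\<Sum>n. \<bar>g n\<bar>)" if "summable (\<lambda>n. \<bar>g n\<bar>)" for g :: "nat \<Rightarrow> real"
    using infsum_eq_suminf_real[of "\<lambda>n. \<bar>g n\<bar>"] that by simp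
  have nonneg: "0 \<le> (\<Sum>j. \<bar>f k j\<bar>)" for k
    by (rule suminf_nonneg[OF row]) simp
  have F: "(\<lambda>x. norm (case x of (k, j) \<Rightarrow> f k j)) summable_on UNIV \<times> UNIV"
    unfolding Infinite_Sum.abs_summable_on_Sigma_iff using row total nonneg
    by (simp add: on_iff inf_abs summable_on_UNIV_nonneg_real_iff)
  then have "(\<lambda>x. norm (case x of (j, k) \<Rightarrow> f k j)) summable_on UNIV \<times> UNIV"
    using summable_on_swap[of "\<lambda>x. norm (case x of (k, j) \<Rightarrow> f k j)" UNIV UNIV]
    by (simp add: case_prod_unfold)
  then have G: "\<And>j. (\<lambda>k. \<bar>f k j\<bar>) summable_on UNIV"
      "(\<lambda>j. \<bar>\<Sum>\<^sub>\<infinity>k. \<bar>f k j\<bar>\<bar>) summable_on UNIV"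
    unfolding Infinite_Sum.abs_summable_on_Sigma_iff by simp_all
  show col: "summable (\<lambda>k. \<bar>f k j\<bar>)" for j
    using G(1)[of j] by (simp add: on_iff)
  have nonneg': "0 \<le> (\<Sum>k. \<bar>f k j\<bar>)" for j
    by (rule suminf_nonneg[OF col]) simp
  show tot': "summable (\<lambda>j. \<Sum>k. \<bar>f k j\<bar>)"
    using G(2) nonneg' by (simp add: inf_abs[OF col] summable_on_UNIV_nonneg_real_iff)
  have r: "summable (\<lambda>k. \<bar>\<Sum>j. f k j\<bar>)"
    by (rule summable_comparison_test'[OF total, of 0]) (simp add: summable_rabs[OF row])
  have c: "summable (\<lambda>j. \<bar>\<Sum>k. f k j\<bar>)"
    by (rule summable_comparison_test'[OF tot', of 0]) (simp add: summable_rabs[OF col])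
  have "(\<lambda>(k, j). f k j) summable_on UNIV \<times> UNIV"
    using F by (rule Infinite_Sum.abs_summable_summable)
  from infsum_swap_banach[OF this]
  show "(\<Sum>j. \<Sum>k. f k j) = (\<Sum>k. \<Sum>j. f k j)"
    by (simp add: infsum_eq_suminf_real row col r c)
qed

text \<open>Row vectors are finite measures on the types, paired with bounded column vectors; then
  every \<open>dot\<close> converges absolutely and is linear and monotone in its second
  argument.\<close>

definition weight :: "(nat \<Rightarrow> real) \<Rightarrow> bool" where
  "weight a \<longleftrightarrow> (\<forall>j. 0 \<le> a j) \<and> summable a"

lemma weight_nonneg: "weight a \<Longrightarrow> 0 \<le> a j"
  and weight_summable: "weight a \<Longrightarrow> summable a"
  by (simp_all add: weight_def)

lemma weight_abs_summable_mult:
  assumes "weight a" and "bounded (range t)"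
  shows "summable (\<lambda>j. \<bar>a j * t j\<bar>)"
proof -
  obtain C where C: "\<And>j. \<bar>t j\<bar> \<le> C"
    using assms(2) by (auto simp: bounded_iff)
  show ?thesis
  proof (rule summable_comparison_test'[of "\<lambda>j. a j * C" 0])
    show "summable (\<lambda>j. a j * C)"
      using assms(1) by (intro summable_mult2) (simp add: weight_def)
    show "norm \<bar>a j * t j\<bar> \<le> a j * C" for j
      using C assms(1) by (auto simp: abs_mult weight_def intro: mult_left_mono)
  qed
qed

lemma weight_summable_mult:
  "weight a \<Longrightarrow> bounded (range t) \<Longrightarrow> summable (\<lambda>j. a j * t j)"
  using weight_abs_summable_mult by (rule summable_rabs_cancel)

lemma dot_add:
  assumes "weight a" "bounded (range s)" "bounded (range t)"
  shows "dot a (\<lambda>j. s j + t j) = dot a s + dot a t"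
  unfolding dot_def using assms by (simp add: suminf_add weight_summable_mult distrib_left)

lemma dot_diff:
  assumes "weight a" "bounded (range s)" "bounded (range t)"
  shows "dot a (\<lambda>j. s j - t j) = dot a s - dot a t"
  unfolding dot_def using assms by (simp add: suminf_diff weight_summable_mult right_diff_distrib)

lemma dot_cmult:
  assumes "weight a" "bounded (range t)"
  shows "dot a (\<lambda>j. c * t j) = c * dot a t"
  unfolding dot_def suminf_mult[OF weight_summable_mult[OF assms], symmetric]
  by (simp add: mult.left_commute)

lemma dot_const: "weight a \<Longrightarrow> dot a (\<lambda>_. c) = suminf a * c"
  unfolding dot_def by (simp add: suminf_mult2 weight_def)

lemma dot_zero [simp]: "dot a (\<lambda>_. 0) = 0"
  by (simp add: dot_def)

lemma dot_mono:
  assumes "weight a" "bounded (range s)" "bounded (range t)" "\<And>j. s j \<le> t j"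
  shows "dot a s \<le> dot a t"
  unfolding dot_def using assms
  by (intro suminf_le weight_summable_mult mult_left_mono) (auto simp: weight_def)

lemma dot_nonneg: "weight a \<Longrightarrow> bounded (range t) \<Longrightarrow> (\<And>j. 0 \<le> t j) \<Longrightarrow> 0 \<le> dot a t"
  using dot_mono[of a "\<lambda>_. 0" t] by simp

lemma dot_pos_iff:
  assumes "weight a" "bounded (range t)" "\<And>j. 0 \<le> t j"
  shows "0 < dot a t \<longleftrightarrow> (\<exists>j. 0 < a j \<and> 0 < t j)"
  unfolding dot_def using assms
  by (subst suminf_pos_iff)
     (auto simp: weight_summable_mult weight_nonneg zero_less_mult_iff less_le)

lemma dot_sum:
  assumes "weight a" "finite K" "\<And>k. k \<in> K \<Longrightarrow> bounded (range (f k))"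
  shows "dot a (\<lambda>j. \<Sum>k\<in>K. f k j) = (\<Sum>k\<in>K. dot a (f k))"
  unfolding dot_def sum_distrib_left
  by (rule suminf_sum) (use assms weight_summable_mult in blast)

lemma bounded_range_add:
  fixes s t :: "nat \<Rightarrow> real"
  shows "bounded (range s) \<Longrightarrow> bounded (range t) \<Longrightarrow> bounded (range (\<lambda>j. s j + t j))"
  by (rule bounded_plus_comp)

lemma bounded_range_cmult:
  fixes t :: "nat \<Rightarrow> real"
  shows "bounded (range t) \<Longrightarrow> bounded (range (\<lambda>j. c * t j))"
  using bounded_scaling[of "range t" c] by (simp add: image_image)

lemma bounded_range_const [simp]: "bounded (range (\<lambda>j::nat. c :: real))"
  by (rule bounded_subset[of "{c}"]) auto

lemma bounded_range_le: "(\<And>j. \<bar>t j\<bar> \<le> C) \<Longrightarrow> bounded (range t)" for t :: "nat \<Rightarrow> real"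
  by (auto simp: bounded_iff)

lemma bounded_range_sum:
  fixes f :: "'k \<Rightarrow> nat \<Rightarrow> real"
  assumes "finite K" "\<And>k. k \<in> K \<Longrightarrow> bounded (range (f k))"
  shows "bounded (range (\<lambda>j. \<Sum>k\<in>K. f k j))"
  using assms by (induction K) (auto intro: bounded_range_add)

text \<open>Associativity (a B) t = a (B t). The uniform bound \<open>C\<close> on the row sums
  yields the majorant \<open>a k * (C * D)\<close> for the exchange of sums.\<close>

lemma
  assumes a: "weight a" and B: "\<And>k. weight (B k)" and C: "\<And>k. suminf (B k) \<le> C"
  shows weight_dot_column: "weight (\<lambda>j. dot a (\<lambda>k. B k j))"
    and dot_dot_swap: "bounded (range t) \<Longrightarrow>
      dot (\<lambda>j. dot a (\<lambda>k. B k j)) t = dot a (\<lambda>k. dot (B k) t)"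
proof -
  have sB: "0 \<le> suminf (B k)" for k
    using B by (auto simp: weight_def intro: suminf_nonneg)
  have bB: "bounded (range (\<lambda>k. B k j))" for j
  proof (rule bounded_range_le)
    show "\<bar>B k j\<bar> \<le> C" for k
      using sum_le_suminf[OF weight_summable[OF B], of "{j}" k] C[of k] weight_nonneg[OF B]
      by (force intro: order.trans)
  qed
  have swap: "summable (\<lambda>j. (\<Sum>k. \<bar>a k * B k j * t j\<bar>))"
      "(\<Sum>j. \<Sum>k. a k * B k j * t j) = (\<Sum>k. \<Sum>j. a k * B k j * t j)"
    if t: "bounded (range t)" for t
  proof -
    obtain D where D: "\<And>j. \<bar>t j\<bar> \<le> D"
      using t by (auto simp: bounded_iff)
    have row: "summable (\<lambda>j. \<bar>a k * B k j * t j\<bar>)" for k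
      using summable_mult[OF weight_abs_summable_mult[OF B t], of "\<bar>a k\<bar>" k]
      by (simp add: abs_mult mult.assoc)
    have "summable (\<lambda>k. \<Sum>j. \<bar>a k * B k j * t j\<bar>)"
    proof (rule summable_comparison_test'[of "\<lambda>k. a k * (C * D)" 0])
      show "summable (\<lambda>k. a k * (C * D))"
        using a by (intro summable_mult2) (simp add: weight_def)
      fix k
      have D0: "0 \<le> D" using D[of 0] by linarith
      have "(\<Sum>j. \<bar>a k * B k j * t j\<bar>) \<le> (\<Sum>j. a k * D * B k j)"
      proof (rule suminf_le[OF _ row])
        show "summable (\<lambda>j. a k * D * B k j)"
          using B by (intro summable_mult) (simp add: weight_def)
        show "\<bar>a k * B k j * t j\<bar> \<le> a k * D * B k j" for j
          using mult_left_mono[OF D[of j], of "a k * B k j"] weight_nonneg[OF a, of k]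
            weight_nonneg[OF B, of k j] by (simp add: abs_mult mult_ac)
      qed
      also have "\<dots> = a k * D * suminf (B k)"
        by (rule suminf_mult[OF weight_summable[OF B]])
      also have "\<dots> \<le> a k * (C * D)"
        using mult_left_mono[OF C[of k], of "a k * D"] D0 weight_nonneg[OF a, of k]
        by (simp add: mult_ac)
      finally show "norm (\<Sum>j. \<bar>a k * B k j * t j\<bar>) \<le> a k * (C * D)"
        using suminf_nonneg[OF row] by simp
    qed
    from summable_double_swap[OF row this] suminf_double_swap[OF row this]
    show "summable (\<lambda>j. (\<Sum>k. \<bar>a k * B k j * t j\<bar>))"
      "(\<Sum>j. \<Sum>k. a k * B k j * t j) = (\<Sum>k. \<Sum>j. a k * B k j * t j)" by simp_all
  qed
  show "weight (\<lambda>j. dot a (\<lambda>k. B k j))"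
    unfolding weight_def
  proof (intro conjI allI)
    show "0 \<le> dot a (\<lambda>k. B k j)" for j
      by (intro dot_nonneg a bB weight_nonneg[OF B])
    show "summable (\<lambda>j. dot a (\<lambda>k. B k j))"
      using swap(1)[of "\<lambda>_. 1"] weight_nonneg[OF a] weight_nonneg[OF B] by (simp add: dot_def)
  qed
  assume t: "bounded (range t)"
  have "dot (\<lambda>j. dot a (\<lambda>k. B k j)) t = (\<Sum>j. \<Sum>k. a k * B k j * t j)"
    unfolding dot_def
    by (intro suminf_cong suminf_mult2 weight_summable_mult[OF a bB])
  also have "\<dots> = (\<Sum>k. \<Sum>j. a k * B k j * t j)"
    by (rule swap(2)[OF t])
  also have "\<dots> = dot a (\<lambda>k. dot (B k) t)"
    unfolding dot_def mult.assoc
    by (intro suminf_cong suminf_mult weight_summable_mult[OF B t])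
  finally show "dot (\<lambda>j. dot a (\<lambda>k. B k j)) t = dot a (\<lambda>k. dot (B k) t)" .
qed

section \<open>Non-negative matrices as operators on bounded vectors\<close>

definition app :: "(nat \<Rightarrow> nat \<Rightarrow> real) \<Rightarrow> (nat \<Rightarrow> real) \<Rightarrow> nat \<Rightarrow> real" where
  "app A t = (\<lambda>i. dot (A i) t)"

definition unit_vec :: "nat \<Rightarrow> nat \<Rightarrow> real" where
  "unit_vec j = (\<lambda>i. if i = j then 1 else 0)"

lemma bounded_unit_vec [simp]: "bounded (range (unit_vec j))"
  by (rule bounded_range_le[of _ 1]) (simp add: unit_vec_def)

lemma unit_vec_nonneg [simp]: "0 \<le> unit_vec j i"
  by (simp add: unit_vec_def)

lemma mat_pow_eq_app: "mat_pow A n i j = (app A ^^ n) (unit_vec j) i"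
  by (induction n arbitrary: i) (simp_all add: unit_vec_def app_def)

locale nonneg_matrix =
  fixes A :: "nat \<Rightarrow> nat \<Rightarrow> real" and C :: real
  assumes weight: "weight (A i)" and row_le: "suminf (A i) \<le> C"
begin

lemma app_abs_le:
  assumes "\<And>j. \<bar>t j\<bar> \<le> D"
  shows "\<bar>app A t i\<bar> \<le> C * D"
proof -
  have t: "bounded (range t)" using assms by (rule bounded_range_le)
  have D: "0 \<le> D" using assms[of 0] by linarith
  have "t j \<le> D" "- D \<le> t j" for j
    using assms[of j] by (simp_all add: abs_le_iff)
  then have "dot (A i) t \<le> dot (A i) (\<lambda>_. D)" "dot (A i) (\<lambda>_. - D) \<le> dot (A i) t"
    by (intro dot_mono weight t; simp)+
  then show ?thesis
    using mult_right_mono[OF row_le[of i] D] unfolding dot_const[OF weight]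
    by (auto simp: app_def abs_le_iff)
qed

lemma bounded_app: "bounded (range t) \<Longrightarrow> bounded (range (app A t))"
  using app_abs_le bounded_range_le by (metis bounded_iff rangeI real_norm_def)

lemma bounded_app_pow: "bounded (range t) \<Longrightarrow> bounded (range ((app A ^^ n) t))"
  by (induction n) (auto intro: bounded_app)

lemma app_pow_add:
  "bounded (range s) \<Longrightarrow> bounded (range t) \<Longrightarrow>
    (app A ^^ n) (\<lambda>j. s j + t j) = (\<lambda>j. (app A ^^ n) s j + (app A ^^ n) t j)"
  by (induction n) (simp_all add: app_def[of A] dot_add[OF weight] bounded_app_pow)

lemma app_pow_cmult:
  "bounded (range t) \<Longrightarrow> (app A ^^ n) (\<lambda>j. c * t j) = (\<lambda>j. c * (app A ^^ n) t j)"
  by (induction n) (simp_all add: app_def[of A] dot_cmult[OF weight] bounded_app_pow)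

lemma app_pow_mono:
  "bounded (range s) \<Longrightarrow> bounded (range t) \<Longrightarrow> (\<And>j. s j \<le> t j) \<Longrightarrow>
    (app A ^^ n) s i \<le> (app A ^^ n) t i"
  by (induction n arbitrary: i) (simp_all add: app_def[of A] dot_mono[OF weight] bounded_app_pow)

lemma app_zero [simp]: "app A (\<lambda>_. 0) = (\<lambda>_. 0)"
  by (simp add: app_def)

lemma app_pow_zero [simp]: "(app A ^^ n) (\<lambda>_. 0) = (\<lambda>_. 0)"
  by (induction n) simp_all

lemma app_pow_nonneg:
  "bounded (range t) \<Longrightarrow> (\<And>j. 0 \<le> t j) \<Longrightarrow> 0 \<le> (app A ^^ n) t i"
  using app_pow_mono[of "\<lambda>_. 0" t n i] by simp

lemma app_pow_abs_le:
  assumes "\<And>j. \<bar>t j\<bar> \<le> D"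
  shows "\<bar>(app A ^^ n) t i\<bar> \<le> D * (app A ^^ n) (\<lambda>_. 1) i"
proof -
  have t: "bounded (range t)" using assms by (rule bounded_range_le)
  have "t j \<le> D * 1" "- D * 1 \<le> t j" for j
    using assms[of j] by (simp_all add: abs_le_iff)
  then have "(app A ^^ n) t i \<le> (app A ^^ n) (\<lambda>_. D * 1) i"
      "(app A ^^ n) (\<lambda>_. - D * 1) i \<le> (app A ^^ n) t i"
    by (intro app_pow_mono t; simp)+
  then show ?thesis
    unfolding app_pow_cmult[OF bounded_range_const] by (simp add: abs_le_iff)
qed

lemma app_pow_one_le: "(app A ^^ n) (\<lambda>_. 1) i \<le> C ^ n"
proof (induction n arbitrary: i)
  case (Suc n)
  have "\<bar>(app A ^^ n) (\<lambda>_. 1) k\<bar> \<le> C ^ n" for k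
    using Suc[of k] app_pow_nonneg[of "\<lambda>_. 1" n k] by simp
  from abs_le_D1[OF app_abs_le[OF this]] show ?case by simp
qed simp

text \<open>Both parts share one induction: associativity in the step needs the rows of the lower
  power to be weights with uniformly bounded sums, and these sums come from the second part at a
  constant vector.\<close>

lemma
  shows weight_mat_pow: "weight (mat_pow A n i)"
    and dot_mat_pow: "bounded (range t) \<Longrightarrow> dot (mat_pow A n i) t = (app A ^^ n) t i"
proof (induction n arbitrary: i t)
  case 0
  case 1
  have "summable (mat_pow A 0 i)"
    by (rule summable_finite[of "{i}"]) auto
  then show ?case by (simp add: weight_def)
next
  case 0
  case 2
  show ?case
    unfolding dot_def by (subst suminf_finite[of "{i}"]) auto
next
  case (Suc n)
  have "suminf (mat_pow A n k) \<le> C ^ n" for k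
  proof -
    have "suminf (mat_pow A n k) = (app A ^^ n) (\<lambda>_. 1) k"
      using Suc(2)[of "\<lambda>_. 1" k] dot_const[OF Suc(1)] by simp
    also have "\<dots> \<le> C ^ n"
      by (rule app_pow_one_le)
    finally show ?thesis .
  qed
  note * = weight_dot_column[OF weight Suc(1) this] dot_dot_swap[OF weight Suc(1) this]
  { case 1 show ?case using *(1) by simp }
  { case 2 then show ?case using *(2) Suc(2) by (simp add: app_def[of A]) }
qed

lemma suminf_mat_pow: "suminf (mat_pow A n i) = (app A ^^ n) (\<lambda>_. 1) i"
  using dot_mat_pow[of "\<lambda>_. 1" n i] dot_const[OF weight_mat_pow] by simp

end

section \<open>Powers of the mean matrix\<close>

lemma sum_pos_obtain:
  fixes f :: "'k \<Rightarrow> real"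
  assumes "0 < (\<Sum>k\<in>K. f k)"
  obtains k where "k \<in> K" "0 < f k"
proof -
  have "\<exists>k\<in>K. 0 < f k"
  proof (rule ccontr)
    assume "\<not> ?thesis"
    then have "(\<Sum>k\<in>K. f k) \<le> 0"
      by (intro sum_nonpos) (simp add: not_less)
    then show False using assms by simp
  qed
  then show ?thesis using that by blast
qed

locale lf_params =
  fixes H :: "nat \<Rightarrow> nat \<Rightarrow> real" and g :: "nat \<Rightarrow> real" and m :: real
  assumes substochastic: "substochastic H" and prob_vector: "prob_vector g" and m_pos: "0 < m"
begin

sublocale H: nonneg_matrix H 1
  using substochastic by unfold_locales (auto simp: substochastic_def weight_def)

text \<open>The algebraic form H + m H 1 g, as \<open>suminf (H i)\<close> is the entry of H 1 at
  \<open>i\<close>; \<open>expectation_count\<close> identifies it with the expected offspring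
  numbers.\<close>

definition mean :: "nat \<Rightarrow> nat \<Rightarrow> real" where
  "mean i j = H i j + m * suminf (H i) * g j"

abbreviation one :: "nat \<Rightarrow> real" where "one \<equiv> (\<lambda>_. 1)"

definition dk :: "nat \<Rightarrow> real" where "dk n = dot g ((app H ^^ n) one)"

definition aseq :: "(nat \<Rightarrow> real) \<Rightarrow> nat \<Rightarrow> real" where
  "aseq t n = dot g ((app mean ^^ n) t)"

lemma weight_g: "weight g" and suminf_g: "suminf g = 1"
  using prob_vector by (auto simp: prob_vector_def weight_def sums_iff)

lemma app_H_one: "app H one i = suminf (H i)"
  by (simp add: app_def dot_const[OF H.weight])

lemma app_H_one_nonneg: "0 \<le> app H one i"
  using H.app_pow_nonneg[of one 1] by simp

lemma mean_eq: "mean i = (\<lambda>j. H i j + m * app H one i * g j)"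
  by (simp add: mean_def app_H_one fun_eq_iff)

lemma suminf_mean: "suminf (mean i) = (1 + m) * app H one i"
proof -
  have "suminf (mean i) = suminf (H i) + m * app H one i * suminf g"
    unfolding mean_eq using weight_summable[OF H.weight] weight_summable[OF weight_g]
    by (simp add: suminf_add[symmetric] suminf_mult summable_mult)
  then show ?thesis by (simp add: suminf_g app_H_one algebra_simps)
qed

sublocale M: nonneg_matrix mean "1 + m"
proof
  show "weight (mean i)" for i
    unfolding weight_def mean_eq
    using H.weight[of i] weight_g m_pos app_H_one_nonneg[of i]
    by (auto simp: weight_def intro!: summable_add summable_mult)
  show "suminf (mean i) \<le> 1 + m" for i
    using mult_left_mono[OF H.row_le[of i], of "1 + m"] m_pos
    by (simp add: suminf_mean app_H_one)
qed

lemma app_mean: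
  assumes t: "bounded (range t)"
  shows "app mean t i = app H t i + m * dot g t * app H one i"
proof -
  have "dot (mean i) t = (\<Sum>j. H i j * t j + m * app H one i * (g j * t j))"
    by (simp add: dot_def mean_eq algebra_simps)
  also have "\<dots> = dot (H i) t + m * app H one i * dot g t"
    unfolding dot_def
    by (subst suminf_add[symmetric])
       (auto intro!: weight_summable_mult[OF H.weight t] weight_summable_mult[OF weight_g t]
         summable_mult suminf_mult[symmetric] simp: suminf_mult weight_summable_mult[OF weight_g t])
  finally show ?thesis by (simp add: app_def mult_ac)
qed

lemma aseq_nonneg: "bounded (range t) \<Longrightarrow> (\<And>j. 0 \<le> t j) \<Longrightarrow> 0 \<le> aseq t n"
  unfolding aseq_def by (intro dot_nonneg weight_g M.bounded_app_pow M.app_pow_nonneg)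

lemma dk_nonneg: "0 \<le> dk n"
  unfolding dk_def by (intro dot_nonneg weight_g H.bounded_app_pow H.app_pow_nonneg) auto

lemma dk_0 [simp]: "dk 0 = 1"
  by (simp add: dk_def dot_const[OF weight_g] suminf_g)

lemma aseq_add:
  "bounded (range s) \<Longrightarrow> bounded (range t) \<Longrightarrow> aseq (\<lambda>j. s j + t j) n = aseq s n + aseq t n"
  by (simp add: aseq_def M.app_pow_add dot_add[OF weight_g] M.bounded_app_pow)

lemma aseq_cmult: "bounded (range t) \<Longrightarrow> aseq (\<lambda>j. c * t j) n = c * aseq t n"
  by (simp add: aseq_def M.app_pow_cmult dot_cmult[OF weight_g] M.bounded_app_pow)

lemma aseq_abs_le:
  assumes "\<And>j. \<bar>t j\<bar> \<le> D"
  shows "\<bar>aseq t n\<bar> \<le> D * aseq one n"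
proof -
  have t: "bounded (range t)" using assms by (rule bounded_range_le)
  have "t j \<le> D * 1" "- D * 1 \<le> t j" for j
    using assms[of j] by (simp_all add: abs_le_iff)
  then have "aseq t n \<le> aseq (\<lambda>j. D * 1) n" "aseq (\<lambda>j. - D * 1) n \<le> aseq t n"
    unfolding aseq_def by (intro dot_mono weight_g M.bounded_app_pow M.app_pow_mono t; simp)+
  then show ?thesis
    unfolding aseq_cmult[OF bounded_range_const] by (simp add: abs_le_iff)
qed

text \<open>The value \<open>0\<close> at \<open>k = 0\<close>, here and for \<open>pk\<close> below, lets the convolutions run over all
  \<open>k \<le> n\<close>.\<close>

definition hk :: "nat \<Rightarrow> nat \<Rightarrow> real" where
  "hk k i = (if k = 0 then 0 else (app H ^^ k) one i)"

lemma hk_0 [simp]: "hk 0 i = 0"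
  by (simp add: hk_def)

lemma hk_nonneg: "0 \<le> hk k i"
  using H.app_pow_nonneg[of one k i] by (simp add: hk_def)

lemma bounded_hk: "bounded (range (hk k))"
  using H.bounded_app_pow[of one k] by (cases "k = 0") (simp_all add: hk_def[abs_def])

text \<open>The powers of the mean matrix are decomposed at the first use of its rank-one part
  \<open>m H 1 g\<close>.\<close>

lemma mean_pow_decomposition:
  assumes t: "bounded (range t)"
  shows "(app mean ^^ n) t i = (app H ^^ n) t i + m * (\<Sum>k\<le>n. hk k i * aseq t (n - k))"
proof (induction n arbitrary: i)
  case 0
  then show ?case by (simp add: hk_def)
next
  case (Suc n)
  \<comment> \<open>The default \<open>hk 0 i = 0\<close> breaks the recursion only at
    \<open>k = 0\<close>; the missing \<open>app H one i\<close> is supplied by the rank-one part of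
    the new left factor.\<close>
  have step: "hk (Suc k) i = dot (H i) (hk k) + (if k = 0 then app H one i else 0)" for k
    by (cases "k = 0") (simp_all add: hk_def[abs_def] app_def[of H])
  have bnd: "bounded (range (\<lambda>j. hk k j * c))" for k c
    using bounded_range_cmult[OF bounded_hk, of c k] by (simp add: mult.commute)
  have dk': "dot (H i) (\<lambda>j. hk k j * c) = dot (H i) (hk k) * c" for k c
    using dot_cmult[OF H.weight bounded_hk, of i c k] by (simp add: mult.commute)
  have "(app mean ^^ Suc n) t i = dot (H i) ((app mean ^^ n) t) + m * aseq t n * app H one i"
    using app_mean[OF M.bounded_app_pow[OF t]] by (simp add: aseq_def app_def[of H])
  also have "(app mean ^^ n) t = (\<lambda>j. (app H ^^ n) t j + m * (\<Sum>k\<le>n. hk k j * aseq t (n - k)))"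
    using Suc by blast
  also have "dot (H i) \<dots> = dot (H i) ((app H ^^ n) t) + m * (\<Sum>k\<le>n. dot (H i) (hk k) * aseq t (n - k))"
    by (simp add: dot_add[OF H.weight] dot_cmult[OF H.weight] dot_sum[OF H.weight] dk'
        H.bounded_app_pow[OF t] bounded_range_cmult bounded_range_sum bnd)
  also have "dot (H i) ((app H ^^ n) t) = (app H ^^ Suc n) t i"
    by (simp add: app_def[of H])
  also have "(\<Sum>k\<le>Suc n. hk k i * aseq t (Suc n - k)) =
      (\<Sum>k\<le>n. dot (H i) (hk k) * aseq t (n - k)) + app H one i * aseq t n"
  proof -
    have "(\<Sum>k\<le>Suc n. hk k i * aseq t (Suc n - k)) = (\<Sum>k\<le>n. hk (Suc k) i * aseq t (n - k))"
      by (subst sum.atMost_Suc_shift) (simp add: hk_def)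
    also have "\<dots> = (\<Sum>k\<le>n. dot (H i) (hk k) * aseq t (n - k) +
        (if k = 0 then app H one i * aseq t n else 0))"
      by (intro sum.cong) (auto simp: step distrib_right)
    also have "\<dots> = (\<Sum>k\<le>n. dot (H i) (hk k) * aseq t (n - k)) + app H one i * aseq t n"
      by (simp add: sum.distrib)
    finally show ?thesis .
  qed
  ultimately show ?case by (simp add: algebra_simps)
qed

definition pk :: "nat \<Rightarrow> real" where "pk k = (if k = 0 then 0 else m * dk k)"

lemma pk_0 [simp]: "pk 0 = 0"
  by (simp add: pk_def)

lemma pk_nonneg: "0 \<le> pk k"
  using m_pos dk_nonneg by (simp add: pk_def)

lemma aseq_renewal:
  assumes t: "bounded (range t)"
  shows "aseq t n = dot g ((app H ^^ n) t) + (\<Sum>k\<le>n. pk k * aseq t (n - k))"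
proof -
  have bnd: "bounded (range (\<lambda>j. hk k j * c))" for k c
    using bounded_range_cmult[OF bounded_hk, of c k] by (simp add: mult.commute)
  have hk: "dot g (\<lambda>j. hk k j * c) = dot g (hk k) * c" for k c
    using dot_cmult[OF weight_g bounded_hk, of c k] by (simp add: mult.commute)
  have pk: "pk k = m * dot g (hk k)" for k
    by (simp add: pk_def hk_def[abs_def] dk_def)
  have "aseq t n = dot g (\<lambda>i. (app H ^^ n) t i + m * (\<Sum>k\<le>n. hk k i * aseq t (n - k)))"
    unfolding aseq_def[of t n] by (rule arg_cong[of _ _ "dot g"]) (simp add: fun_eq_iff mean_pow_decomposition[OF t])
  also have "\<dots> = dot g ((app H ^^ n) t) + (\<Sum>k\<le>n. pk k * aseq t (n - k))"
    by (simp add: dot_add[OF weight_g] dot_cmult[OF weight_g] dot_sum[OF weight_g] hk pk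
        H.bounded_app_pow[OF t] bounded_range_cmult bounded_range_sum bnd sum_distrib_left mult.assoc)
  finally show ?thesis .
qed

text \<open>By monotonicity, as \<open>x\<close> dominates its restriction to type \<open>i\<close>.
  In terms of paths, only those at \<open>i\<close> after \<open>l\<close> steps from
  \<open>g\<close> are kept; positivity and summability at a single type are derived from
  this.\<close>

lemma dot_g_pow_ge:
  assumes x: "bounded (range x)" "\<And>j. 0 \<le> x j"
  shows "x i * dot g ((app H ^^ l) (unit_vec i)) \<le> dot g ((app H ^^ l) x)"
proof -
  have "dot g ((app H ^^ l) (\<lambda>j. x i * unit_vec i j)) \<le> dot g ((app H ^^ l) x)"
  proof (intro dot_mono weight_g H.bounded_app_pow H.app_pow_mono bounded_range_cmult)
    show "x i * unit_vec i j \<le> x j" for j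
      using x(2) by (simp add: unit_vec_def)
  qed (use x in simp_all)
  then show ?thesis
    by (simp add: H.app_pow_cmult dot_cmult[OF weight_g] H.bounded_app_pow)
qed

lemma pow_unit_nonneg: "0 \<le> (app H ^^ l) (unit_vec i) j" "0 \<le> dot g ((app H ^^ l) (unit_vec i))"
  by (simp_all add: dot_nonneg weight_g H.app_pow_nonneg H.bounded_app_pow)

end

text \<open>Criticality and finite mean are expressed by \<open>pk\<close> alone, which keeps the
  renewal analysis apart from the definition of the Malthusian parameter; \<open>pk_sums_1\<close>
  and \<open>mean_pk_sums\<close> provide both.\<close>

locale critical_lf = lf_params +
  fixes \<beta> :: real
  assumes irreducible: "irreducible_mat mean" and aperiodic: "aperiodic_mat mean"
    and critical: "pk sums 1" and mean_pk: "(\<lambda>k. real k * pk k) sums \<beta>"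
begin

text \<open>If H 1 vanished at \<open>i\<close>, so would row \<open>i\<close> of \<open>H\<close>,
  and the rank-one part of \<open>mean\<close> carries the same factor. Row \<open>i\<close> of
  \<open>mean\<close> would be zero, which rules out a return to \<open>i\<close>.\<close>

lemma app_H_one_pos: "0 < app H one i"
proof -
  obtain n where "n \<ge> 1" "mat_pow mean n i i > 0"
    using irreducible by (auto simp: irreducible_mat_def)
  moreover define x where "x = (app mean ^^ (n - 1)) (unit_vec i)"
  ultimately have pos: "0 < app mean x i"
    by (cases n) (simp_all add: mat_pow_eq_app del: mat_pow.simps)
  have x: "bounded (range x)" "\<And>j. 0 \<le> x j"
    unfolding x_def by (simp_all add: M.bounded_app_pow M.app_pow_nonneg)
  show ?thesis
  proof (rule ccontr)
    assume "\<not> ?thesis"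
    then have 0: "app H one i = 0"
      using app_H_one_nonneg[of i] by linarith
    then have "\<And>j. \<not> 0 < H i j"
      using dot_pos_iff[OF H.weight, of one i] by (auto simp: app_def)
    then have "\<not> 0 < app H x i"
      using dot_pos_iff[OF H.weight x] by (auto simp: app_def)
    then show False
      using pos app_mean[OF x(1), of i] 0 by simp
  qed
qed

text \<open>Otherwise the renewal equation for \<open>unit_vec i\<close> has zero forcing term and
  hence zero solution, whereas irreducibility makes g M^n e_i positive for some n.\<close>

lemma reachable: "\<exists>l. 0 < dot g ((app H ^^ l) (unit_vec i))"
proof (rule ccontr)
  assume "\<not> ?thesis"
  then have 0: "dot g ((app H ^^ l) (unit_vec i)) = 0" for l
    using pow_unit_nonneg(2)[of l i] by (auto simp: not_less intro: antisym)
  have az: "aseq (unit_vec i) n = 0" for n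
  proof (induction n rule: less_induct)
    case (less n)
    have "pk k * aseq (unit_vec i) (n - k) = 0" if "k \<le> n" for k
      using less[of "n - k"] that by (cases "k = 0") (auto simp: pk_def)
    then have "(\<Sum>k\<le>n. pk k * aseq (unit_vec i) (n - k)) = 0"
      by (intro sum.neutral) simp
    then show ?case using aseq_renewal[of "unit_vec i" n] 0 by simp
  qed
  obtain j where j: "0 < g j"
    using dot_pos_iff[OF weight_g, of one] dk_0 by (auto simp: dk_def)
  obtain n where "0 < mat_pow mean n j i"
    using irreducible unfolding irreducible_mat_def by blast
  then have "0 < aseq (unit_vec i) n"
    unfolding aseq_def mat_pow_eq_app
    by (subst dot_pos_iff) (use j in \<open>auto simp: weight_g M.bounded_app_pow M.app_pow_nonneg\<close>)
  then show False using az by simp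
qed

text \<open>Concatenation of \<open>l\<close> steps of \<open>H\<close> from \<open>g\<close> to
  \<open>i\<close> with \<open>k\<close> further steps from \<open>i\<close>.\<close>

lemma pk_add_pos:
  assumes "0 < dot g ((app H ^^ l) (unit_vec i))" "0 < (app H ^^ k) one i" "0 < k"
  shows "0 < pk (l + k)"
proof -
  have "0 < (app H ^^ k) one i * dot g ((app H ^^ l) (unit_vec i))"
    using assms by simp
  also have "\<dots> \<le> dot g ((app H ^^ l) ((app H ^^ k) one))"
    by (intro dot_g_pow_ge H.bounded_app_pow H.app_pow_nonneg) auto
  also have "\<dots> = dk (l + k)"
    by (simp add: dk_def funpow_add)
  finally show ?thesis using m_pos assms(3) by (simp add: pk_def)
qed

text \<open>If \<open>H\<close> leads from \<open>g\<close> to type 0 in \<open>l\<close> steps, one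
  more step is possible, so \<open>d\<close> divides \<open>l + 1\<close>; by the renewal equation
  \<open>d\<close> divides \<open>n + 1\<close> whenever \<open>aseq\<close> of
  \<open>unit_vec 0\<close> is positive at \<open>n\<close>. A return of \<open>mean\<close> to 0 in
  \<open>n\<close> steps either uses \<open>H\<close> alone, and \<open>d\<close> divides both
  \<open>l + 1\<close> and \<open>l + n + 1\<close>, or restarts first after \<open>k\<close> steps,
  and \<open>d\<close> divides (l + k) + (n - k + 1). In both cases \<open>d\<close> divides
  \<open>n\<close>.\<close>

lemma pk_aperiodic:
  assumes d: "\<And>k. 0 < pk k \<Longrightarrow> d dvd k"
  shows "d = 1"
proof -
  let ?e = "unit_vec (0::nat)"
  have reach: "d dvd l + 1" if "0 < dot g ((app H ^^ l) ?e)" for l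
    using d[OF pk_add_pos[OF that, of 1]] app_H_one_pos by simp
  have an: "0 \<le> aseq ?e n" for n
    by (rule aseq_nonneg) simp_all
  have aseq: "d dvd n + 1" if "0 < aseq ?e n" for n
    using that
  proof (induction n rule: less_induct)
    case (less n)
    show ?case
    proof (cases "0 < dot g ((app H ^^ n) ?e)")
      case False
      then have "0 < (\<Sum>k\<le>n. pk k * aseq ?e (n - k))"
        using less.prems aseq_renewal[of ?e n] by simp
      then obtain k where k: "k \<in> {..n}" "0 < pk k * aseq ?e (n - k)"
        by (rule sum_pos_obtain)
      then have "0 < pk k" "0 < aseq ?e (n - k)"
        using pk_nonneg[of k] an[of "n - k"] by (auto simp: zero_less_mult_iff)
      moreover from this have "0 < k" by (simp add: pk_def split: if_splits)
      ultimately have "d dvd k" "d dvd n - k + 1"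
        using d less.IH[of "n - k"] k(1) by auto
      then have "d dvd k + (n - k + 1)" by (rule dvd_add)
      then show ?thesis using k(1) by simp
    qed (rule reach)
  qed
  obtain l where l: "0 < dot g ((app H ^^ l) ?e)"
    using reachable by blast
  have "d dvd n" if "1 \<le> n" "0 < mat_pow mean n 0 0" for n
  proof (cases "0 < (app H ^^ n) ?e 0")
    case True
    then have "0 < (app H ^^ n) ?e 0 * dot g ((app H ^^ l) ?e)"
      using l by simp
    also have "\<dots> \<le> dot g ((app H ^^ l) ((app H ^^ n) ?e))"
      by (intro dot_g_pow_ge H.bounded_app_pow pow_unit_nonneg) auto
    finally have "d dvd (l + n) + 1"
      by (intro reach) (simp add: funpow_add)
    then have "d dvd (l + 1) + n" by (simp add: ac_simps)
    then show ?thesis using reach[OF l] dvd_add_right_iff by blast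
  next
    case False
    have "0 < (app mean ^^ n) ?e 0"
      using that by (simp add: mat_pow_eq_app)
    then have "0 < m * (\<Sum>k\<le>n. hk k 0 * aseq ?e (n - k))"
      using False mean_pow_decomposition[of ?e n 0] by simp
    then have "0 < (\<Sum>k\<le>n. hk k 0 * aseq ?e (n - k))"
      using m_pos by (simp add: zero_less_mult_iff)
    then obtain k where k: "k \<in> {..n}" "0 < hk k 0 * aseq ?e (n - k)"
      by (rule sum_pos_obtain)
    then have *: "0 < hk k 0" "0 < aseq ?e (n - k)"
      using hk_nonneg[of k 0] an[of "n - k"] by (auto simp: zero_less_mult_iff)
    then have "0 < k" "0 < (app H ^^ k) one 0"
      by (auto simp: hk_def split: if_splits)
    then have "d dvd (l + k) + (n - k + 1)"
      using dvd_add[OF d[OF pk_add_pos[OF l, of k]] aseq[OF *(2)]] by blast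
    also have "(l + k) + (n - k + 1) = (l + 1) + n"
      using k(1) by simp
    finally show ?thesis using reach[OF l] dvd_add_right_iff by blast
  qed
  then have "d dvd Gcd {n. n \<ge> 1 \<and> mat_pow mean n 0 0 > 0}"
    by (intro Gcd_greatest) auto
  then show ?thesis
    using aperiodic by (simp add: aperiodic_mat_def)
qed

text \<open>For \<open>R = 1\<close> the vectors of the statement are recovered as
  \<open>v t = m / (1 + m) * V t\<close> and \<open>u i = (1 + m) / \<beta> * U i\<close>.\<close>

definition V :: "(nat \<Rightarrow> real) \<Rightarrow> real" where
  "V t = (\<Sum>k. dot g ((app H ^^ k) t))"

lemma summable_dk: "summable dk"
proof -
  have "summable (\<lambda>k. pk (Suc k))"
    using sums_summable[OF critical] by (subst summable_Suc_iff)
  then have "summable (\<lambda>k. dk (Suc k))"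
    using m_pos by (simp add: pk_def summable_cmult_iff)
  then show ?thesis by (simp add: summable_Suc_iff)
qed

lemma summable_dot_pow:
  assumes t: "bounded (range t)"
  shows "summable (\<lambda>k. \<bar>dot g ((app H ^^ k) t)\<bar>)"
proof -
  obtain D where D: "\<And>j. \<bar>t j\<bar> \<le> D"
    using t by (auto simp: bounded_iff)
  show ?thesis
  proof (rule summable_comparison_test'[of "\<lambda>k. D * dk k" 0])
    show "summable (\<lambda>k. D * dk k)" by (intro summable_mult summable_dk)
    fix k
    have "(app H ^^ k) t j \<le> D * (app H ^^ k) one j" "(- D) * (app H ^^ k) one j \<le> (app H ^^ k) t j" for j
      using H.app_pow_abs_le[of t D k j, OF D] by (simp_all add: abs_le_iff)
    then have "dot g ((app H ^^ k) t) \<le> dot g (\<lambda>j. D * (app H ^^ k) one j)"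
        "dot g (\<lambda>j. (- D) * (app H ^^ k) one j) \<le> dot g ((app H ^^ k) t)"
      by (intro dot_mono weight_g H.bounded_app_pow bounded_range_cmult t; simp)+
    then show "norm \<bar>dot g ((app H ^^ k) t)\<bar> \<le> D * dk k"
      by (simp only: dot_cmult[OF weight_g H.bounded_app_pow[OF bounded_range_const]] dk_def[symmetric])
         (simp add: abs_le_iff)
  qed
qed

text \<open>The forcing term g H^n t of the renewal equation has the sum \<open>V t\<close>.\<close>

lemma aseq_tendsto:
  assumes t: "bounded (range t)"
  shows "aseq t \<longlonglongrightarrow> V t / \<beta>"
  unfolding V_def
  by (rule renewal_theorem[OF pk_nonneg pk_0 critical mean_pk pk_aperiodic summable_dot_pow[OF t]
        aseq_renewal[OF t]])

text \<open>Criticality makes the sum over k \<ge> 1 equal to 1/m, and \<open>dk 0 = 1\<close> is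
  added. This is the normalization of \<open>v\<close> to total mass one.\<close>

lemma V_one: "V one = (1 + m) / m"
proof -
  have "(\<lambda>k. pk (Suc k)) sums 1"
    using critical by (subst sums_Suc_iff) simp
  from sums_mult[OF this, of "1 / m"] have "(\<lambda>k. dk (Suc k)) sums (1 / m)"
    using m_pos by (simp add: pk_def)
  then have "dk sums (1 / m + 1)"
    by (simp add: sums_Suc_iff)
  then show ?thesis
    using m_pos by (simp add: V_def dk_def[abs_def, symmetric] sums_iff field_simps)
qed

lemma beta_ge_1: "1 \<le> \<beta>"
proof -
  have "suminf pk \<le> (\<Sum>k. real k * pk k)"
    using critical mean_pk pk_nonneg
  proof (intro suminf_le)
    show "pk k \<le> real k * pk k" for k
      using mult_right_mono[OF _ pk_nonneg[of k], of 1 "real k"] by (cases "k = 0") (auto simp: pk_def)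
  qed (auto simp: sums_iff)
  then show ?thesis using critical mean_pk by (simp add: sums_iff)
qed

text \<open>\<open>summable_dk\<close> controls only averages with respect to \<open>g\<close>. If
  \<open>i\<close> is reached from \<open>g\<close> in \<open>l\<close> steps with positive weight,
  then \<open>dk (k + l)\<close> divided by that weight is a majorant at \<open>i\<close>.\<close>

lemma summable_pow_one: "summable (\<lambda>k. (app H ^^ k) one i)"
proof -
  obtain l where l: "0 < dot g ((app H ^^ l) (unit_vec i))"
    using reachable by blast
  let ?c = "dot g ((app H ^^ l) (unit_vec i))"
  show ?thesis
  proof (rule summable_comparison_test'[of "\<lambda>k. dk (k + l) / ?c" 0])
    show "summable (\<lambda>k. dk (k + l) / ?c)"
      using summable_ignore_initial_segment[OF summable_dk, of l] by (rule summable_divide)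
    fix k
    have "(app H ^^ k) one i * ?c \<le> dot g ((app H ^^ l) ((app H ^^ k) one))"
      by (intro dot_g_pow_ge H.bounded_app_pow H.app_pow_nonneg) auto
    also have "\<dots> = dk (k + l)"
      by (simp add: dk_def funpow_add add.commute[of k l])
    finally show "norm ((app H ^^ k) one i) \<le> dk (k + l) / ?c"
      using l H.app_pow_nonneg[of one k i] by (simp add: field_simps)
  qed
qed

definition U :: "nat \<Rightarrow> real" where "U i = (\<Sum>k. (app H ^^ Suc k) one i)"

lemma hk_sums: "(\<lambda>k. hk k i) sums U i"
proof -
  have "(\<lambda>k. hk (Suc k) i) sums U i"
    using summable_pow_one[of i] unfolding U_def hk_def
    by (simp del: funpow.simps add: summable_Suc_iff[of "\<lambda>k. (app H ^^ k) one i"] summable_sums)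
  then show ?thesis by (subst (asm) sums_Suc_iff) simp
qed

lemma U_pos: "0 < U i"
  using sum_le_suminf[OF sums_summable[OF hk_sums[of i]], of "{1}"] hk_nonneg app_H_one_pos[of i]
    hk_sums[of i] by (auto simp: sums_iff hk_def)

text \<open>In the decomposition the pure \<open>H\<close> part vanishes, and a summable sequence is
  convolved with a convergent one. The limit is u v t: the powers of \<open>mean\<close> tend to a
  rank-one matrix.\<close>

lemma mean_pow_tendsto:
  assumes t: "bounded (range t)"
  shows "(\<lambda>n. (app mean ^^ n) t i) \<longlonglongrightarrow> m * U i * V t / \<beta>"
proof -
  obtain D where D: "\<And>j. \<bar>t j\<bar> \<le> D"
    using t by (auto simp: bounded_iff)
  have H0: "(\<lambda>n. (app H ^^ n) t i) \<longlonglongrightarrow> 0"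
  proof (rule Lim_null_comparison)
    show "\<forall>\<^sub>F n in sequentially. norm ((app H ^^ n) t i) \<le> D * (app H ^^ n) one i"
      using H.app_pow_abs_le[of t D, OF D] by (intro always_eventually allI) simp
    show "(\<lambda>n. D * (app H ^^ n) one i) \<longlonglongrightarrow> 0"
      using tendsto_mult[OF tendsto_const summable_LIMSEQ_zero[OF summable_pow_one]] by fastforce
  qed
  obtain B where B: "\<And>n. \<bar>aseq t n\<bar> \<le> B"
    using convergent_imp_Bseq[OF convergentI[OF aseq_tendsto[OF t]]]
    by (auto simp: Bseq_def)
  have S: "(\<Sum>k. hk k i) = U i"
    using hk_sums[of i] by (simp add: sums_iff)
  have "(\<lambda>n. aseq t (n - k)) \<longlonglongrightarrow> V t / \<beta>" for k
    using filterlim_compose[OF aseq_tendsto[OF t] filterlim_minus_const_nat_at_top] .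
  from convolution_tendsto[OF hk_nonneg sums_summable[OF hk_sums[of i]] B filterlim_ident this]
  have "(\<lambda>n. \<Sum>k\<le>n. hk k i * aseq t (n - k)) \<longlonglongrightarrow> U i * (V t / \<beta>)"
    unfolding S .
  from tendsto_add[OF H0 tendsto_mult[OF tendsto_const[of m] this]]
  show ?thesis
    unfolding mean_pow_decomposition[OF t] by (simp add: mult.assoc)
qed

end

section \<open>Generating functions of the process\<close>

text \<open>A population is coded by a finite list of counts. Countability allows events to be split
  over all values of one generation.\<close>

lemma countable_populations: "countable (UNIV :: population set)"
proof -
  have "z \<in> range Poly_Mapping.nth" for z :: population
  proof -
    define N where "N = Suc (Max (insert 0 (Poly_Mapping.keys z)))"
    have "Poly_Mapping.lookup z k = 0" if "k \<ge> N" for k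
    proof (rule ccontr)
      assume "Poly_Mapping.lookup z k \<noteq> 0"
      then have "k \<le> Max (insert 0 (Poly_Mapping.keys z))"
        by (intro Max_ge) (auto simp: in_keys_iff)
      with that show False by (simp add: N_def)
    qed
    then have "z = Poly_Mapping.nth (map (Poly_Mapping.lookup z) [0..<N])"
      by (intro poly_mapping_eqI) (auto simp: nth.rep_eq nth_default_def)
    then show ?thesis by blast
  qed
  then have "(UNIV :: population set) = range Poly_Mapping.nth" by blast
  then show ?thesis by (metis countableI_type countable_image)
qed

lemma monomial_at_superset:
  assumes "finite A" "Poly_Mapping.keys z \<subseteq> A"
  shows "monomial_at s z = (\<Prod>j\<in>A. s j ^ Poly_Mapping.lookup z j)"
  unfolding monomial_at_def using assms
  by (intro prod.mono_neutral_left) (auto simp: in_keys_iff)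

lemma monomial_at_0 [simp]: "monomial_at s 0 = 1"
  by (simp add: monomial_at_def)

lemma monomial_at_single [simp]: "monomial_at s (Poly_Mapping.single i n) = s i ^ n"
  by (cases "n = 0") (simp_all add: monomial_at_def)

lemma monomial_at_add: "monomial_at s (x + y) = monomial_at s x * monomial_at s y"
proof -
  let ?A = "Poly_Mapping.keys x \<union> Poly_Mapping.keys y"
  have "Poly_Mapping.keys (x + y) \<subseteq> ?A" by (rule keys_add)
  then show ?thesis
    by (simp add: monomial_at_superset[of ?A] lookup_add power_add prod.distrib)
qed

lemma monomial_at_sum: "monomial_at s (\<Sum>p\<in>I. f p) = (\<Prod>p\<in>I. monomial_at s (f p))"
  by (induction I rule: infinite_finite_induct) (simp_all add: monomial_at_add)

lemma monomial_at_bounds: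
  assumes "\<And>j. 0 \<le> s j \<and> s j \<le> 1"
  shows "0 \<le> monomial_at s z" "monomial_at s z \<le> 1"
  unfolding monomial_at_def using assms
  by (auto intro!: prod_nonneg prod_le_1 power_le_one)

lemma monomial_at_zero_vec: "monomial_at (\<lambda>_. 0) z = (if z = 0 then 1 else 0)"
proof (cases "z = 0")
  case False
  then obtain j where "j \<in> Poly_Mapping.keys z"
    using keys_eq_empty by blast
  then show ?thesis
    using False by (auto simp: monomial_at_def in_keys_iff intro!: prod_zero)
qed simp

lemma integrable_monomial_at:
  assumes "\<And>j. 0 \<le> s j \<and> s j \<le> 1"
  shows "integrable (measure_pmf q) (monomial_at s)"
  using monomial_at_bounds[OF assms]
  by (intro measure_pmf.integrable_const_bound[where B = 1]) (auto simp: abs_le_iff intro: order.trans[of _ 0])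

lemma expectation_monomial_bounds:
  assumes "\<And>j. 0 \<le> s j \<and> s j \<le> 1"
  shows "0 \<le> measure_pmf.expectation q (monomial_at s) \<and> measure_pmf.expectation q (monomial_at s) \<le> 1"
  using monomial_at_bounds[OF assms] integrable_monomial_at[OF assms]
  by (auto intro!: integral_nonneg_AE measure_pmf.integral_le_const)

text \<open>Independence of the offspring factors the expectation over the particles, and grouping
  them by type gives the composition of generating functions.\<close>

lemma expectation_next_generation:
  assumes s: "\<And>j. 0 \<le> s j \<and> s j \<le> 1"
  shows "measure_pmf.expectation (next_generation q z) (monomial_at s) =
    monomial_at (\<lambda>i. measure_pmf.expectation (q i) (monomial_at s)) z"
proof -
  have fin: "finite (particles z)"
    by (simp add: particles_def)
  have "measure_pmf.expectation (next_generation q z) (monomial_at s) =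
      measure_pmf.expectation (Pi_pmf (particles z) 0 (\<lambda>(i, k). q i))
        (\<lambda>\<xi>. \<Prod>p\<in>particles z. monomial_at s (\<xi> p))"
    by (simp add: next_generation_def monomial_at_sum)
  also have "\<dots> = (\<Prod>p\<in>particles z.
      measure_pmf.expectation (case p of (i, k) \<Rightarrow> q i) (monomial_at s))"
    using fin monomial_at_bounds[OF s] integrable_monomial_at[OF s]
    by (intro expectation_prod_Pi_pmf) auto
  also have "\<dots> = (\<Prod>i\<in>Poly_Mapping.keys z. \<Prod>k<Poly_Mapping.lookup z i.
      measure_pmf.expectation (q i) (monomial_at s))"
    unfolding particles_def by (subst prod.Sigma) (auto intro!: prod.cong)
  also have "\<dots> = monomial_at (\<lambda>i. measure_pmf.expectation (q i) (monomial_at s)) z"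
    by (simp add: monomial_at_def)
  finally show ?thesis .
qed

lemma expectation_bind_bounded:
  fixes f :: "'b \<Rightarrow> real"
  assumes "\<And>x. 0 \<le> f x \<and> f x \<le> 1"
  shows "measure_pmf.expectation (bind_pmf p k) f =
    measure_pmf.expectation p (\<lambda>x. measure_pmf.expectation (k x) f)"
proof -
  have int: "integrable (measure_pmf q) f" for q
    using assms by (intro measure_pmf.integrable_const_bound[where B = 1]) (auto simp: abs_le_iff intro: order.trans[of _ 0])
  have ex: "0 \<le> measure_pmf.expectation q f \<and> measure_pmf.expectation q f \<le> 1" for q
    using assms int by (auto intro!: integral_nonneg_AE measure_pmf.integral_le_const)
  have int': "integrable (measure_pmf p) (\<lambda>x. measure_pmf.expectation (k x) f)"
    using ex by (intro measure_pmf.integrable_const_bound[where B = 1]) (auto simp: abs_le_iff intro: order.trans[of _ 0])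
  have nn: "(\<integral>\<^sup>+x. ennreal (f x) \<partial>measure_pmf q) = ennreal (measure_pmf.expectation q f)" for q
    using int assms by (intro nn_integral_eq_integral) auto
  have "ennreal (measure_pmf.expectation (bind_pmf p k) f) =
      (\<integral>\<^sup>+x. ennreal (measure_pmf.expectation (k x) f) \<partial>measure_pmf p)"
    unfolding nn[symmetric] by simp
  also have "\<dots> = ennreal (measure_pmf.expectation p (\<lambda>x. measure_pmf.expectation (k x) f))"
    using int' ex by (simp add: nn_integral_eq_integral)
  finally show ?thesis
    using ex by (subst (asm) ennreal_inj) (auto intro: integral_nonneg_AE)
qed

text \<open>The law of the n-th generation without a sample space;
  \<open>distr_branching_process\<close> links it to the given process.\<close>

primrec generation :: "(nat \<Rightarrow> population pmf) \<Rightarrow> population \<Rightarrow> nat \<Rightarrow> population pmf" where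
  "generation q z 0 = return_pmf z"
| "generation q z (Suc n) = bind_pmf (generation q z n) (next_generation q)"

lemma expectation_generation_Suc:
  assumes s: "\<And>j. 0 \<le> s j \<and> s j \<le> 1"
  shows "measure_pmf.expectation (generation q z (Suc n)) (monomial_at s) =
    measure_pmf.expectation (generation q z n)
      (monomial_at (\<lambda>i. measure_pmf.expectation (q i) (monomial_at s)))"
  using monomial_at_bounds[OF s]
  by (simp add: expectation_bind_bounded expectation_next_generation[OF s])

text \<open>The Markov property is assumed for complete paths only; the past is removed one coordinate at a
  time by summing over its countably many values.\<close>

lemma branching_process_window:
  assumes bp: "branching_process M q z0 Z" and "k \<le> n"
  shows "emeasure M {\<omega> \<in> space M. \<forall>j\<in>{k..Suc n}. Z j \<omega> = z j} =
    emeasure M {\<omega> \<in> space M. \<forall>j\<in>{k..n}. Z j \<omega> = z j} * ennreal (pmf (next_generation q (z n)) (z (Suc n)))"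
  using \<open>k \<le> n\<close>
proof (induction k arbitrary: z)
  case 0
  interpret prob_space M using bp by (simp add: branching_process_def)
  have "\<P>(\<omega> in M. \<forall>j\<le>Suc n. Z j \<omega> = z j) =
      \<P>(\<omega> in M. \<forall>j\<le>n. Z j \<omega> = z j) * pmf (next_generation q (z n)) (z (Suc n))"
    using bp unfolding branching_process_def by blast
  then show ?case
    by (simp add: emeasure_eq_measure atLeast0AtMost Ball_def ennreal_mult)
next
  case (Suc k)
  have meas [measurable]: "Z j \<in> measurable M (count_space UNIV)" for j
    using bp by (simp add: branching_process_def)
  have split: "emeasure M {\<omega> \<in> space M. \<forall>j\<in>{Suc k..N}. Z j \<omega> = z j} =
      (\<integral>\<^sup>+x. emeasure M {\<omega> \<in> space M. \<forall>j\<in>{k..N}. Z j \<omega> = (z(k := x)) j} \<partial>count_space UNIV)"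
    if "k \<le> N" for N
  proof -
    have "{k..N} = insert k {Suc k..N}" using that by auto
    then have "{\<omega> \<in> space M. \<forall>j\<in>{Suc k..N}. Z j \<omega> = z j} =
        (\<Union>x. {\<omega> \<in> space M. \<forall>j\<in>{k..N}. Z j \<omega> = (z(k := x)) j})"
      by auto
    moreover have "disjoint_family (\<lambda>x. {\<omega> \<in> space M. \<forall>j\<in>{k..N}. Z j \<omega> = (z(k := x)) j})"
      using that by (fastforce simp: disjoint_family_on_def)
    ultimately show ?thesis
      by (simp only:) (intro emeasure_UN_countable countable_populations; measurable)
  qed
  have "emeasure M {\<omega> \<in> space M. \<forall>j\<in>{Suc k..Suc n}. Z j \<omega> = z j} =
      (\<integral>\<^sup>+x. emeasure M {\<omega> \<in> space M. \<forall>j\<in>{k..n}. Z j \<omega> = (z(k := x)) j} *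
        ennreal (pmf (next_generation q ((z(k := x)) n)) ((z(k := x)) (Suc n))) \<partial>count_space UNIV)"
    using Suc.prems by (subst split) (simp_all only: Suc.IH Suc_leD le_SucI)
  \<comment> \<open>Since \<open>k < n\<close>, overwriting coordinate \<open>k\<close> changes
    neither \<open>z n\<close> nor \<open>z (Suc n)\<close>, and the transition factor leaves the
    sum.\<close>
  also have "\<dots> = (\<integral>\<^sup>+x. emeasure M {\<omega> \<in> space M. \<forall>j\<in>{k..n}. Z j \<omega> = (z(k := x)) j} *
        ennreal (pmf (next_generation q (z n)) (z (Suc n))) \<partial>count_space UNIV)"
    using Suc.prems by simp
  also have "\<dots> = emeasure M {\<omega> \<in> space M. \<forall>j\<in>{Suc k..n}. Z j \<omega> = z j} *
        ennreal (pmf (next_generation q (z n)) (z (Suc n)))"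
    using Suc.prems by (subst nn_integral_multc) (simp_all add: split[of n])
  finally show ?case .
qed

text \<open>Windows of length two give one-step transitions; summing over the value at time
  \<open>n\<close> reproduces the recursion of \<open>generation\<close>.\<close>

lemma distr_branching_process:
  assumes bp: "branching_process M q z0 Z"
  shows "distr M (count_space UNIV) (Z n) = measure_pmf (generation q z0 n)"
proof -
  interpret prob_space M using bp by (simp add: branching_process_def)
  have meas [measurable]: "Z j \<in> measurable M (count_space UNIV)" for j
    using bp by (simp add: branching_process_def)
  have "emeasure M {\<omega> \<in> space M. Z n \<omega> = y} = ennreal (pmf (generation q z0 n) y)" for y
  proof (induction n arbitrary: y)
    case 0
    have "AE \<omega> in M. Z 0 \<omega> = z0"
      using bp by (simp add: branching_process_def)
    then have "emeasure M {\<omega> \<in> space M. Z 0 \<omega> = y} = emeasure M {\<omega> \<in> space M. z0 = y}"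
      by (intro emeasure_eq_AE) auto
    also have "\<dots> = ennreal (pmf (generation q z0 0) y)"
      using emeasure_space_1 by (cases "z0 = y") simp_all
    finally show ?case .
  next
    case (Suc n)
    have "emeasure M {\<omega> \<in> space M. Z (Suc n) \<omega> = y} =
        emeasure M (\<Union>x. {\<omega> \<in> space M. Z n \<omega> = x \<and> Z (Suc n) \<omega> = y})"
      by (intro arg_cong[of _ _ "emeasure M"]) auto
    also have "\<dots> = (\<integral>\<^sup>+x. emeasure M {\<omega> \<in> space M. Z n \<omega> = x \<and> Z (Suc n) \<omega> = y} \<partial>count_space UNIV)"
      by (intro emeasure_UN_countable countable_populations) (auto simp: disjoint_family_on_def)
    also have "\<dots> = (\<integral>\<^sup>+x. ennreal (pmf (generation q z0 n) x) *
        ennreal (pmf (next_generation q x) y) \<partial>count_space UNIV)"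
    proof (rule nn_integral_cong)
      fix x
      have "{n..Suc n} = {n, Suc n}" by auto
      then show "emeasure M {\<omega> \<in> space M. Z n \<omega> = x \<and> Z (Suc n) \<omega> = y} =
          ennreal (pmf (generation q z0 n) x) * ennreal (pmf (next_generation q x) y)"
        using branching_process_window[OF bp order.refl, of n "\<lambda>j. if j = n then x else y"]
        by (simp add: Suc.IH)
    qed
    also have "\<dots> = ennreal (pmf (generation q z0 (Suc n)) y)"
      by (simp add: ennreal_pmf_bind nn_integral_measure_pmf)
    finally show ?case .
  qed
  then show ?thesis
    by (intro measure_eqI_countable[of _ UNIV] countable_populations)
       (auto simp: emeasure_distr emeasure_pmf_single vimage_def Int_def conj_commute)
qed

section \<open>Iterates of the linear-fractional generating functions\<close>

context lf_params
begin

lemma dot_unit_vec: "dot a (unit_vec j) = a j"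
  unfolding dot_def by (subst suminf_finite[of "{j}"]) (auto simp: unit_vec_def)

lemma app_unit_vec: "app A (unit_vec j) i = A i j"
  by (simp add: app_def dot_unit_vec)

lemma app_mean_cmult: "bounded (range t) \<Longrightarrow> app mean (\<lambda>j. c * t j) i = c * app mean t i"
  using M.app_pow_cmult[of t 1 c] by simp

lemma aseq_Suc_app: "aseq (app mean t) k = aseq t (Suc k)"
  by (simp add: aseq_def funpow_swap1)

text \<open>In terms of \<open>1 - s\<close> the offspring generating functions act as a projective linear map.\<close>

lemma expectation_offspring:
  assumes q: "linear_fractional (H i) g m q" and t: "\<And>j. 0 \<le> t j \<and> t j \<le> 1"
  shows "measure_pmf.expectation q (monomial_at (\<lambda>j. 1 - t j)) =
    1 - app mean t i / (1 + m * dot g t)"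
proof -
  have bt: "bounded (range t)" using t by (intro bounded_range_le[of _ 1]) (simp add: abs_le_iff order.trans[of _ 0])
  have "0 \<le> m * dot g t"
    using m_pos t by (intro mult_nonneg_nonneg dot_nonneg weight_g bt) auto
  then have nz: "1 + m * dot g t \<noteq> 0" by linarith
  have "measure_pmf.expectation q (monomial_at (\<lambda>j. 1 - t j)) =
      (1 - suminf (H i)) + dot (H i) (\<lambda>j. 1 - t j) / (1 + m - m * dot g (\<lambda>j. 1 - t j))"
    using q t by (simp add: linear_fractional_def)
  also have "dot (H i) (\<lambda>j. 1 - t j) = suminf (H i) - app H t i"
    by (simp add: dot_diff[OF H.weight bounded_range_const bt] dot_const[OF H.weight] app_def)
  also have "dot g (\<lambda>j. 1 - t j) = 1 - dot g t"
    by (simp add: dot_diff[OF weight_g bounded_range_const bt] dot_const[OF weight_g] suminf_g)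
  also have "(1 - suminf (H i)) + (suminf (H i) - app H t i) / (1 + m - m * (1 - dot g t)) =
      1 - app mean t i / (1 + m * dot g t)"
    using nz by (simp add: app_mean[OF bt] app_H_one field_simps)
  finally show ?thesis .
qed

text \<open>The last generation is integrated out first, which replaces \<open>t\<close> by M t / c
  with c = 1 + m g t. As \<open>aseq t' k\<close> is \<open>aseq t (Suc k) / c\<close>, the factor c
  merges with the denominator for \<open>t'\<close> into a single sum starting at
  \<open>k = 0\<close>.\<close>

lemma expectation_generation:
  assumes q: "\<And>i. linear_fractional (H i) g m (q i)" and t: "\<And>j. 0 \<le> t j \<and> t j \<le> 1"
  shows "measure_pmf.expectation (generation q (Poly_Mapping.single i 1) n) (monomial_at (\<lambda>j. 1 - t j)) =
    1 - (app mean ^^ n) t i / (1 + m * (\<Sum>k<n. aseq t k))"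
  using t
proof (induction n arbitrary: t)
  case 0
  then show ?case by simp
next
  case (Suc n)
  define c where "c = 1 + m * dot g t"
  define t' where "t' i = app mean t i / c" for i
  have bt: "bounded (range t)"
    using Suc.prems by (intro bounded_range_le[of _ 1]) (simp add: abs_le_iff order.trans[of _ 0])
  have "0 \<le> m * dot g t"
    using m_pos Suc.prems by (intro mult_nonneg_nonneg dot_nonneg weight_g bt) auto
  then have c: "1 \<le> c" by (simp add: c_def)
  have offspring: "measure_pmf.expectation (q i) (monomial_at (\<lambda>j. 1 - t j)) = 1 - t' i" for i
    using expectation_offspring[OF q Suc.prems] by (simp add: t'_def c_def)
  have s: "\<And>j. 0 \<le> 1 - t j \<and> 1 - t j \<le> 1" using Suc.prems by simp
  \<comment> \<open>\<open>1 - t' i\<close> is a value of an offspring generating function, so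
    \<open>t'\<close> is again admissible for the induction hypothesis.\<close>
  have t': "0 \<le> t' i \<and> t' i \<le> 1" for i
    using expectation_monomial_bounds[of "\<lambda>j. 1 - t j" "q i"] s by (simp add: offspring)
  have bM: "bounded (range (app mean t))" by (rule M.bounded_app[OF bt])
  have t'_eq: "t' = (\<lambda>j. (1 / c) * app mean t j)" by (simp add: t'_def fun_eq_iff)
  have pow: "(app mean ^^ n) t' i = (app mean ^^ Suc n) t i / c"
    unfolding t'_eq M.app_pow_cmult[OF bM] by (simp add: funpow_swap1)
  have "aseq t' k = aseq t (Suc k) / c" for k
    unfolding t'_eq by (subst aseq_cmult[OF bM]) (simp add: aseq_Suc_app)
  then have "(\<Sum>k<n. aseq t' k) = (\<Sum>k<n. aseq t (Suc k)) / c"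
    by (simp only: sum_divide_distrib)
  then have "c * (1 + m * (\<Sum>k<n. aseq t' k)) = c + m * (\<Sum>k<n. aseq t (Suc k))"
    using c by (simp add: field_simps)
  also have "\<dots> = 1 + m * (\<Sum>k<Suc n. aseq t k)"
    by (subst sum.lessThan_Suc_shift) (simp add: c_def aseq_def algebra_simps)
  finally have den: "1 + m * (\<Sum>k<Suc n. aseq t k) = c * (1 + m * (\<Sum>k<n. aseq t' k))" by simp
  have "measure_pmf.expectation (generation q (Poly_Mapping.single i 1) (Suc n)) (monomial_at (\<lambda>j. 1 - t j)) =
      measure_pmf.expectation (generation q (Poly_Mapping.single i 1) n) (monomial_at (\<lambda>i. 1 - t' i))"
    unfolding expectation_generation_Suc[OF s] offspring ..
  also have "\<dots> = 1 - (app mean ^^ n) t' i / (1 + m * (\<Sum>k<n. aseq t' k))"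
    by (rule Suc.IH[OF t'])
  finally show ?case
    unfolding den pow by simp
qed

text \<open>The offspring law is known only through its generating function, so the mean is taken as
  a one-sided derivative at 1 in direction \<open>j\<close>. The difference quotients are the
  geometric sums \<open>f n z\<close>, which increase to the count of type \<open>j\<close> as
  \<open>e n\<close> decreases to 0; monotone convergence applies.\<close>

lemma expectation_count:
  assumes q: "\<And>i. linear_fractional (H i) g m (q i)"
  shows "measure_pmf.expectation (generation q (Poly_Mapping.single i 1) 1) (\<lambda>z. counts z j) = mean i j"
proof -
  let ?p = "measure_pmf (generation q (Poly_Mapping.single i 1) 1)"
  define e where "e n = 1 / real (Suc n)" for n
  define f where "f n z = (\<Sum>l<Poly_Mapping.lookup z j. (1 - e n) ^ l)" for n and z :: population
  have e: "0 < e n" "e n \<le> 1" for n by (simp_all add: e_def)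
  have e0: "e \<longlonglongrightarrow> 0"
    unfolding e_def using LIMSEQ_inverse_real_of_nat by (simp add: inverse_eq_divide)
  have mono: "monomial_at (\<lambda>k. 1 - e n * unit_vec j k) z = 1 - e n * f n z" for n z
  proof -
    have "monomial_at (\<lambda>k. 1 - e n * unit_vec j k) z =
        (\<Prod>k\<in>insert j (Poly_Mapping.keys z). (1 - e n * unit_vec j k) ^ Poly_Mapping.lookup z k)"
      by (intro monomial_at_superset) auto
    also have "\<dots> = (\<Prod>k\<in>insert j (Poly_Mapping.keys z). if k = j then (1 - e n) ^ Poly_Mapping.lookup z j else 1)"
      by (intro prod.cong) (auto simp: unit_vec_def)
    also have "\<dots> = (1 - e n) ^ Poly_Mapping.lookup z j"
      by (simp add: prod.delta)
    also have "\<dots> = 1 - e n * f n z"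
      using one_diff_power_eq[of "1 - e n" "Poly_Mapping.lookup z j"] by (simp add: f_def)
    finally show ?thesis .
  qed
  have t: "0 \<le> e n * unit_vec j k \<and> e n * unit_vec j k \<le> 1" for n k
    using e[of n] by (simp add: unit_vec_def)
  have f_eq: "f n = (\<lambda>z. (1 - monomial_at (\<lambda>k. 1 - e n * unit_vec j k) z) / e n)" for n
    using e[of n] by (simp add: mono fun_eq_iff)
  have int_m: "integrable ?p (monomial_at (\<lambda>k. 1 - e n * unit_vec j k))" for n
    using t[of n] by (intro integrable_monomial_at) simp
  have int: "integrable ?p (f n)" for n
    unfolding f_eq using int_m by auto
  have E: "integral\<^sup>L ?p (f n) = mean i j / (1 + m * (e n * g j))" for n
  proof -
    have "integral\<^sup>L ?p (f n) = (1 - integral\<^sup>L ?p (monomial_at (\<lambda>k. 1 - e n * unit_vec j k))) / e n"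
      unfolding f_eq using int_m by simp
    also have "integral\<^sup>L ?p (monomial_at (\<lambda>k. 1 - e n * unit_vec j k)) =
        1 - e n * mean i j / (1 + m * (e n * g j))"
      unfolding expectation_generation[OF q t]
      by (simp add: app_mean_cmult aseq_def dot_cmult[OF weight_g] dot_unit_vec app_unit_vec)
    finally show ?thesis
      using e[of n] by simp
  qed
  have "(\<lambda>n. mean i j / (1 + m * (e n * g j))) \<longlonglongrightarrow> mean i j / (1 + m * (0 * g j))"
    by (intro tendsto_intros e0) simp
  then have lim: "(\<lambda>n. integral\<^sup>L ?p (f n)) \<longlonglongrightarrow> mean i j"
    unfolding E by simp
  show ?thesis
  proof (rule integral_monotone_convergence_nonneg(2)[OF int _ _ _ lim])
    show "AE z in ?p. mono (\<lambda>n. f n z)"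
      unfolding f_def e_def
      by (intro always_eventually allI monoI sum_mono power_mono) (auto simp: field_simps)
    show "AE z in ?p. 0 \<le> f n z" for n
      unfolding f_def using e[of n] by (intro always_eventually allI sum_nonneg) simp
    have "(\<lambda>n. f n z) \<longlonglongrightarrow> (\<Sum>l<Poly_Mapping.lookup z j. (1 - 0) ^ l)" for z
      unfolding f_def by (intro tendsto_intros e0)
    then show "AE z in ?p. (\<lambda>n. f n z) \<longlonglongrightarrow> counts z j"
      by (simp add: counts_def)
  qed simp
qed

end

section \<open>Weak convergence from joint Laplace transforms\<close>

lemma tendsto_approx:
  fixes x :: "nat \<Rightarrow> real"
  assumes "\<And>e. 0 < e \<Longrightarrow> \<exists>y y'. (\<forall>\<^sub>F n in sequentially. \<bar>x n - y n\<bar> \<le> e) \<and> \<bar>x' - y'\<bar> \<le> e \<and> y \<longlonglongrightarrow> y'"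
  shows "x \<longlonglongrightarrow> x'"
proof (rule tendstoI)
  fix e :: real assume "0 < e"
  then obtain y y' where y: "\<forall>\<^sub>F n in sequentially. \<bar>x n - y n\<bar> \<le> e / 4" "\<bar>x' - y'\<bar> \<le> e / 4" "y \<longlonglongrightarrow> y'"
    using assms[of "e / 4"] by auto
  from tendstoD[OF y(3), of "e / 4"] have "\<forall>\<^sub>F n in sequentially. \<bar>y n - y'\<bar> < e / 4"
    using \<open>0 < e\<close> by (simp add: dist_real_def)
  with y(1) show "\<forall>\<^sub>F n in sequentially. dist (x n) x' < e"
  proof eventually_elim
    case (elim n)
    then show ?case using y(2) \<open>0 < e\<close> unfolding dist_real_def by linarith
  qed
qed

lemma (in prob_space) abs_expectation_diff_le:
  fixes f h :: "'a \<Rightarrow> real"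
  assumes "integrable M f" "integrable M h" "\<And>\<omega>. \<omega> \<in> space M \<Longrightarrow> \<bar>f \<omega> - h \<omega>\<bar> \<le> k \<omega>" "integrable M k"
  shows "\<bar>expectation f - expectation h\<bar> \<le> expectation k"
proof -
  have "\<bar>expectation f - expectation h\<bar> = \<bar>expectation (\<lambda>\<omega>. f \<omega> - h \<omega>)\<bar>"
    using assms by simp
  also have "\<dots> \<le> expectation (\<lambda>\<omega>. \<bar>f \<omega> - h \<omega>\<bar>)"
    by (rule integral_abs_bound)
  also have "\<dots> \<le> expectation k"
    using assms by (intro integral_mono) auto
  finally show ?thesis .
qed

text \<open>Natural \<open>a\<close> and \<open>b\<close> suffice because these transforms are the
  joint moments of exp (- N) and exp (- W), which live in the unit interval. Each \<open>n\<close>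
  has its own measure since the conditioning on survival depends on \<open>n\<close>.\<close>

locale laplace_convergence =
  fixes M :: "nat \<Rightarrow> 'a measure" and M' :: "'b measure"
    and N W :: "nat \<Rightarrow> 'a \<Rightarrow> real" and N' W' :: "'b \<Rightarrow> real"
  assumes prob: "\<And>n. prob_space (M n)" and prob': "prob_space M'"
    and meas [measurable]: "\<And>n. N n \<in> borel_measurable (M n)" "\<And>n. W n \<in> borel_measurable (M n)"
    and meas' [measurable]: "N' \<in> borel_measurable M'" "W' \<in> borel_measurable M'"
    and nonneg: "\<And>n \<omega>. 0 \<le> N n \<omega>" "\<And>n \<omega>. 0 \<le> W n \<omega>"
    and nonneg': "\<And>\<omega>. 0 \<le> N' \<omega>" "\<And>\<omega>. 0 \<le> W' \<omega>"
    and laplace: "\<And>a b :: nat. (\<lambda>n. \<integral>\<omega>. exp (- (real a * N n \<omega> + real b * W n \<omega>)) \<partial>M n)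
      \<longlonglongrightarrow> (\<integral>\<omega>. exp (- (real a * N' \<omega> + real b * W' \<omega>)) \<partial>M')"
begin

lemma integrable_bounded:
  fixes h :: "real \<Rightarrow> real \<Rightarrow> real"
  assumes [measurable]: "(\<lambda>x. h (fst x) (snd x)) \<in> borel_measurable (borel \<Otimes>\<^sub>M borel)"
    and "\<And>x y. 0 \<le> x \<Longrightarrow> 0 \<le> y \<Longrightarrow> \<bar>h x y\<bar> \<le> B"
  shows "integrable (M n) (\<lambda>\<omega>. h (N n \<omega>) (W n \<omega>))" "integrable M' (\<lambda>\<omega>. h (N' \<omega>) (W' \<omega>))"
proof -
  interpret prob_space "M n" by (rule prob)
  have "(\<lambda>\<omega>. (\<lambda>x. h (fst x) (snd x)) (N n \<omega>, W n \<omega>)) \<in> borel_measurable (M n)"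
    by measurable
  then show "integrable (M n) (\<lambda>\<omega>. h (N n \<omega>) (W n \<omega>))"
    using assms(2) nonneg by (intro integrable_const_bound[where B = B]) auto
  interpret M': prob_space M' by (rule prob')
  have "(\<lambda>\<omega>. (\<lambda>x. h (fst x) (snd x)) (N' \<omega>, W' \<omega>)) \<in> borel_measurable M'"
    by measurable
  then show "integrable M' (\<lambda>\<omega>. h (N' \<omega>) (W' \<omega>))"
    using assms(2) nonneg' by (intro M'.integrable_const_bound[where B = B]) auto
qed

lemma exp_polynomials_tendsto:
  fixes a b :: "nat \<Rightarrow> real"
  shows "(\<lambda>n. \<integral>\<omega>. (\<Sum>i\<le>k. a i * exp (- N n \<omega>) ^ i) * (\<Sum>j\<le>l. b j * exp (- W n \<omega>) ^ j) \<partial>M n)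
    \<longlonglongrightarrow> (\<integral>\<omega>. (\<Sum>i\<le>k. a i * exp (- N' \<omega>) ^ i) * (\<Sum>j\<le>l. b j * exp (- W' \<omega>) ^ j) \<partial>M')"
proof -
  have eq: "(\<Sum>i\<le>k. a i * exp (- x) ^ i) * (\<Sum>j\<le>l. b j * exp (- y) ^ j) =
      (\<Sum>i\<le>k. \<Sum>j\<le>l. a i * b j * exp (- (real i * x + real j * y)))" for x y :: real
    unfolding sum_product
    by (intro sum.cong refl) (simp add: exp_of_nat_mult[symmetric] exp_add[symmetric] algebra_simps)
  have int: "integrable (M n) (\<lambda>\<omega>. exp (- (real i * N n \<omega> + real j * W n \<omega>)))"
    "integrable M' (\<lambda>\<omega>. exp (- (real i * N' \<omega> + real j * W' \<omega>)))" for i j n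
  proof -
    have m: "(\<lambda>x. exp (- (real i * fst x + real j * snd x))) \<in> borel_measurable (borel \<Otimes>\<^sub>M borel)"
      by measurable
    have "\<bar>exp (- (real i * x + real j * y))\<bar> \<le> 1" if "0 \<le> x" "0 \<le> y" for x y
    proof -
      have "0 \<le> real i * x + real j * y"
        using that by (intro add_nonneg_nonneg mult_nonneg_nonneg) auto
      then show ?thesis by (simp only: abs_exp_cancel exp_le_one_iff neg_le_0_iff_le)
    qed
    from integrable_bounded[OF m this]
    show "integrable (M n) (\<lambda>\<omega>. exp (- (real i * N n \<omega> + real j * W n \<omega>)))"
      "integrable M' (\<lambda>\<omega>. exp (- (real i * N' \<omega> + real j * W' \<omega>)))" by simp_all
  qed
  show ?thesis
    unfolding eq using int by (simp add: laplace tendsto_sum tendsto_mult del: minus_add_distrib)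
qed

lemma exp_continuous_tendsto:
  fixes \<phi> \<psi> :: "real \<Rightarrow> real"
  assumes \<phi>: "continuous_on {0..1} \<phi>" and \<psi>: "continuous_on {0..1} \<psi>"
  shows "(\<lambda>n. \<integral>\<omega>. \<phi> (exp (- N n \<omega>)) * \<psi> (exp (- W n \<omega>)) \<partial>M n)
    \<longlonglongrightarrow> (\<integral>\<omega>. \<phi> (exp (- N' \<omega>)) * \<psi> (exp (- W' \<omega>)) \<partial>M')"
proof (rule tendsto_approx)
  fix e :: real assume e: "0 < e"
  have "bounded (\<phi> ` {0..1})" "bounded (\<psi> ` {0..1})"
    using \<phi> \<psi> by (auto intro!: compact_imp_bounded compact_continuous_image)
  then have "bounded (\<phi> ` {0..1} \<union> \<psi> ` {0..1})" by simp
  then obtain B where "\<forall>y\<in>\<phi> ` {0..1} \<union> \<psi> ` {0..1}. norm y \<le> B"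
    unfolding bounded_iff by blast
  then have B: "\<And>x. x \<in> {0..1} \<Longrightarrow> \<bar>\<phi> x\<bar> \<le> B" "\<And>x. x \<in> {0..1} \<Longrightarrow> \<bar>\<psi> x\<bar> \<le> B"
    by auto
  have B0: "0 \<le> B" using B(1)[of 0] by simp
  \<comment> \<open>The product of the approximations errs by at most B \<delta> + \<delta> (B + 1),
    where \<delta> \<le> 1 bounds the second polynomial by B + 1.\<close>
  define \<delta> where "\<delta> = min 1 (e / (2 * B + 1))"
  have \<delta>: "0 < \<delta>" "\<delta> \<le> 1" "\<delta> \<le> e / (2 * B + 1)"
    using e B0 by (auto simp: \<delta>_def)
  then have \<delta>e: "\<delta> * (2 * B + 1) \<le> e"
    using B0 by (simp add: pos_le_divide_eq)
  obtain p where p: "real_polynomial_function p" "\<And>x. x \<in> {0..1} \<Longrightarrow> \<bar>\<phi> x - p x\<bar> < \<delta>"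
    using Stone_Weierstrass_real_polynomial_function[OF compact_Icc \<phi> \<delta>(1)] by metis
  obtain q where q: "real_polynomial_function q" "\<And>x. x \<in> {0..1} \<Longrightarrow> \<bar>\<psi> x - q x\<bar> < \<delta>"
    using Stone_Weierstrass_real_polynomial_function[OF compact_Icc \<psi> \<delta>(1)] by metis
  obtain a k where a: "p = (\<lambda>x. \<Sum>i\<le>k. a i * x ^ i)"
    using p(1) by (auto simp: real_polynomial_function_iff_sum)
  obtain b l where b: "q = (\<lambda>x. \<Sum>i\<le>l. b i * x ^ i)"
    using q(1) by (auto simp: real_polynomial_function_iff_sum)
  have [measurable]: "p \<in> borel_measurable borel" "q \<in> borel_measurable borel"
    unfolding a b by measurable
  have pq: "\<bar>\<phi> x * \<psi> y - p x * q y\<bar> \<le> e" if "x \<in> {0..1}" "y \<in> {0..1}" for x y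
  proof -
    have "\<bar>q y\<bar> \<le> B + 1"
      using B(2)[OF that(2)] q(2)[OF that(2)] \<delta>(2) by linarith
    then have "\<bar>\<phi> x\<bar> * \<bar>\<psi> y - q y\<bar> + \<bar>\<phi> x - p x\<bar> * \<bar>q y\<bar> \<le> B * \<delta> + \<delta> * (B + 1)"
      using B that p(2)[OF that(1)] q(2)[OF that(2)] B0 \<delta>(1)
      by (intro add_mono mult_mono) (auto intro: less_imp_le)
    moreover have "\<phi> x * \<psi> y - p x * q y = \<phi> x * (\<psi> y - q y) + (\<phi> x - p x) * q y"
      by (simp add: algebra_simps)
    then have "\<bar>\<phi> x * \<psi> y - p x * q y\<bar> \<le> \<bar>\<phi> x\<bar> * \<bar>\<psi> y - q y\<bar> + \<bar>\<phi> x - p x\<bar> * \<bar>q y\<bar>"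
      by (metis abs_mult abs_triangle_ineq)
    moreover have "B * \<delta> + \<delta> * (B + 1) = \<delta> * (2 * B + 1)" by (simp add: algebra_simps)
    ultimately show ?thesis using \<delta>e by linarith
  qed
  \<comment> \<open>The functions \<phi> and \<psi> are controlled on the unit interval only;
    clipping yields Borel functions on the line with the same values at exp (- N) and exp (-
    W).\<close>
  define clip where "clip x = max 0 (min 1 x)" for x :: real
  have clip: "clip x \<in> {0..1}" "x \<in> {0..1} \<Longrightarrow> clip x = x" for x
    by (auto simp: clip_def)
  have cont: "continuous_on UNIV clip"
    unfolding clip_def by (intro continuous_intros)
  have sub: "range clip \<subseteq> {0..1}" using clip(1) by blast
  have [measurable]: "(\<lambda>x. \<phi> (clip x)) \<in> borel_measurable borel" "(\<lambda>x. \<psi> (clip x)) \<in> borel_measurable borel"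
    using continuous_on_compose2[OF \<phi> cont sub] continuous_on_compose2[OF \<psi> cont sub]
    by (auto intro!: borel_measurable_continuous_onI)
  have "integrable (M n) (\<lambda>\<omega>. \<phi> (clip (exp (- N n \<omega>))) * \<psi> (clip (exp (- W n \<omega>))))"
    "integrable M' (\<lambda>\<omega>. \<phi> (clip (exp (- N' \<omega>))) * \<psi> (clip (exp (- W' \<omega>))))" for n
  proof -
    have m: "(\<lambda>x. \<phi> (clip (exp (- fst x))) * \<psi> (clip (exp (- snd x)))) \<in> borel_measurable (borel \<Otimes>\<^sub>M borel)"
      by measurable
    have "\<bar>\<phi> (clip (exp (- x))) * \<psi> (clip (exp (- y)))\<bar> \<le> B * B" for x y
      unfolding abs_mult using B[OF clip(1)] B0 by (intro mult_mono) auto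
    from integrable_bounded[of "\<lambda>x y. \<phi> (clip (exp (- x))) * \<psi> (clip (exp (- y)))", OF m this]
    show "integrable (M n) (\<lambda>\<omega>. \<phi> (clip (exp (- N n \<omega>))) * \<psi> (clip (exp (- W n \<omega>))))"
      "integrable M' (\<lambda>\<omega>. \<phi> (clip (exp (- N' \<omega>))) * \<psi> (clip (exp (- W' \<omega>))))" by simp_all
  qed
  then have int: "integrable (M n) (\<lambda>\<omega>. \<phi> (exp (- N n \<omega>)) * \<psi> (exp (- W n \<omega>)))"
    "integrable M' (\<lambda>\<omega>. \<phi> (exp (- N' \<omega>)) * \<psi> (exp (- W' \<omega>)))" for n
    using nonneg nonneg' by (simp_all add: clip(2))
  have pqB: "\<bar>p x * q y\<bar> \<le> B * B + e" if "x \<in> {0..1}" "y \<in> {0..1}" for x y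
  proof -
    have "\<bar>\<phi> x * \<psi> y\<bar> \<le> B * B"
      unfolding abs_mult using B that B0 by (intro mult_mono) auto
    then show ?thesis using pq[OF that] by linarith
  qed
  have int2: "integrable (M n) (\<lambda>\<omega>. p (exp (- N n \<omega>)) * q (exp (- W n \<omega>)))"
    "integrable M' (\<lambda>\<omega>. p (exp (- N' \<omega>)) * q (exp (- W' \<omega>)))" for n
    using integrable_bounded[of "\<lambda>x y. p (exp (- x)) * q (exp (- y))" "B * B + e"] pqB by simp_all
  show "\<exists>y y'. (\<forall>\<^sub>F n in sequentially. \<bar>(\<integral>\<omega>. \<phi> (exp (- N n \<omega>)) * \<psi> (exp (- W n \<omega>)) \<partial>M n) - y n\<bar> \<le> e) \<and>
      \<bar>(\<integral>\<omega>. \<phi> (exp (- N' \<omega>)) * \<psi> (exp (- W' \<omega>)) \<partial>M') - y'\<bar> \<le> e \<and> y \<longlonglongrightarrow> y'"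
  proof (intro exI conjI always_eventually allI)
    fix n
    interpret prob_space "M n" by (rule prob)
    show "\<bar>(\<integral>\<omega>. \<phi> (exp (- N n \<omega>)) * \<psi> (exp (- W n \<omega>)) \<partial>M n) -
        (\<integral>\<omega>. p (exp (- N n \<omega>)) * q (exp (- W n \<omega>)) \<partial>M n)\<bar> \<le> e"
      using abs_expectation_diff_le[OF int(1) int2(1), of "\<lambda>_. e"] pq nonneg by (simp add: prob_space)
  next
    interpret prob_space M' by (rule prob')
    show "\<bar>(\<integral>\<omega>. \<phi> (exp (- N' \<omega>)) * \<psi> (exp (- W' \<omega>)) \<partial>M') -
        (\<integral>\<omega>. p (exp (- N' \<omega>)) * q (exp (- W' \<omega>)) \<partial>M')\<bar> \<le> e"
      using abs_expectation_diff_le[OF int(2) int2(2), of "\<lambda>_. e"] pq nonneg' by (simp add: prob_space)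
  next
    show "(\<lambda>n. \<integral>\<omega>. p (exp (- N n \<omega>)) * q (exp (- W n \<omega>)) \<partial>M n) \<longlonglongrightarrow>
        (\<integral>\<omega>. p (exp (- N' \<omega>)) * q (exp (- W' \<omega>)) \<partial>M')"
      unfolding a b by (rule exp_polynomials_tendsto)
  qed
qed

text \<open>The factor \<open>exp (- \<epsilon> x)\<close> makes a bounded continuous function of \<open>x = - ln y\<close> extend
  continuously to \<open>y = 0\<close>.\<close>

lemma damped_tendsto:
  fixes h1 h2 :: "real \<Rightarrow> real"
  assumes h: "continuous_on UNIV h1" "continuous_on UNIV h2" "\<And>x. \<bar>h1 x\<bar> \<le> 1" "\<And>x. \<bar>h2 x\<bar> \<le> 1"
    and \<epsilon>: "0 < \<epsilon>"
  shows "(\<lambda>n. \<integral>\<omega>. (exp (- \<epsilon> * N n \<omega>) * h1 (N n \<omega>)) * (exp (- \<epsilon> * W n \<omega>) * h2 (W n \<omega>)) \<partial>M n)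
    \<longlonglongrightarrow> (\<integral>\<omega>. (exp (- \<epsilon> * N' \<omega>) * h1 (N' \<omega>)) * (exp (- \<epsilon> * W' \<omega>) * h2 (W' \<omega>)) \<partial>M')"
proof -
  have cont: "continuous_on {0..1} (\<lambda>x. x powr \<epsilon> * h (- ln x))"
    if h: "continuous_on UNIV h" "\<And>x. \<bar>h x\<bar> \<le> 1" for h :: "real \<Rightarrow> real"
  proof -
    have "((\<lambda>x. x powr \<epsilon> * h (- ln x)) \<longlongrightarrow> x powr \<epsilon> * h (- ln x)) (at x within {0..1})"
      if "x \<in> {0..1}" for x
    proof (cases "x = 0")
      case True
      have pw: "((\<lambda>x. x powr \<epsilon>) \<longlongrightarrow> 0) (at 0 within {0..1})"
        using \<epsilon> tendsto_powr'[of "\<lambda>x. x" 0 "at 0 within {0..1}" "\<lambda>_. \<epsilon>" \<epsilon>]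
        by (auto simp: eventually_at_filter)
      show ?thesis
        unfolding True
      proof (simp, rule Lim_null_comparison[OF _ pw])
        show "\<forall>\<^sub>F x in at 0 within {0..1}. norm (x powr \<epsilon> * h (- ln x)) \<le> x powr \<epsilon>"
          using h(2) by (intro always_eventually allI) (simp add: abs_mult mult_left_le)
      qed
    next
      case False
      then have "0 < x" using that by simp
      have "isCont h (- ln x)"
        using h(1) by (simp add: continuous_on_eq_continuous_at)
      then show ?thesis
        using \<open>0 < x\<close> by (intro tendsto_intros isCont_tendsto_compose[of _ h]) auto
    qed
    then show ?thesis by (simp add: continuous_on_def)
  qed
  show ?thesis
    using exp_continuous_tendsto[OF cont[OF h(1,3)] cont[OF h(2,4)]]
    by (simp add: powr_def)
qed

text \<open>Removing the damping costs at most one minus its expectation. This is small under the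
  limit law for small \<epsilon>, and \<open>damped_tendsto\<close> with constant test functions
  transfers it to large \<open>n\<close>, which takes the place of a tightness argument.\<close>

lemma bounded_continuous_tendsto:
  fixes h1 h2 :: "real \<Rightarrow> real"
  assumes h: "continuous_on UNIV h1" "continuous_on UNIV h2" "\<And>x. \<bar>h1 x\<bar> \<le> 1" "\<And>x. \<bar>h2 x\<bar> \<le> 1"
  shows "(\<lambda>n. \<integral>\<omega>. h1 (N n \<omega>) * h2 (W n \<omega>) \<partial>M n) \<longlonglongrightarrow> (\<integral>\<omega>. h1 (N' \<omega>) * h2 (W' \<omega>) \<partial>M')"
proof (rule tendsto_approx)
  fix e :: real assume e: "0 < e"
  have [measurable]: "h1 \<in> borel_measurable borel" "h2 \<in> borel_measurable borel"
    using h by (auto intro: borel_measurable_continuous_onI)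
  define damp where "damp \<epsilon> x y = exp (- \<epsilon> * x) * exp (- \<epsilon> * y)" for \<epsilon> x y :: real
  have damp: "0 \<le> damp \<epsilon> x y" "damp \<epsilon> x y \<le> 1" if "0 < \<epsilon>" "0 \<le> x" "0 \<le> y" for \<epsilon> x y
    using that by (auto simp: damp_def intro!: mult_le_one)
  have [measurable]: "(\<lambda>x. damp \<epsilon> (fst x) (snd x)) \<in> borel_measurable (borel \<Otimes>\<^sub>M borel)" for \<epsilon>
    unfolding damp_def by measurable
  interpret M': prob_space M' by (rule prob')
  have "(\<lambda>k. \<integral>\<omega>. damp (1 / real (Suc k)) (N' \<omega>) (W' \<omega>) \<partial>M') \<longlonglongrightarrow> (\<integral>\<omega>. 1 \<partial>M')"
  proof (rule integral_dominated_convergence[where w = "\<lambda>_. 1"])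
    have z: "(\<lambda>k. 1 / real (Suc k)) \<longlonglongrightarrow> 0"
      using LIMSEQ_inverse_real_of_nat by (simp add: inverse_eq_divide)
    have "(\<lambda>k. damp (1 / real (Suc k)) x y) \<longlonglongrightarrow> exp (- 0 * x) * exp (- 0 * y)" for x y
      unfolding damp_def by (intro tendsto_intros z)
    then show "AE \<omega> in M'. (\<lambda>k. damp (1 / real (Suc k)) (N' \<omega>) (W' \<omega>)) \<longlonglongrightarrow> 1"
      by simp
    show "AE \<omega> in M'. norm (damp (1 / real (Suc k)) (N' \<omega>) (W' \<omega>)) \<le> 1" for k
      using damp[of "1 / real (Suc k)"] nonneg' by (intro always_eventually allI) simp
  qed (simp_all add: damp_def)
  from tendstoD[OF this, of "e / 2"] obtain k where
    k: "\<bar>(\<integral>\<omega>. damp (1 / real (Suc k)) (N' \<omega>) (W' \<omega>) \<partial>M') - 1\<bar> < e / 2"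
    using e by (auto simp: eventually_sequentially dist_real_def M'.prob_space)
  define \<epsilon> where "\<epsilon> = 1 / real (Suc k)"
  have \<epsilon>: "0 < \<epsilon>" by (simp add: \<epsilon>_def)
  define y where "y n = (\<integral>\<omega>. damp \<epsilon> (N n \<omega>) (W n \<omega>) * (h1 (N n \<omega>) * h2 (W n \<omega>)) \<partial>M n)" for n
  define y' where "y' = (\<integral>\<omega>. damp \<epsilon> (N' \<omega>) (W' \<omega>) * (h1 (N' \<omega>) * h2 (W' \<omega>)) \<partial>M')"
  have y: "y \<longlonglongrightarrow> y'"
    using damped_tendsto[OF h \<epsilon>] by (simp add: y_def[abs_def] y'_def damp_def mult_ac)
  have "(\<lambda>n. \<integral>\<omega>. damp \<epsilon> (N n \<omega>) (W n \<omega>) \<partial>M n) \<longlonglongrightarrow> (\<integral>\<omega>. damp \<epsilon> (N' \<omega>) (W' \<omega>) \<partial>M')"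
    using damped_tendsto[of "\<lambda>_. 1" "\<lambda>_. 1", OF _ _ _ _ \<epsilon>] by (simp add: damp_def)
  then have "\<forall>\<^sub>F n in sequentially. dist (\<integral>\<omega>. damp \<epsilon> (N n \<omega>) (W n \<omega>) \<partial>M n)
      (\<integral>\<omega>. damp \<epsilon> (N' \<omega>) (W' \<omega>) \<partial>M') < e / 2"
    using e by (intro tendstoD) auto
  then have near: "\<forall>\<^sub>F n in sequentially. 1 - (\<integral>\<omega>. damp \<epsilon> (N n \<omega>) (W n \<omega>) \<partial>M n) \<le> e"
  proof eventually_elim
    case (elim n)
    then show ?case using k unfolding \<epsilon>_def[symmetric] dist_real_def by linarith
  qed
  have hb: "\<bar>h1 x * h2 y\<bar> \<le> 1" for x y
    using h(3)[of x] h(4)[of y] by (simp add: abs_mult mult_le_one)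
  have diff: "\<bar>h1 x * h2 y - damp \<epsilon> x y * (h1 x * h2 y)\<bar> \<le> 1 - damp \<epsilon> x y" if "0 \<le> x" "0 \<le> y" for x y
  proof -
    have "h1 x * h2 y - damp \<epsilon> x y * (h1 x * h2 y) = (1 - damp \<epsilon> x y) * (h1 x * h2 y)"
      by (simp add: algebra_simps)
    then show ?thesis
      using damp[OF \<epsilon> that] hb[of x y] by (simp add: abs_mult mult_left_le)
  qed
  have dhb: "\<bar>damp \<epsilon> x y * (h1 x * h2 y)\<bar> \<le> 1" if "0 \<le> x" "0 \<le> y" for x y
    using damp[OF \<epsilon> that] hb[of x y] unfolding abs_mult[of "damp \<epsilon> x y"] by (intro mult_le_one) auto
  have "(\<lambda>x. h1 (fst x) * h2 (snd x)) \<in> borel_measurable (borel \<Otimes>\<^sub>M borel)"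
    "(\<lambda>x. damp \<epsilon> (fst x) (snd x) * (h1 (fst x) * h2 (snd x))) \<in> borel_measurable (borel \<Otimes>\<^sub>M borel)"
    by measurable
  note int1 = integrable_bounded[of "\<lambda>x y. h1 x * h2 y", OF this(1) hb]
    and int2 = integrable_bounded[of "\<lambda>x y. damp \<epsilon> x y * (h1 x * h2 y)", OF this(2) dhb]
  have int3: "integrable (M n) (\<lambda>\<omega>. damp \<epsilon> (N n \<omega>) (W n \<omega>))" "integrable M' (\<lambda>\<omega>. damp \<epsilon> (N' \<omega>) (W' \<omega>))" for n
    using integrable_bounded[of "damp \<epsilon>" 1] damp[OF \<epsilon>] by simp_all
  have "\<bar>(\<integral>\<omega>. h1 (N n \<omega>) * h2 (W n \<omega>) \<partial>M n) - y n\<bar> \<le> 1 - (\<integral>\<omega>. damp \<epsilon> (N n \<omega>) (W n \<omega>) \<partial>M n)" for n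
  proof -
    interpret prob_space "M n" by (rule prob)
    show ?thesis
      using abs_expectation_diff_le[OF int1(1) int2(1), of "\<lambda>\<omega>. 1 - damp \<epsilon> (N n \<omega>) (W n \<omega>)"] diff nonneg int3
      by (simp add: y_def prob_space)
  qed
  then have "\<forall>\<^sub>F n in sequentially. \<bar>(\<integral>\<omega>. h1 (N n \<omega>) * h2 (W n \<omega>) \<partial>M n) - y n\<bar> \<le> e"
    using near by (auto elim!: eventually_mono intro: order.trans)
  moreover have "\<bar>(\<integral>\<omega>. h1 (N' \<omega>) * h2 (W' \<omega>) \<partial>M') - y'\<bar> \<le> 1 - (\<integral>\<omega>. damp \<epsilon> (N' \<omega>) (W' \<omega>) \<partial>M')"
    using M'.abs_expectation_diff_le[OF int1(2) int2(2), of "\<lambda>\<omega>. 1 - damp \<epsilon> (N' \<omega>) (W' \<omega>)"] diff nonneg' int3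
    by (simp add: y'_def M'.prob_space)
  then have "\<bar>(\<integral>\<omega>. h1 (N' \<omega>) * h2 (W' \<omega>) \<partial>M') - y'\<bar> \<le> e"
    using k e unfolding \<epsilon>_def[symmetric] by linarith
  ultimately show "\<exists>y y'. (\<forall>\<^sub>F n in sequentially. \<bar>(\<integral>\<omega>. h1 (N n \<omega>) * h2 (W n \<omega>) \<partial>M n) - y n\<bar> \<le> e) \<and>
      \<bar>(\<integral>\<omega>. h1 (N' \<omega>) * h2 (W' \<omega>) \<partial>M') - y'\<bar> \<le> e \<and> y \<longlonglongrightarrow> y'"
    using y by blast
qed

text \<open>The addition formulas turn functions of W - K N into sums of products of a function of N
  and a function of W, the form covered by \<open>bounded_continuous_tendsto\<close>.\<close>

lemma
  shows cos_tendsto: "(\<lambda>n. \<integral>\<omega>. cos (t * (W n \<omega> - K * N n \<omega>)) \<partial>M n) \<longlonglongrightarrow> (\<integral>\<omega>. cos (t * (W' \<omega> - K * N' \<omega>)) \<partial>M')"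
    and sin_tendsto: "(\<lambda>n. \<integral>\<omega>. sin (t * (W n \<omega> - K * N n \<omega>)) \<partial>M n) \<longlonglongrightarrow> (\<integral>\<omega>. sin (t * (W' \<omega> - K * N' \<omega>)) \<partial>M')"
proof -
  have c: "continuous_on UNIV (\<lambda>x. cos (c * x))" "continuous_on UNIV (\<lambda>x. sin (c * x))" for c :: real
    by (intro continuous_intros)+
  have prod: "\<bar>cos a * cos b\<bar> \<le> 1" "\<bar>sin a * sin b\<bar> \<le> 1" "\<bar>sin a * cos b\<bar> \<le> 1" "\<bar>cos a * sin b\<bar> \<le> 1" for a b :: real
    by (simp_all add: abs_mult mult_le_one)
  have trig:
    "(\<lambda>x. cos (a * fst x) * cos (b * snd x)) \<in> borel_measurable (borel \<Otimes>\<^sub>M borel)"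
    "(\<lambda>x. sin (a * fst x) * sin (b * snd x)) \<in> borel_measurable (borel \<Otimes>\<^sub>M borel)"
    "(\<lambda>x. cos (a * fst x) * sin (b * snd x)) \<in> borel_measurable (borel \<Otimes>\<^sub>M borel)"
    "(\<lambda>x. sin (a * fst x) * cos (b * snd x)) \<in> borel_measurable (borel \<Otimes>\<^sub>M borel)" for a b :: real
    by measurable
  note int =
    integrable_bounded[of "\<lambda>x y. cos (t * K * x) * cos (t * y)", OF trig(1) prod(1)]
    integrable_bounded[of "\<lambda>x y. sin (t * K * x) * sin (t * y)", OF trig(2) prod(2)]
    integrable_bounded[of "\<lambda>x y. cos (t * K * x) * sin (t * y)", OF trig(3) prod(4)]
    integrable_bounded[of "\<lambda>x y. sin (t * K * x) * cos (t * y)", OF trig(4) prod(3)]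
  note bct = bounded_continuous_tendsto[OF c(1)[of "t * K"] c(1)[of t]]
    bounded_continuous_tendsto[OF c(2)[of "t * K"] c(2)[of t]]
    bounded_continuous_tendsto[OF c(1)[of "t * K"] c(2)[of t]]
    bounded_continuous_tendsto[OF c(2)[of "t * K"] c(1)[of t]]
  note bct = bct[OF _ _, simplified]
  have C: "cos (t * (y - K * x)) = cos (t * K * x) * cos (t * y) + sin (t * K * x) * sin (t * y)" for x y :: real
    by (simp add: right_diff_distrib cos_diff mult_ac)
  have S: "sin (t * (y - K * x)) = cos (t * K * x) * sin (t * y) - sin (t * K * x) * cos (t * y)" for x y :: real
    by (simp add: right_diff_distrib sin_diff mult_ac)
  show "(\<lambda>n. \<integral>\<omega>. cos (t * (W n \<omega> - K * N n \<omega>)) \<partial>M n) \<longlonglongrightarrow> (\<integral>\<omega>. cos (t * (W' \<omega> - K * N' \<omega>)) \<partial>M')"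
    unfolding C using int tendsto_add[OF bct(1) bct(2)] by simp
  show "(\<lambda>n. \<integral>\<omega>. sin (t * (W n \<omega> - K * N n \<omega>)) \<partial>M n) \<longlonglongrightarrow> (\<integral>\<omega>. sin (t * (W' \<omega> - K * N' \<omega>)) \<partial>M')"
    unfolding S using int tendsto_diff[OF bct(3) bct(4)] by simp
qed

theorem weak_conv_difference:
  "weak_conv_m (\<lambda>n. distr (M n) borel (\<lambda>\<omega>. W n \<omega> - K * N n \<omega>)) (distr M' borel (\<lambda>\<omega>. W' \<omega> - K * N' \<omega>))"
proof (rule levy_continuity)
  have char: "char (distr P borel X) t = Complex (\<integral>\<omega>. cos (t * X \<omega>) \<partial>P) (\<integral>\<omega>. sin (t * X \<omega>) \<partial>P)"
    if P: "prob_space P" and X [measurable]: "X \<in> borel_measurable P"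
    for P :: "'c measure" and X :: "'c \<Rightarrow> real" and t
  proof -
    interpret prob_space P by (rule P)
    have int: "integrable P (\<lambda>\<omega>. iexp (t * X \<omega>))"
      by (rule integrable_iexp) simp_all
    have "char (distr P borel X) t = (\<integral>\<omega>. iexp (t * X \<omega>) \<partial>P)"
      unfolding char_def by (subst integral_distr) simp_all
    then show ?thesis
      using integral_Re[OF int] integral_Im[OF int]
      by (simp add: complex_eq_iff Re_exp Im_exp)
  qed
  show "(\<lambda>n. char (distr (M n) borel (\<lambda>\<omega>. W n \<omega> - K * N n \<omega>)) t)
      \<longlonglongrightarrow> char (distr M' borel (\<lambda>\<omega>. W' \<omega> - K * N' \<omega>)) t" for t
    by (simp add: char prob prob' tendsto_Complex cos_tendsto sin_tendsto)
qed (auto intro!: prob_space.real_distribution_distr prob prob')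

end

section \<open>The critical case\<close>

context lf_params
begin

section \<open>The Malthusian equation and its root\<close>

lemma row_sum_eq: "row_sum H n = (app H ^^ n) one"
  by (simp add: row_sum_def H.suminf_mat_pow fun_eq_iff)

lemma d_seq_eq: "d_seq H g n = dk n"
  by (simp add: d_seq_def row_sum_eq dk_def)

lemma f_gen_real:
  assumes "0 \<le> x"
  shows "f_gen H g (ennreal x) = (\<Sum>n. ennreal (dk (Suc n) * x ^ Suc n))"
  unfolding f_gen_def d_seq_eq using assms
  by (intro suminf_cong) (simp add: ennreal_mult[symmetric] ennreal_power dk_nonneg del: power_Suc)

lemma f_gen_mono: "s \<le> t \<Longrightarrow> f_gen H g s \<le> f_gen H g t"
  unfolding f_gen_def by (intro suminf_le mult_left_mono power_mono) auto

lemma f_gen_finite: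
  assumes x: "0 \<le> x" and fin: "f_gen H g (ennreal x) < \<infinity>"
  shows "summable (\<lambda>n. dk (Suc n) * x ^ Suc n)"
    and "f_gen H g (ennreal x) = ennreal (\<Sum>n. dk (Suc n) * x ^ Suc n)"
proof -
  have nonneg: "0 \<le> dk (Suc n) * x ^ Suc n" for n
    using x dk_nonneg by (intro mult_nonneg_nonneg zero_le_power) auto
  show s: "summable (\<lambda>n. dk (Suc n) * x ^ Suc n)"
    using fin nonneg by (intro summable_suminf_not_top) (auto simp: f_gen_real[OF x] simp del: power_Suc)
  show "f_gen H g (ennreal x) = ennreal (\<Sum>n. dk (Suc n) * x ^ Suc n)"
    unfolding f_gen_real[OF x] by (rule suminf_ennreal2[OF nonneg s])
qed

text \<open>Finite sums make the sublevel set of \<open>f_gen\<close> an intersection of closed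
  sublevel sets of polynomials.\<close>

lemma f_gen_le_iff:
  assumes x: "0 \<le> x" and c: "0 \<le> c"
  shows "f_gen H g (ennreal x) \<le> ennreal c \<longleftrightarrow> (\<forall>N. (\<Sum>n<N. dk (Suc n) * x ^ Suc n) \<le> c)"
proof -
  have "(\<Sum>n<N. ennreal (dk (Suc n) * x ^ Suc n)) = ennreal (\<Sum>n<N. dk (Suc n) * x ^ Suc n)" for N
    using x dk_nonneg by (intro sum_ennreal) (auto intro!: mult_nonneg_nonneg)
  then show ?thesis
    unfolding f_gen_real[OF x] suminf_eq_SUP SUP_le_iff using c
    by (simp add: ennreal_le_iff del: power_Suc)
qed

text \<open>The root is the largest \<open>x\<close> with \<open>f x \<le> 1 / m\<close>: the series is continuous inside its disc of
  convergence, and at the boundary the value is large enough by assumption.\<close>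

lemma f_gen_root_exists:
  assumes ge: "f_gen H g (R_f H g) \<ge> ennreal (1 / m)"
  shows "\<exists>x>0. f_gen H g (ennreal x) = ennreal (1 / m)"
proof -
  define P where "P N x = (\<Sum>n<N. dk (Suc n) * x ^ Suc n)" for N and x :: real
  define A where "A = {x. 0 \<le> x \<and> (\<forall>N. P N x \<le> 1 / m)}"
  have A_iff: "x \<in> A \<longleftrightarrow> f_gen H g (ennreal x) \<le> ennreal (1 / m)" if "0 \<le> x" for x
    using f_gen_le_iff[OF that, of "1 / m"] that m_pos by (simp add: A_def P_def)
  have "\<exists>k. dk (Suc k) \<noteq> 0"
  proof (rule ccontr)
    assume "\<not> ?thesis"
    then have "f_gen H g (R_f H g) = 0" by (simp add: f_gen_def d_seq_eq)
    then show False using ge m_pos by simp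
  qed
  then obtain k where k: "0 < dk (Suc k)"
    using dk_nonneg by (metis less_eq_real_def)
  \<comment> \<open>One positive coefficient bounds \<open>A\<close>: for x \<ge> 1 its term is at
    least \<open>dk (Suc k) * x\<close> and at most 1/m.\<close>
  have "x \<le> max 1 (1 / m / dk (Suc k))" if "x \<in> A" for x
  proof (cases "1 \<le> x")
    case True
    have "dk (Suc k) * x \<le> dk (Suc k) * x ^ Suc k"
      using True k by (intro mult_left_mono) (auto intro: self_le_power)
    also have "\<dots> \<le> P (Suc k) x"
      unfolding P_def using True dk_nonneg
      by (intro member_le_sum[where f = "\<lambda>n. dk (Suc n) * x ^ Suc n"]) (auto intro!: mult_nonneg_nonneg)
    also have "\<dots> \<le> 1 / m" using that by (auto simp: A_def)
    finally have "x \<le> 1 / m / dk (Suc k)"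
      using k by (subst pos_le_divide_eq) (simp_all add: mult.commute)
    then show ?thesis by (rule max.coboundedI2)
  qed simp
  then have bdd: "bdd_above A" by (rule bdd_aboveI)
  have "0 \<in> A" using m_pos by (simp add: A_def P_def)
  have "A = {0..} \<inter> (\<Inter>N. {x. P N x \<le> 1 / m})" by (auto simp: A_def)
  moreover have "closed {x. P N x \<le> 1 / m}" for N
    unfolding P_def by (intro closed_Collect_le continuous_intros)
  ultimately have "closed A" by auto
  define x where "x = Sup A"
  have xA: "x \<in> A"
    unfolding x_def using \<open>0 \<in> A\<close> bdd \<open>closed A\<close> by (intro closed_contains_Sup) auto
  then have x0: "0 \<le> x" by (simp add: A_def)
  have above: "y \<notin> A" if "x < y" for y
    using cSup_upper[OF _ bdd] that unfolding x_def by (meson not_le)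
  have le: "f_gen H g (ennreal x) \<le> ennreal (1 / m)"
    using A_iff[OF x0] xA by simp
  have eq: "f_gen H g (ennreal x) = ennreal (1 / m)"
  proof (rule ccontr)
    assume "\<not> ?thesis"
    with le have less: "f_gen H g (ennreal x) < ennreal (1 / m)" by simp
    show False
    \<comment> \<open>If the series is finite somewhere beyond \<open>x\<close>, continuity puts
      points to the right of \<open>x\<close> into \<open>A\<close>. Otherwise
      \<open>R_f H g\<close> is at most \<open>x\<close>, and monotonicity contradicts the
      assumption on its value there.\<close>
    proof (cases "\<exists>y>x. f_gen H g (ennreal y) < \<infinity>")
      case True
      then obtain y where y: "x < y" "f_gen H g (ennreal y) < \<infinity>" by blast
      define c where "c n = (if n = 0 then 0 else dk n)" for n
      define G where "G z = (\<Sum>n. c n * z ^ n)" for z :: real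
      have "summable (\<lambda>n. c (Suc n) * y ^ Suc n)"
        using f_gen_finite(1)[OF _ y(2)] x0 y(1) by (simp add: c_def del: power_Suc)
      then have sum_y: "summable (\<lambda>n. c n * y ^ n)"
        by (subst (asm) summable_Suc_iff)
      have fG: "f_gen H g (ennreal z) = ennreal (G z)" if "0 \<le> z" "z < y" for z
      proof -
        have "f_gen H g (ennreal z) < \<infinity>"
          using f_gen_mono[of "ennreal z" "ennreal y"] y(2) that by (auto intro: ennreal_leI order.strict_trans1)
        note fin = f_gen_finite[OF that(1) this]
        have "summable (\<lambda>n. c n * z ^ n)"
          using powser_inside[OF sum_y, of z] that by simp
        then have "G z = (\<Sum>n. c (Suc n) * z ^ Suc n)"
          unfolding G_def by (subst suminf_split_head) (simp_all add: c_def)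
        then show ?thesis using fin(2) by (simp add: c_def del: power_Suc)
      qed
      have Gx: "G x < 1 / m"
        using less unfolding fG[OF x0 y(1)] by (meson ennreal_leI not_le)
      have "isCont G x"
        unfolding G_def by (rule isCont_powser[OF sum_y]) (use x0 y(1) in simp)
      then have "\<forall>\<^sub>F z in at x. G z < 1 / m"
        using Gx by (intro order_tendstoD(2)[of G "G x"]) (simp_all add: isCont_def)
      then have "\<forall>\<^sub>F z in at_right x. G z < 1 / m"
        by (simp add: eventually_at_split)
      moreover have "\<forall>\<^sub>F z in at_right x. z \<in> {x<..<y}"
        using y(1) by (rule eventually_at_right_real)
      ultimately have "\<forall>\<^sub>F z in at_right x. False"
      proof eventually_elim
        case (elim z)
        then have "z \<in> A"
          using A_iff[of z] fG[of z] x0 by (simp add: ennreal_leI)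
        then show False using above[of z] elim by simp
      qed
      then show False by (simp add: trivial_limit_at_right_real)
    next
      case False
      have "R_f H g \<le> ennreal y" if "x < y" for y
      proof -
        have "f_gen H g (ennreal y) = \<infinity>"
          using False that by (metis infinity_ennreal_def less_top)
        then show ?thesis
          unfolding R_f_def using that x0 by (intro Inf_lower) auto
      qed
      then have near: "R_f H g \<le> ennreal (x + e)" if "0 < e" for e
        using that by simp
      have "R_f H g \<le> ennreal x"
      proof (rule ennreal_le_epsilon)
        fix e :: real assume "0 < e"
        then show "R_f H g \<le> ennreal x + ennreal e"
          using near[OF \<open>0 < e\<close>] ennreal_plus[of x e] x0 by simp
      qed
      then have "f_gen H g (R_f H g) \<le> f_gen H g (ennreal x)" by (rule f_gen_mono)
      then show False using ge less by (meson leD order.trans)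
    qed
  qed
  moreover have "x \<noteq> 0"
  proof
    assume "x = 0"
    then have "f_gen H g (ennreal x) = 0" by (simp add: f_gen_def)
    then show False using eq m_pos by simp
  qed
  ultimately show ?thesis using x0 by (intro exI[of _ x]) auto
qed

lemma f_gen_root_unique:
  assumes "0 < x" "0 < y" "f_gen H g (ennreal x) = ennreal (1 / m)" "f_gen H g (ennreal y) = ennreal (1 / m)"
  shows "x = y"
  using assms
proof (induction x y rule: linorder_wlog)
  case (le x y)
  have fx: "f_gen H g (ennreal x) < \<infinity>" and fy: "f_gen H g (ennreal y) < \<infinity>"
    using le by simp_all
  note X = f_gen_finite[OF _ fx] and Y = f_gen_finite[OF _ fy]
  have nonneg: "0 \<le> dk (Suc n) * x ^ Suc n" "0 \<le> dk (Suc n) * y ^ Suc n" for n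
    using le dk_nonneg by (auto intro!: mult_nonneg_nonneg)
  have GX: "(\<Sum>n. dk (Suc n) * x ^ Suc n) = 1 / m"
    using X le(2,4) m_pos suminf_nonneg[OF X(1) nonneg(1)] by (simp del: power_Suc)
  have GY: "(\<Sum>n. dk (Suc n) * y ^ Suc n) = 1 / m"
    using Y le(3,5) m_pos suminf_nonneg[OF Y(1) nonneg(2)] by (simp del: power_Suc)
  show ?case
  proof (rule ccontr)
    assume "x \<noteq> y"
    with le have "x < y" by simp
    have "\<exists>k. 0 < dk (Suc k)"
    proof (rule ccontr)
      assume "\<not> ?thesis"
      then have "dk (Suc k) = 0" for k using dk_nonneg[of "Suc k"] by (auto simp: not_less intro: antisym)
      then show False using GX m_pos by simp
    qed
    then obtain k where k: "0 < dk (Suc k)" by blast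
    have "0 < (\<Sum>n. dk (Suc n) * y ^ Suc n - dk (Suc n) * x ^ Suc n)"
    proof (rule suminf_pos2)
      show "summable (\<lambda>n. dk (Suc n) * y ^ Suc n - dk (Suc n) * x ^ Suc n)"
        using X(1) Y(1) le(2,3) by (intro summable_diff) auto
      show "0 \<le> dk (Suc n) * y ^ Suc n - dk (Suc n) * x ^ Suc n" for n
        using mult_left_mono[OF power_mono[of x y "Suc n"] dk_nonneg[of "Suc n"]] le by simp
      show "0 < dk (Suc k) * y ^ Suc k - dk (Suc k) * x ^ Suc k"
        using k \<open>x < y\<close> le by (simp add: power_strict_mono del: power_Suc)
    qed
    also have "\<dots> = 0"
      using X(1) Y(1) le(2,3) GX GY by (subst suminf_diff[symmetric]) (simp_all del: power_Suc)
    finally show False by simp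
  qed
qed metis

lemma mult_f_gen_eq_1_iff: "ennreal m * f_gen H g s = 1 \<longleftrightarrow> f_gen H g s = ennreal (1 / m)"
proof (cases "f_gen H g s")
  case (real r)
  then show ?thesis
    using m_pos by (simp add: ennreal_mult[symmetric] ennreal_1[symmetric] field_simps del: ennreal_1)
next
  case top
  then show ?thesis using m_pos by (simp add: ennreal_mult_top)
qed

text \<open>The value 1 of \<open>rho\<close> alone is ambiguous, because
  \<open>real_of_ereal\<close> maps the infinite value of \<open>malthusian\<close> to 0 as well;
  finiteness of \<open>beta\<close> excludes that case. Existence and uniqueness of the root then
  give the \<open>THE\<close> term its defining equation.\<close>

lemma malthusian_zero:
  assumes beta: "beta H g m < \<infinity>" and rho: "rho H g m = 1"
  shows "malthusian H g m = 0" "R_conv H g m = 1" "ennreal m * f_gen H g 1 = 1"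
proof -
  have ge: "f_gen H g (R_f H g) \<ge> ennreal (1 / m)"
    using beta by (auto simp: beta_def split: if_splits)
  show R: "R_conv H g m = 1"
    using rho by (simp add: rho_def)
  let ?Q = "\<lambda>a. ennreal m * f_gen H g (ennreal (exp (- a))) = 1"
  obtain x where x: "0 < x" "f_gen H g (ennreal x) = ennreal (1 / m)"
    using f_gen_root_exists[OF ge] by blast
  have "\<exists>!a. ?Q a"
  proof (rule ex1I[of _ "- ln x"])
    show "?Q (- ln x)" unfolding mult_f_gen_eq_1_iff using x by simp
    fix a assume "?Q a"
    then have "x = exp (- a)"
      unfolding mult_f_gen_eq_1_iff using x by (intro f_gen_root_unique) simp_all
    then show "a = - ln x" by simp
  qed
  from theI'[OF this] have root: "?Q (THE a. ?Q a)" .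
  have mal: "malthusian H g m = ereal (THE a. ?Q a)"
    using ge by (simp add: malthusian_def)
  then have "(THE a. ?Q a) = 0"
    using R by (simp add: R_conv_def)
  with root mal show "malthusian H g m = 0" "ennreal m * f_gen H g 1 = 1"
    by (simp_all add: zero_ereal_def)
qed

text \<open>With R = 1 the root equation says that \<open>pk\<close> has mass one, and
  \<open>beta\<close> is its mean; both are transferred from extended to real series.\<close>

lemma
  assumes beta: "beta H g m < \<infinity>" and rho: "rho H g m = 1"
  shows pk_sums_1: "pk sums 1"
    and mean_pk_sums: "(\<lambda>k. real k * pk k) sums enn2real (beta H g m)"
proof -
  note mz = malthusian_zero[OF beta rho]
  have f1: "f_gen H g (ennreal 1) = ennreal (1 / m)"
    using mz(3) by (simp add: mult_f_gen_eq_1_iff)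
  then have fin: "f_gen H g (ennreal 1) < \<infinity>" by simp
  note F = f_gen_finite[OF _ fin, simplified]
  have "(\<Sum>n. dk (Suc n)) = 1 / m"
    using F f1 m_pos suminf_nonneg[OF F(1) dk_nonneg] by simp
  then have "(\<lambda>n. m * dk (Suc n)) sums 1"
    using sums_mult[OF summable_sums[OF F(1)], of m] m_pos by simp
  then have "(\<lambda>n. pk (Suc n)) sums 1" by (simp add: pk_def)
  then show "pk sums 1" by (subst (asm) sums_Suc_iff) simp
  have ge: "f_gen H g (R_f H g) \<ge> ennreal (1 / m)"
    using beta by (auto simp: beta_def split: if_splits)
  have b: "beta H g m = ennreal m * (\<Sum>n. ennreal (real (Suc n) * dk (Suc n)))"
    using ge by (simp add: beta_def mz(1) d_seq_eq)
  have "(\<Sum>n. ennreal (real (Suc n) * dk (Suc n))) \<noteq> top"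
    using beta m_pos unfolding b by (auto simp: ennreal_mult_top)
  then have s: "summable (\<lambda>n. real (Suc n) * dk (Suc n))"
    by (intro summable_suminf_not_top) (simp_all add: dk_nonneg)
  have "(\<Sum>n. ennreal (real (Suc n) * dk (Suc n))) = ennreal (\<Sum>n. real (Suc n) * dk (Suc n))"
    by (rule suminf_ennreal2[OF _ s]) (simp add: dk_nonneg)
  then have "enn2real (beta H g m) = m * (\<Sum>n. real (Suc n) * dk (Suc n))"
    using m_pos suminf_nonneg[OF s] dk_nonneg by (simp add: b enn2real_mult)
  then have "(\<lambda>n. m * (real (Suc n) * dk (Suc n))) sums enn2real (beta H g m)"
    using sums_mult[OF summable_sums[OF s], of m] by simp
  then have "(\<lambda>n. real (Suc n) * pk (Suc n)) sums enn2real (beta H g m)"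
    by (simp add: pk_def mult_ac)
  then show "(\<lambda>k. real k * pk k) sums enn2real (beta H g m)"
    by (subst (asm) sums_Suc_iff) simp
qed

end

section \<open>Limits of the survival probability and of the Laplace transforms\<close>

lemma cesaro_mean_tendsto:
  fixes a :: "nat \<Rightarrow> real"
  assumes a: "a \<longlonglongrightarrow> L"
  shows "(\<lambda>n. (\<Sum>k<n. a k) / real n) \<longlonglongrightarrow> L"
proof (rule LIMSEQ_I)
  fix e :: real assume "0 < e"
  then have e: "0 < e / 2" by simp
  from LIMSEQ_D[OF a e] obtain N where N: "\<And>k. k \<ge> N \<Longrightarrow> \<bar>a k - L\<bar> < e / 2"
    by auto
  define B where "B = (\<Sum>k<N. \<bar>a k - L\<bar>)"
  obtain N' where N': "B < real N' * (e / 2)"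
    using reals_Archimedean3[OF e] by blast
  have "\<bar>(\<Sum>k<n. a k) / real n - L\<bar> < e" if n: "n \<ge> Suc (max N N')" for n
  proof -
    have "(\<Sum>k<n. a k - L) = (\<Sum>k<n. a k) - real n * L"
      by (simp add: sum_subtractf)
    then have "\<bar>(\<Sum>k<n. a k) - real n * L\<bar> \<le> (\<Sum>k<n. \<bar>a k - L\<bar>)"
      using sum_abs[of "\<lambda>k. a k - L" "{..<n}"] by simp
    also have "(\<Sum>k<n. \<bar>a k - L\<bar>) = B + (\<Sum>k\<in>{N..<n}. \<bar>a k - L\<bar>)"
    proof -
      have set: "{..<n} = {..<N} \<union> {N..<n}" using n by auto
      show ?thesis unfolding B_def set by (rule sum.union_disjoint) auto
    qed
    also have "(\<Sum>k\<in>{N..<n}. \<bar>a k - L\<bar>) \<le> (\<Sum>k\<in>{N..<n}. e / 2)"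
      using N by (intro sum_mono) (auto intro: less_imp_le)
    also have "\<dots> \<le> real n * (e / 2)"
      using e by (simp add: mult_right_mono)
    also have "B < real n * (e / 2)"
      using N' n e by (intro less_le_trans[OF N'] mult_right_mono) auto
    finally have "\<bar>(\<Sum>k<n. a k) - real n * L\<bar> < real n * e" by (simp add: mult.commute)
    moreover have "(\<Sum>k<n. a k) / real n - L = ((\<Sum>k<n. a k) - real n * L) / real n"
      using n by (simp add: field_simps)
    ultimately show ?thesis
      using n by (simp add: abs_divide divide_less_eq mult.commute)
  qed
  then show "\<exists>no. \<forall>n\<ge>no. norm ((\<Sum>k<n. a k) / real n - L) < e"
    by (intro exI[of _ "Suc (max N N')"]) simp
qed

lemma one_minus_exp_bounds:
  assumes "0 \<le> (x::real)"
  shows "1 - exp (- x) \<le> x" "x - x\<^sup>2 \<le> 1 - exp (- x)"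
proof -
  show "1 - exp (- x) \<le> x" using exp_ge_add_one_self[of "- x"] by simp
  have "exp (- x) \<le> 1 / (1 + x)"
    using exp_ge_add_one_self[of x] assms unfolding exp_minus by (simp add: inverse_eq_divide frac_le)
  also have "\<dots> \<le> 1 - x + x\<^sup>2"
  proof -
    have "(1 - x + x\<^sup>2) * (1 + x) = 1 + x ^ 3"
      by (simp add: algebra_simps power2_eq_square power3_eq_cube)
    then show ?thesis using assms by (subst pos_divide_le_eq) auto
  qed
  finally show "x - x\<^sup>2 \<le> 1 - exp (- x)" by simp
qed

text \<open>The error depends on \<open>x\<close> only through the bound \<open>D\<close>, hence is
  uniform over the types for a bounded weight.\<close>

lemma scaled_one_minus_exp:
  assumes "0 \<le> x" "x \<le> D" "0 < n"
  shows "\<bar>real n * (1 - exp (- x / real n)) - x\<bar> \<le> D\<^sup>2 / real n"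
proof -
  define y where "y = x / real n"
  have y: "0 \<le> y" "real n * y = x" using assms by (simp_all add: y_def)
  have "real n * (1 - exp (- y)) \<le> real n * y" "real n * (y - y\<^sup>2) \<le> real n * (1 - exp (- y))"
    using one_minus_exp_bounds[OF y(1)] by (auto intro!: mult_left_mono)
  moreover have "real n * (y - y\<^sup>2) = x - x\<^sup>2 / real n"
    using assms(3) by (simp add: y_def power2_eq_square field_simps)
  moreover have "x\<^sup>2 / real n \<le> D\<^sup>2 / real n"
    using assms by (intro divide_right_mono power_mono) auto
  ultimately show ?thesis using y(2) by (simp add: y_def abs_le_iff)
qed

section \<open>Linear functionals of populations and the exponential law\<close>

lemma dot_counts: "dot (counts z) x = (\<Sum>j\<in>Poly_Mapping.keys z. counts z j * x j)"
  unfolding dot_def by (rule suminf_finite) (auto simp: counts_def in_keys_iff)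

lemma dot_counts_add: "dot (counts z) (\<lambda>j. x j + y j) = dot (counts z) x + dot (counts z) y"
  by (simp add: dot_counts sum.distrib distrib_left)

lemma dot_counts_cmult: "dot (counts z) (\<lambda>j. c * x j) = c * dot (counts z) x"
  by (simp add: dot_counts sum_distrib_left mult_ac)

lemma dot_counts_divide: "dot (\<lambda>j. counts z j / c) x = dot (counts z) x / c"
proof -
  have "dot (\<lambda>j. counts z j / c) x = (\<Sum>j\<in>Poly_Mapping.keys z. counts z j / c * x j)"
    unfolding dot_def by (rule suminf_finite) (auto simp: counts_def in_keys_iff)
  then show ?thesis by (simp add: dot_counts sum_divide_distrib)
qed

lemma dot_counts_nonneg: "(\<And>j. 0 \<le> x j) \<Longrightarrow> 0 \<le> dot (counts z) x"
  unfolding dot_counts by (intro sum_nonneg mult_nonneg_nonneg) (auto simp: counts_def)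

lemma monomial_at_exp: "monomial_at (\<lambda>j. exp (- x j / c)) z = exp (- (dot (counts z) x / c))"
proof -
  have "exp (- (dot (counts z) x / c)) = exp (\<Sum>j\<in>Poly_Mapping.keys z. real (Poly_Mapping.lookup z j) * (- x j / c))"
    unfolding dot_counts by (simp add: counts_def sum_divide_distrib sum_negf)
  also have "\<dots> = monomial_at (\<lambda>j. exp (- x j / c)) z"
    unfolding monomial_at_def exp_sum[OF finite_keys] by (simp only: exp_of_nat_mult)
  finally show ?thesis ..
qed

lemma prob_space_exponential_law: "0 < \<mu> \<Longrightarrow> prob_space (exponential_law \<mu>)"
  unfolding exponential_law_def by (rule prob_space_exponential_density) simp

lemma sets_exponential_law [measurable_cong, simp]: "sets (exponential_law \<mu>) = sets borel"
  and space_exponential_law [simp]: "space (exponential_law \<mu>) = UNIV"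
  by (simp_all add: exponential_law_def)

lemma integral_exponential_density:
  assumes "0 < l"
  shows "(\<integral>x. exponential_density l x \<partial>lborel) = 1"
proof -
  interpret prob_space "density lborel (exponential_density l)"
    using assms by (rule prob_space_exponential_density)
  have "(\<integral>\<^sup>+x. ennreal (exponential_density l x) \<partial>lborel) = 1"
    using emeasure_space_1 by (simp add: emeasure_density)
  then show ?thesis
    using exponential_density_nonneg[OF assms] by (simp add: integral_eq_nn_integral)
qed

text \<open>The damped density is a multiple of the exponential density with rate l + s. The
  absolute value appears because \<open>laplace_convergence\<close> asks for limit variables that
  are non-negative everywhere, not just almost surely.\<close>

lemma exponential_law_laplace:
  assumes "0 < \<mu>" "0 \<le> s"
  shows "(\<integral>x. exp (- s * \<bar>x\<bar>) \<partial>exponential_law \<mu>) = 1 / (1 + \<mu> * s)"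
proof -
  define l where "l = 1 / \<mu>"
  have l: "0 < l" "0 < l + s" using assms by (simp_all add: l_def add_pos_nonneg)
  have "(\<integral>x. exp (- s * \<bar>x\<bar>) \<partial>exponential_law \<mu>) = (\<integral>x. exponential_density l x * exp (- s * \<bar>x\<bar>) \<partial>lborel)"
    unfolding exponential_law_def l_def[symmetric]
    using exponential_density_nonneg[OF l(1)] by (subst integral_real_density) auto
  also have "\<dots> = (\<integral>x. l / (l + s) * exponential_density (l + s) x \<partial>lborel)"
  proof (rule Bochner_Integration.integral_cong[OF refl])
    fix x :: real
    show "exponential_density l x * exp (- s * \<bar>x\<bar>) = l / (l + s) * exponential_density (l + s) x"
    proof (cases "x < 0")
      case False
      then have "exp (- x * l) * exp (- s * \<bar>x\<bar>) = exp (- x * (l + s))"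
        by (simp add: exp_add[symmetric] algebra_simps)
      then show ?thesis
        using False l(2) by (simp only: exponential_density_def if_False mult.assoc) simp
    qed (simp add: exponential_density_def)
  qed
  also have "\<dots> = l / (l + s)"
    using integral_exponential_density[OF l(2)] by simp
  also have "\<dots> = 1 / (1 + \<mu> * s)"
    using assms l(2) by (simp add: l_def field_simps)
  finally show ?thesis .
qed

lemma measure_exponential_law_le:
  assumes "0 < \<mu>" "0 \<le> y"
  shows "measure (exponential_law \<mu>) {..y} = 1 - exp (- y / \<mu>)"
proof -
  interpret prob_space "exponential_law \<mu>" using assms(1) by (rule prob_space_exponential_law)
  have "distributed (exponential_law \<mu>) lborel (\<lambda>x. x) (exponential_density (1 / \<mu>))"
    unfolding distributed_def
    using exponential_density_nonneg[of "1 / \<mu>"] assms(1)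
    by (auto simp: exponential_law_def distr_id2)
  from exponential_distributedD_le[OF this assms(2)] assms(1)
  show ?thesis by (simp add: atMost_def)
qed

lemma AE_exponential_law_nonneg: "0 < \<mu> \<Longrightarrow> AE x in exponential_law \<mu>. 0 \<le> x"
  unfolding exponential_law_def by (subst AE_density) (auto simp: exponential_density_def)

lemma uniform_measure_integral:
  fixes f :: "'a \<Rightarrow> real"
  assumes "prob_space M" and A [measurable]: "A \<in> sets M" and pos: "0 < measure M A"
    and f [measurable]: "f \<in> borel_measurable M"
  shows "(\<integral>x. f x \<partial>uniform_measure M A) = (\<integral>x. indicator A x * f x \<partial>M) / measure M A"
proof -
  interpret prob_space M by fact
  have "uniform_measure M A = density M (\<lambda>x. ennreal (indicator A x / measure M A))"
    unfolding uniform_measure_def using pos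
    by (intro density_cong) (auto simp: emeasure_eq_measure divide_ennreal indicator_def simp flip: ennreal_1)
  then have "(\<integral>x. f x \<partial>uniform_measure M A) = (\<integral>x. indicator A x / measure M A * f x \<partial>M)"
    by (simp add: integral_real_density)
  then show ?thesis by simp
qed

context critical_lf
begin

lemma beta_pos: "0 < \<beta>"
  using beta_ge_1 by linarith

lemma V_add:
  assumes "bounded (range s)" "bounded (range t)"
  shows "V (\<lambda>j. s j + t j) = V s + V t"
  unfolding V_def
  using summable_rabs_cancel[OF summable_dot_pow[OF assms(1)]] summable_rabs_cancel[OF summable_dot_pow[OF assms(2)]]
  by (simp add: H.app_pow_add dot_add[OF weight_g] H.bounded_app_pow assms suminf_add)

lemma V_cmult:
  assumes "bounded (range t)"
  shows "V (\<lambda>j. c * t j) = c * V t"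
  unfolding V_def using summable_rabs_cancel[OF summable_dot_pow[OF assms]]
  by (simp add: H.app_pow_cmult dot_cmult[OF weight_g] H.bounded_app_pow assms suminf_mult)

lemma V_nonneg: "bounded (range t) \<Longrightarrow> (\<And>j. 0 \<le> t j) \<Longrightarrow> 0 \<le> V t"
  unfolding V_def
  by (intro suminf_nonneg summable_rabs_cancel[OF summable_dot_pow] dot_nonneg weight_g
      H.bounded_app_pow H.app_pow_nonneg)

definition vsum :: "nat \<Rightarrow> real" where
  "vsum j = (\<Sum>k. dot g (\<lambda>i. mat_pow H k i j))"

text \<open>\<open>vsum\<close> is formed entrywise, while \<open>V\<close> sums over
  \<open>k\<close> after pairing with \<open>t\<close>. Fubini reconciles them: the k-th row
  contributes at most \<open>dk k * D\<close> in absolute value.\<close>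

lemma
  shows weight_vsum: "weight vsum"
    and dot_vsum: "bounded (range t) \<Longrightarrow> dot vsum t = V t"
proof -
  define x where "x k j = dot g (\<lambda>i. mat_pow H k i j)" for k j
  have C: "suminf (mat_pow H k i) \<le> 1" for k i
    using H.app_pow_one_le[of k i] by (simp add: H.suminf_mat_pow)
  have x: "weight (x k)" for k
    unfolding x_def by (rule weight_dot_column[OF weight_g H.weight_mat_pow C])
  have dot_x: "dot (x k) t = dot g ((app H ^^ k) t)" if "bounded (range t)" for k t
    unfolding x_def dot_dot_swap[OF weight_g H.weight_mat_pow C that]
    by (simp add: H.dot_mat_pow[OF that])
  have sum_x: "suminf (x k) = dk k" for k
    using dot_const[OF x, of k 1] dot_x[of one k] by (simp add: dk_def)
  have swap: "summable (\<lambda>k. \<bar>x k j * t j\<bar>)" "summable (\<lambda>j. \<Sum>k. \<bar>x k j * t j\<bar>)"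
      "(\<Sum>j. \<Sum>k. x k j * t j) = (\<Sum>k. \<Sum>j. x k j * t j)" if t: "bounded (range t)" for t j
  proof -
    obtain D where D: "\<And>j. \<bar>t j\<bar> \<le> D"
      using t by (auto simp: bounded_iff)
    note row = weight_abs_summable_mult[OF x t]
    have tot: "summable (\<lambda>k. \<Sum>j. \<bar>x k j * t j\<bar>)"
    proof (rule summable_comparison_test'[of "\<lambda>k. dk k * D" 0])
      show "summable (\<lambda>k. dk k * D)" using summable_dk by (rule summable_mult2)
      fix k
      have "(\<Sum>j. \<bar>x k j * t j\<bar>) \<le> (\<Sum>j. x k j * D)"
        using D weight_nonneg[OF x]
        by (intro suminf_le row summable_mult2 weight_summable[OF x]) (auto simp: abs_mult intro: mult_left_mono)
      also have "\<dots> = dk k * D"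
        using suminf_mult2[OF weight_summable[OF x], of k D] by (simp add: sum_x)
      finally show "norm (\<Sum>j. \<bar>x k j * t j\<bar>) \<le> dk k * D"
        using suminf_nonneg[OF row] by simp
    qed
    show "summable (\<lambda>k. \<bar>x k j * t j\<bar>)" "summable (\<lambda>j. \<Sum>k. \<bar>x k j * t j\<bar>)"
      "(\<Sum>j. \<Sum>k. x k j * t j) = (\<Sum>k. \<Sum>j. x k j * t j)"
      by (rule summable_double_column[OF row tot] summable_double_swap[OF row tot] suminf_double_swap[OF row tot])+
  qed
  have abs_x: "\<bar>x k j\<bar> = x k j" for k j using weight_nonneg[OF x] by simp
  have col: "summable (\<lambda>k. x k j)" for j
    using swap(1)[of one j] by (simp add: abs_x)
  have v: "vsum j = (\<Sum>k. x k j)" for j by (simp add: vsum_def x_def)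
  show "weight vsum"
    unfolding weight_def v
    using swap(2)[of one] by (auto simp: abs_x v[abs_def] intro!: suminf_nonneg col weight_nonneg[OF x])
  assume t: "bounded (range t)"
  have "dot vsum t = (\<Sum>j. \<Sum>k. x k j * t j)"
    unfolding dot_def v by (intro suminf_cong suminf_mult2 col)
  also have "\<dots> = (\<Sum>k. dot (x k) t)"
    unfolding swap(3)[OF t] dot_def ..
  also have "\<dots> = V t" by (simp add: dot_x[OF t] V_def)
  finally show "dot vsum t = V t" .
qed

text \<open>n t_n differs from \<tau> by at most D^2 / n in every component, and positivity bounds
  the image of this difference by D^2 / n times that of \<open>one\<close>, which stays bounded. So
  t_n may be replaced by \<tau> / n; the sum of n such terms becomes a Cesaro mean.\<close>

lemma
  assumes \<tau>: "\<And>j. 0 \<le> \<tau> j \<and> \<tau> j \<le> D"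
  defines "t \<equiv> \<lambda>n j. 1 - exp (- \<tau> j / real n)"
  shows scaled_pow_tendsto: "(\<lambda>n. real n * (app mean ^^ n) (t n) i) \<longlonglongrightarrow> m * U i * V \<tau> / \<beta>"
    and scaled_sum_tendsto: "(\<lambda>n. \<Sum>k<n. aseq (t n) k) \<longlonglongrightarrow> V \<tau> / \<beta>"
proof -
  have b\<tau>: "bounded (range \<tau>)"
    using \<tau> by (intro bounded_range_le[of _ D]) (simp add: abs_le_iff order.trans[of _ 0])
  have "\<bar>t n j\<bar> \<le> 1" for n j
    using \<tau>[of j] by (simp add: t_def abs_le_iff)
  then have bt: "bounded (range (t n))" for n by (rule bounded_range_le)
  define r where "r n j = real n * t n j - \<tau> j" for n j
  have r: "\<bar>r n j\<bar> \<le> D\<^sup>2 / real n" if "0 < n" for n j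
    using scaled_one_minus_exp[of "\<tau> j" D n] \<tau> that by (simp add: r_def t_def)
  have br: "bounded (range (r n))" if "0 < n" for n
    using r[OF that] by (rule bounded_range_le)
  have decomp: "(\<lambda>j. real n * t n j) = (\<lambda>j. \<tau> j + r n j)" for n
    by (simp add: r_def)
  have inv: "(\<lambda>n. c / real n) \<longlonglongrightarrow> 0" for c
    by (rule lim_const_over_n)
  have "(\<lambda>n. D\<^sup>2 / real n * (app mean ^^ n) one i) \<longlonglongrightarrow> 0"
    using tendsto_mult[OF inv mean_pow_tendsto[of one i]] by simp
  then have err: "(\<lambda>n. (app mean ^^ n) (r n) i) \<longlonglongrightarrow> 0"
  proof (rule Lim_null_comparison[rotated])
    show "\<forall>\<^sub>F n in sequentially. norm ((app mean ^^ n) (r n) i) \<le> D\<^sup>2 / real n * (app mean ^^ n) one i"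
      using eventually_gt_at_top[of 0]
    proof eventually_elim
      case (elim n)
      show ?case using M.app_pow_abs_le[of "r n" "D\<^sup>2 / real n" n i, OF r[OF elim]] by simp
    qed
  qed
  have "\<forall>\<^sub>F n in sequentially. (app mean ^^ n) \<tau> i + (app mean ^^ n) (r n) i = real n * (app mean ^^ n) (t n) i"
    using eventually_gt_at_top[of 0]
  proof eventually_elim
    case (elim n)
    show ?case
      using M.app_pow_cmult[of "t n" n "real n", OF bt] M.app_pow_add[OF b\<tau> br[OF elim], of n]
      unfolding decomp by (simp add: fun_eq_iff)
  qed
  with tendsto_add[OF mean_pow_tendsto[OF b\<tau>, of i] err]
  show "(\<lambda>n. real n * (app mean ^^ n) (t n) i) \<longlonglongrightarrow> m * U i * V \<tau> / \<beta>"
    by (auto intro: Lim_transform_eventually)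
  obtain B where B: "\<And>n. \<bar>aseq one n\<bar> \<le> B"
    using convergent_imp_Bseq[OF convergentI[OF aseq_tendsto[of one]]]
    by (auto simp: Bseq_def)
  have err2: "(\<lambda>n. (\<Sum>k<n. aseq (r n) k) / real n) \<longlonglongrightarrow> 0"
  proof (rule Lim_null_comparison[OF _ inv])
    show "\<forall>\<^sub>F n in sequentially. norm ((\<Sum>k<n. aseq (r n) k) / real n) \<le> (D\<^sup>2 * B) / real n"
      using eventually_gt_at_top[of 0]
    proof eventually_elim
      case (elim n)
      have "\<bar>aseq (r n) k\<bar> \<le> D\<^sup>2 / real n * B" for k
      proof -
        have "\<bar>aseq (r n) k\<bar> \<le> D\<^sup>2 / real n * aseq one k"
          by (rule aseq_abs_le[OF r[OF elim]])
        also have "\<dots> \<le> D\<^sup>2 / real n * B"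
          using B[of k] by (intro mult_left_mono) auto
        finally show ?thesis .
      qed
      then have "\<bar>\<Sum>k<n. aseq (r n) k\<bar> \<le> (\<Sum>k<n. D\<^sup>2 / real n * B)"
        by (intro order.trans[OF sum_abs] sum_mono)
      also have "\<dots> = D\<^sup>2 * B" using elim by simp
      finally show ?case using elim by (simp add: divide_right_mono abs_divide)
    qed
  qed
  have "\<forall>\<^sub>F n in sequentially. (\<Sum>k<n. aseq \<tau> k) / real n + (\<Sum>k<n. aseq (r n) k) / real n = (\<Sum>k<n. aseq (t n) k)"
    using eventually_gt_at_top[of 0]
  proof eventually_elim
    case (elim n)
    have "aseq \<tau> k + aseq (r n) k = real n * aseq (t n) k" for k
      using aseq_cmult[of "t n" "real n" k, OF bt] aseq_add[OF b\<tau> br[OF elim], of k] unfolding decomp by simp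
    then have "(\<Sum>k<n. aseq \<tau> k) + (\<Sum>k<n. aseq (r n) k) = real n * (\<Sum>k<n. aseq (t n) k)"
      by (simp add: sum.distrib[symmetric] sum_distrib_left)
    then show ?case using elim by (simp add: add_divide_distrib[symmetric])
  qed
  with tendsto_add[OF cesaro_mean_tendsto[OF aseq_tendsto[OF b\<tau>]] err2]
  show "(\<lambda>n. \<Sum>k<n. aseq (t n) k) \<longlonglongrightarrow> V \<tau> / \<beta>"
    by (auto intro: Lim_transform_eventually)
qed

text \<open>\<open>expectation_generation\<close> at \<open>t = one\<close>, that is at s = 0, where
  the generating function is the extinction probability; see \<open>prob_survival\<close>.\<close>

definition survival :: "nat \<Rightarrow> nat \<Rightarrow> real" where
  "survival n i = (app mean ^^ n) one i / (1 + m * (\<Sum>k<n. aseq one k))"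

text \<open>The numerator tends to \<open>U i\<close> times m V 1 / \<beta>, and the denominator
  divided by n tends to m V 1 / \<beta> by Cesaro averaging.\<close>

lemma survival_tendsto: "(\<lambda>n. real n * survival n i) \<longlonglongrightarrow> U i"
proof -
  have "(\<lambda>n. 1 / real n + m * ((\<Sum>k<n. aseq one k) / real n)) \<longlonglongrightarrow> 0 + m * (V one / \<beta>)"
    by (intro tendsto_intros lim_const_over_n cesaro_mean_tendsto aseq_tendsto bounded_range_const)
  moreover have pos: "0 < m * (V one / \<beta>)"
    using m_pos beta_pos by (simp add: V_one)
  ultimately have "(\<lambda>n. (app mean ^^ n) one i / (1 / real n + m * ((\<Sum>k<n. aseq one k) / real n)))
      \<longlonglongrightarrow> (m * U i * V one / \<beta>) / (0 + m * (V one / \<beta>))"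
    by (intro tendsto_divide mean_pow_tendsto bounded_range_const) auto
  moreover have "(m * U i * V one / \<beta>) / (0 + m * (V one / \<beta>)) = U i"
  proof -
    have eq: "m * U i * V one / \<beta> = U i * (m * (V one / \<beta>))" by simp
    show ?thesis
      unfolding eq add_0 by (rule nonzero_mult_div_cancel_right) (use pos in linarith)
  qed
  moreover have "\<forall>\<^sub>F n in sequentially.
      (app mean ^^ n) one i / (1 / real n + m * ((\<Sum>k<n. aseq one k) / real n)) = real n * survival n i"
    using eventually_gt_at_top[of 0]
  proof eventually_elim
    case (elim n)
    have "1 / real n + m * ((\<Sum>k<n. aseq one k) / real n) = (1 + m * (\<Sum>k<n. aseq one k)) / real n"
      by (simp add: add_divide_distrib)
    then show ?case by (simp add: survival_def)
  qed
  ultimately show ?thesis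
    by (auto intro: Lim_transform_eventually)
qed

lemma conditional_laplace_tendsto:
  assumes \<tau>: "\<And>j. 0 \<le> \<tau> j \<and> \<tau> j \<le> D"
  defines "t \<equiv> \<lambda>n j. 1 - exp (- \<tau> j / real n)"
  shows "(\<lambda>n. 1 - ((app mean ^^ n) (t n) i / (1 + m * (\<Sum>k<n. aseq (t n) k))) / survival n i)
    \<longlonglongrightarrow> 1 / (1 + m * V \<tau> / \<beta>)"
proof -
  have "bounded (range \<tau>)"
    using \<tau> by (intro bounded_range_le[of _ D]) (simp add: abs_le_iff order.trans[of _ 0])
  then have V: "0 \<le> m * V \<tau> / \<beta>"
    using \<tau> V_nonneg[of \<tau>] m_pos beta_pos by simp
  have "(\<lambda>n. 1 - (real n * (app mean ^^ n) (t n) i / (1 + m * (\<Sum>k<n. aseq (t n) k))) / (real n * survival n i))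
      \<longlonglongrightarrow> 1 - (m * U i * V \<tau> / \<beta> / (1 + m * (V \<tau> / \<beta>))) / U i"
    using U_pos[of i] V unfolding t_def
    by (intro tendsto_intros scaled_pow_tendsto[OF \<tau>] scaled_sum_tendsto[OF \<tau>] survival_tendsto) auto
  moreover have "1 - (m * U i * V \<tau> / \<beta> / (1 + m * (V \<tau> / \<beta>))) / U i = 1 / (1 + m * V \<tau> / \<beta>)"
  proof -
    \<comment> \<open>In terms of \<open>y\<close> the factor \<open>U i\<close> cancels, which
      removes the starting type from the limit.\<close>
    define y where "y = m * V \<tau> / \<beta>"
    have "m * U i * V \<tau> / \<beta> = U i * y" "m * (V \<tau> / \<beta>) = y" by (simp_all add: y_def)
    moreover have "1 - y / (1 + y) = 1 / (1 + y)"
      using V by (simp add: y_def[symmetric] field_simps)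
    ultimately show ?thesis using U_pos[of i] by (simp flip: y_def)
  qed
  moreover have "\<forall>\<^sub>F n in sequentially.
      1 - (real n * (app mean ^^ n) (t n) i / (1 + m * (\<Sum>k<n. aseq (t n) k))) / (real n * survival n i) =
      1 - ((app mean ^^ n) (t n) i / (1 + m * (\<Sum>k<n. aseq (t n) k))) / survival n i"
    using eventually_gt_at_top[of 0] by eventually_elim simp
  ultimately show ?thesis
    by (auto intro: Lim_transform_eventually)
qed

text \<open>Every row of \<open>H\<close> has a positive entry, so positivity of M^n 1 propagates.
  Positivity for all \<open>n\<close> makes each conditional measure a probability measure.\<close>

lemma survival_pos: "0 < survival n i"
proof -
  have "0 < (app mean ^^ n) one i"
  proof (induction n arbitrary: i)
    case (Suc n)
    have "0 < app H ((app mean ^^ n) one) i"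
    proof -
      obtain j where "0 < H i j"
        using app_H_one_pos[of i] dot_pos_iff[OF H.weight, of one i] by (auto simp: app_def)
      then show ?thesis
        using Suc unfolding app_def[of H]
        by (subst dot_pos_iff[OF H.weight]) (auto intro!: M.bounded_app_pow M.app_pow_nonneg)
    qed
    moreover have "0 \<le> m * dot g ((app mean ^^ n) one) * app H one i"
      using m_pos app_H_one_nonneg[of i] aseq_nonneg[of one n] by (simp add: aseq_def)
    ultimately show ?case
      by (simp add: app_mean M.bounded_app_pow)
  qed simp
  moreover have "0 \<le> m * (\<Sum>k<n. aseq one k)"
    using m_pos by (intro mult_nonneg_nonneg sum_nonneg aseq_nonneg) auto
  ultimately show ?thesis by (simp add: survival_def add_pos_nonneg)
qed

end

section \<open>The limit theorem\<close>

context critical_lf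
begin

context
  fixes P :: "'a measure" and Z :: "nat \<Rightarrow> 'a \<Rightarrow> population" and q :: "nat \<Rightarrow> population pmf" and i :: nat
  assumes q: "\<And>i. linear_fractional (H i) g m (q i)"
    and bp: "branching_process P q (Poly_Mapping.single i 1) Z"
begin

interpretation P: prob_space P
  using bp by (simp add: branching_process_def)

lemma measurable_state [measurable]: "Z n \<in> measurable P (count_space UNIV)"
  using bp by (simp add: branching_process_def)

lemma measurable_fun_state [measurable]: "(\<lambda>\<omega>. f (Z n \<omega>)) \<in> borel_measurable P" for f :: "population \<Rightarrow> real"
  by (rule measurable_compose[OF measurable_state]) simp

lemma integral_state:
  fixes f :: "population \<Rightarrow> real"
  shows "(\<integral>\<omega>. f (Z n \<omega>) \<partial>P) = measure_pmf.expectation (generation q (Poly_Mapping.single i 1) n) f"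
  unfolding distr_branching_process[OF bp, symmetric] by (subst integral_distr) simp_all

lemma integral_monomial_state:
  assumes "\<And>j. 0 \<le> t j \<and> t j \<le> 1"
  shows "(\<integral>\<omega>. monomial_at (\<lambda>j. 1 - t j) (Z n \<omega>) \<partial>P) =
    1 - (app mean ^^ n) t i / (1 + m * (\<Sum>k<n. aseq t k))"
  unfolding integral_state by (rule expectation_generation[OF q assms])

lemma integrable_monomial_state:
  assumes "\<And>j. 0 \<le> s j \<and> s j \<le> 1"
  shows "integrable P (\<lambda>\<omega>. monomial_at s (Z n \<omega>))"
  using monomial_at_bounds[of s] assms
  by (intro P.integrable_const_bound[where B = 1]) (auto simp: abs_le_iff intro: order.trans[of _ 0])

lemma prob_survival: "\<P>(\<omega> in P. Z n \<omega> \<noteq> 0) = survival n i"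
proof -
  have "\<P>(\<omega> in P. Z n \<omega> \<noteq> 0) = (\<integral>\<omega>. indicator {\<omega> \<in> space P. Z n \<omega> \<noteq> 0} \<omega> \<partial>P)"
    by simp
  also have "\<dots> = (\<integral>\<omega>. 1 - monomial_at (\<lambda>_. 0) (Z n \<omega>) \<partial>P)"
    by (intro Bochner_Integration.integral_cong) (auto simp: monomial_at_zero_vec)
  also have "\<dots> = 1 - (\<integral>\<omega>. monomial_at (\<lambda>j. 1 - one j) (Z n \<omega>) \<partial>P)"
    using integrable_monomial_state[of "\<lambda>_. 0" n] by (simp add: P.prob_space)
  also have "\<dots> = survival n i"
    by (subst integral_monomial_state) (simp_all add: survival_def)
  finally show ?thesis .
qed

abbreviation surviving :: "nat \<Rightarrow> 'a set" where
  "surviving n \<equiv> {\<omega> \<in> space P. Z n \<omega> \<noteq> 0}"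

lemma prob_space_conditional: "prob_space (uniform_measure P (surviving n))"
  using survival_pos[of n i] prob_survival[of n]
  by (intro prob_space_uniform_measure) (auto simp: P.emeasure_eq_measure)

text \<open>The monomial at s = 0 indicates extinction, where every monomial equals 1. Restriction
  to survival therefore subtracts it, leaving a difference of two generating functions.\<close>

lemma conditional_laplace:
  fixes n :: nat
  assumes \<tau>: "\<And>j. 0 \<le> \<tau> j"
  defines "t \<equiv> \<lambda>j. 1 - exp (- \<tau> j / real n)"
  shows "(\<integral>\<omega>. exp (- (dot (counts (Z n \<omega>)) \<tau> / real n)) \<partial>uniform_measure P (surviving n)) =
    1 - ((app mean ^^ n) t i / (1 + m * (\<Sum>k<n. aseq t k))) / survival n i"
proof -
  have t: "0 \<le> t j \<and> t j \<le> 1" for j using \<tau> by (simp add: t_def)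
  have s: "(\<lambda>j. exp (- \<tau> j / real n)) = (\<lambda>j. 1 - t j)" by (simp add: t_def)
  have "indicator (surviving n) \<omega> * exp (- (dot (counts (Z n \<omega>)) \<tau> / real n)) =
      monomial_at (\<lambda>j. 1 - t j) (Z n \<omega>) - monomial_at (\<lambda>_. 0) (Z n \<omega>)" if "\<omega> \<in> space P" for \<omega>
    using that unfolding monomial_at_exp[of \<tau> "real n", symmetric] s
    by (simp add: monomial_at_zero_vec)
  then have "(\<integral>\<omega>. indicator (surviving n) \<omega> * exp (- (dot (counts (Z n \<omega>)) \<tau> / real n)) \<partial>P) =
      (\<integral>\<omega>. monomial_at (\<lambda>j. 1 - t j) (Z n \<omega>) - monomial_at (\<lambda>j. 1 - one j) (Z n \<omega>) \<partial>P)"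
    by (intro Bochner_Integration.integral_cong) simp_all
  also have "\<dots> = (\<integral>\<omega>. monomial_at (\<lambda>j. 1 - t j) (Z n \<omega>) \<partial>P) - (\<integral>\<omega>. monomial_at (\<lambda>j. 1 - one j) (Z n \<omega>) \<partial>P)"
    using t by (intro Bochner_Integration.integral_diff integrable_monomial_state) auto
  also have "\<dots> = survival n i - (app mean ^^ n) t i / (1 + m * (\<Sum>k<n. aseq t k))"
    by (subst (1 2) integral_monomial_state) (simp_all add: t survival_def)
  finally show ?thesis
    using survival_pos[of n i] prob_survival[of n]
    by (subst uniform_measure_integral) (simp_all add: P.prob_space_axioms diff_divide_distrib)
qed

text \<open>Weights of arbitrary sign are split as \<open>w = (w + K) - K\<close>, so that only Laplace transforms of
  non-negative variables occur.\<close>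

lemma conditional_weak_conv:
  assumes w: "bounded (range w)"
  shows "weak_conv_m
    (\<lambda>n. distr (uniform_measure P (surviving n)) borel (\<lambda>\<omega>. dot (\<lambda>j. counts (Z n \<omega>) j / real n) w))
    (distr (exponential_law ((1 + m) / \<beta>)) borel (\<lambda>X. X * (m / (1 + m) * V w)))"
proof -
  define \<mu> where "\<mu> = (1 + m) / \<beta>"
  define v where "v = m / (1 + m) * V w"
  have \<mu>: "0 < \<mu>" using m_pos beta_pos by (simp add: \<mu>_def)
  obtain K where K: "\<And>j. \<bar>w j\<bar> \<le> K"
    using w by (auto simp: bounded_iff)
  have K0: "0 \<le> w j + K" "w j + K \<le> 2 * K" "0 \<le> K" for j
    using K[of j] by (auto simp: abs_le_iff)
  have bwK: "bounded (range (\<lambda>j. w j + K))"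
    by (intro bounded_range_add w bounded_range_const)
  \<comment> \<open>Since \<open>v\<close> has total mass one, the total population divided by n has
    the limit X itself, and adding \<open>K\<close> to the weight adds \<open>K\<close> to its
    pairing with \<open>v\<close>.\<close>
  have V1: "m / (1 + m) * V one = 1" using m_pos by (simp add: V_one)
  have VwK: "m / (1 + m) * V (\<lambda>j. w j + K) = v + K"
  proof -
    have "V (\<lambda>j. w j + K * one j) = V w + K * V one"
      by (subst V_add[OF w bounded_range_cmult[OF bounded_range_const]]) (simp add: V_cmult del: mult_1_right)
    then have "m / (1 + m) * V (\<lambda>j. w j + K) = v + K * (m / (1 + m) * V one)"
      by (simp add: v_def distrib_left)
    then show ?thesis unfolding V1 by (simp only: mult_1_right)
  qed
  have vK: "0 \<le> v + K"
    unfolding VwK[symmetric] using m_pos K0 by (intro mult_nonneg_nonneg V_nonneg bwK) auto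
  let ?Q = "\<lambda>n. uniform_measure P (surviving n)"
  let ?N = "\<lambda>n \<omega>. dot (counts (Z n \<omega>)) one / real n"
  let ?W = "\<lambda>n \<omega>. dot (counts (Z n \<omega>)) (\<lambda>j. w j + K) / real n"
  \<comment> \<open>Both limits are multiples of one exponential variable, so the joint transform at
    \<open>a\<close>, \<open>b\<close> is its transform at a + b (v + K).\<close>
  interpret laplace_convergence ?Q "exponential_law \<mu>" ?N ?W "\<lambda>X. \<bar>X\<bar>" "\<lambda>X. (v + K) * \<bar>X\<bar>"
  proof (rule laplace_convergence.intro)
    fix a b :: nat
    define \<tau> where "\<tau> j = real a * one j + real b * (w j + K)" for j
    have \<tau>: "0 \<le> \<tau> j \<and> \<tau> j \<le> real a + real b * (2 * K)" for j
      using K0 by (auto simp: \<tau>_def intro!: add_nonneg_nonneg mult_nonneg_nonneg mult_left_mono)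
    have "V \<tau> = real a * V one + real b * V (\<lambda>j. w j + K)"
      unfolding \<tau>_def
      by (simp only: V_add[OF bounded_range_cmult[OF bounded_range_const] bounded_range_cmult[OF bwK]]
          V_cmult[OF bounded_range_const] V_cmult[OF bwK])
    then have "m / (1 + m) * V \<tau> = real a * (m / (1 + m) * V one) + real b * (m / (1 + m) * V (\<lambda>j. w j + K))"
      by (simp add: algebra_simps add_divide_distrib)
    moreover have "m * V \<tau> / \<beta> = \<mu> * (m / (1 + m) * V \<tau>)"
      using m_pos by (simp add: \<mu>_def)
    ultimately have V\<tau>: "m * V \<tau> / \<beta> = \<mu> * (real a + real b * (v + K))"
      unfolding V1 VwK by (simp only: mult_1_right)
    have dot_\<tau>: "dot (counts z) \<tau> = real a * dot (counts z) one + real b * dot (counts z) (\<lambda>j. w j + K)" for z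
      unfolding \<tau>_def[abs_def] dot_counts_cmult[symmetric] by (rule dot_counts_add)
    have "(\<integral>\<omega>. exp (- (real a * ?N n \<omega> + real b * ?W n \<omega>)) \<partial>?Q n) =
        (\<integral>\<omega>. exp (- (dot (counts (Z n \<omega>)) \<tau> / real n)) \<partial>?Q n)" for n
      by (simp only: dot_\<tau> add_divide_distrib times_divide_eq_right)
    also have "(\<integral>\<omega>. exp (- (dot (counts (Z n \<omega>)) \<tau> / real n)) \<partial>?Q n) =
        1 - ((app mean ^^ n) (\<lambda>j. 1 - exp (- \<tau> j / real n)) i /
          (1 + m * (\<Sum>k<n. aseq (\<lambda>j. 1 - exp (- \<tau> j / real n)) k))) / survival n i" for n
      using \<tau> by (intro conditional_laplace) auto
    finally have lhs: "(\<lambda>n. \<integral>\<omega>. exp (- (real a * ?N n \<omega> + real b * ?W n \<omega>)) \<partial>?Q n)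
        \<longlonglongrightarrow> 1 / (1 + m * V \<tau> / \<beta>)"
      using conditional_laplace_tendsto[OF \<tau>] by simp
    have "(\<integral>X. exp (- (real a * \<bar>X\<bar> + real b * ((v + K) * \<bar>X\<bar>))) \<partial>exponential_law \<mu>) =
        (\<integral>X. exp (- (real a + real b * (v + K)) * \<bar>X\<bar>) \<partial>exponential_law \<mu>)"
      by (intro Bochner_Integration.integral_cong refl) (simp add: algebra_simps)
    also have "\<dots> = 1 / (1 + m * V \<tau> / \<beta>)"
      unfolding V\<tau> using vK by (intro exponential_law_laplace \<mu>) simp
    finally show "(\<lambda>n. \<integral>\<omega>. exp (- (real a * ?N n \<omega> + real b * ?W n \<omega>)) \<partial>?Q n) \<longlonglongrightarrow>
        (\<integral>X. exp (- (real a * \<bar>X\<bar> + real b * ((v + K) * \<bar>X\<bar>))) \<partial>exponential_law \<mu>)"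
      using lhs by simp
  next
    show "?N n \<in> borel_measurable (?Q n)" "?W n \<in> borel_measurable (?Q n)" for n
      by measurable
    show "0 \<le> ?N n \<omega>" "0 \<le> ?W n \<omega>" for n \<omega>
      using K0 by (auto intro!: divide_nonneg_nonneg dot_counts_nonneg)
    show "prob_space (?Q n)" for n by (rule prob_space_conditional)
    show "prob_space (exponential_law \<mu>)" by (rule prob_space_exponential_law[OF \<mu>])
    show "(\<lambda>X. \<bar>X\<bar>) \<in> borel_measurable (exponential_law \<mu>)"
      "(\<lambda>X. (v + K) * \<bar>X\<bar>) \<in> borel_measurable (exponential_law \<mu>)" by measurable
    show "0 \<le> \<bar>X\<bar>" "0 \<le> (v + K) * \<bar>X\<bar>" for X :: real
      using vK by simp_all
  qed
  have "?W n \<omega> - K * ?N n \<omega> = dot (\<lambda>j. counts (Z n \<omega>) j / real n) w" for n \<omega>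
    using dot_counts_add[of "Z n \<omega>" w "\<lambda>_. K"] dot_counts_cmult[of "Z n \<omega>" K one]
    by (simp add: dot_counts_divide add_divide_distrib)
  moreover have "distr (exponential_law \<mu>) borel (\<lambda>X. (v + K) * \<bar>X\<bar> - K * \<bar>X\<bar>) =
      distr (exponential_law \<mu>) borel (\<lambda>X. X * v)"
  proof (rule distr_cong_AE)
    show "AE X in exponential_law \<mu>. (v + K) * \<bar>X\<bar> - K * \<bar>X\<bar> = X * v"
      using AE_exponential_law_nonneg[OF \<mu>] by eventually_elim (simp add: algebra_simps)
  qed simp_all
  ultimately show ?thesis
    using weak_conv_difference[of K] by (simp add: \<mu>_def v_def)
qed

text \<open>The limit law has a continuous distribution function at \<open>x > 0\<close>, and the
  strict tail is its complement. Positivity of the pairing of \<open>v\<close> and \<open>w\<close>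
  allows X v \<le> y to be solved for X.\<close>

lemma conditional_tail:
  assumes w: "bounded (range w)" and pos: "0 < m / (1 + m) * V w" and x: "0 < x"
  shows "(\<lambda>n. \<P>(\<omega> in P. dot (counts (Z n \<omega>)) w > real n * x \<bar> Z n \<omega> \<noteq> 0))
    \<longlonglongrightarrow> exp (- x / ((1 + m) / \<beta> * (m / (1 + m) * V w)))"
proof -
  define \<mu> where "\<mu> = (1 + m) / \<beta>"
  define v where "v = m / (1 + m) * V w"
  have \<mu>: "0 < \<mu>" using m_pos beta_pos by (simp add: \<mu>_def)
  have v: "0 < v" using pos by (simp add: v_def)
  let ?Q = "\<lambda>n. uniform_measure P (surviving n)"
  let ?D = "\<lambda>n \<omega>. dot (\<lambda>j. counts (Z n \<omega>) j / real n) w"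
  let ?L = "distr (exponential_law \<mu>) borel (\<lambda>X. X * v)"
  interpret E: prob_space "exponential_law \<mu>" by (rule prob_space_exponential_law[OF \<mu>])
  interpret L: real_distribution ?L by (rule E.real_distribution_distr) simp
  have cdf: "cdf ?L y = 1 - exp (- y / (\<mu> * v))" if "0 < y" for y
  proof -
    have "cdf ?L y = measure (exponential_law \<mu>) {..y / v}"
      unfolding cdf_def using v by (subst measure_distr) (auto intro!: arg_cong[of _ _ "measure (exponential_law \<mu>)"] simp: pos_le_divide_eq)
    then show ?thesis
      using measure_exponential_law_le[OF \<mu>, of "y / v"] that v by (simp add: mult.commute)
  qed
  have "isCont (cdf ?L) x"
  proof -
    have "\<forall>\<^sub>F y in nhds x. 0 < y"
      using order_tendstoD(1)[OF filterlim_ident x] by simp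
    then have "\<forall>\<^sub>F y in nhds x. cdf ?L y = 1 - exp (- y / (\<mu> * v))"
      by eventually_elim (rule cdf)
    moreover have "isCont (\<lambda>y. 1 - exp (- y / (\<mu> * v))) x"
      using \<mu> v by (intro continuous_intros) auto
    ultimately show ?thesis by (simp add: isCont_cong)
  qed
  then have "(\<lambda>n. cdf (distr (?Q n) borel (?D n)) x) \<longlonglongrightarrow> cdf ?L x"
    using conditional_weak_conv[OF w] by (simp add: weak_conv_m_def weak_conv_def \<mu>_def v_def)
  then have "(\<lambda>n. 1 - cdf (distr (?Q n) borel (?D n)) x) \<longlonglongrightarrow> 1 - (1 - exp (- x / (\<mu> * v)))"
    unfolding cdf[OF x] by (intro tendsto_intros)
  moreover have "\<forall>\<^sub>F n in sequentially. 1 - cdf (distr (?Q n) borel (?D n)) x =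
      \<P>(\<omega> in P. dot (counts (Z n \<omega>)) w > real n * x \<bar> Z n \<omega> \<noteq> 0)"
    using eventually_gt_at_top[of 0]
  proof eventually_elim
    case (elim n)
    interpret Q: prob_space "?Q n" by (rule prob_space_conditional)
    have [measurable]: "?D n \<in> borel_measurable P"
      unfolding dot_counts_divide by measurable
    have D: "x < ?D n \<omega> \<longleftrightarrow> real n * x < dot (counts (Z n \<omega>)) w" for \<omega>
      using elim by (simp add: dot_counts_divide pos_less_divide_eq mult.commute)
    have "cdf (distr (?Q n) borel (?D n)) x = Q.prob {\<omega> \<in> space P. ?D n \<omega> \<le> x}"
      unfolding cdf_def by (subst measure_distr) (auto intro!: arg_cong[of _ _ Q.prob])
    then have "1 - cdf (distr (?Q n) borel (?D n)) x = Q.prob (space (?Q n) - {\<omega> \<in> space P. ?D n \<omega> \<le> x})"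
      by (subst Q.prob_compl) auto
    also have "space (?Q n) - {\<omega> \<in> space P. ?D n \<omega> \<le> x} = {\<omega> \<in> space (?Q n). real n * x < dot (counts (Z n \<omega>)) w}"
      by (auto simp: D[symmetric])
    also have "Q.prob \<dots> = \<P>(\<omega> in P. dot (counts (Z n \<omega>)) w > real n * x \<bar> Z n \<omega> \<noteq> 0)"
      by (rule P.measure_uniform_measure_eq_cond_prob) measurable
    finally show ?case .
  qed
  ultimately show ?thesis
    by (auto simp: \<mu>_def v_def intro: Lim_transform_eventually)
qed

end

end

theorem proposition10:
  fixes H :: "nat \<Rightarrow> nat \<Rightarrow> real" and g :: "nat \<Rightarrow> real" and m :: real
    and P :: "nat \<Rightarrow> 'a measure" and Z :: "nat \<Rightarrow> 'a \<Rightarrow> population"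
  assumes "substochastic H" and "prob_vector g" and "m > 0"
    and "lf_branching_process P Z H g m"
    and "irreducible_mat (mean_matrix P Z)" and "aperiodic_mat (mean_matrix P Z)"
    and "beta H g m < \<infinity>"
    and "rho H g m = 1"
  shows "(\<forall>i. (\<lambda>n. \<P>(\<omega> in P i. Z n \<omega> \<noteq> 0)) \<sim>[at_top]
              (\<lambda>n. inverse (real n) * inverse (1 + m) * enn2real (beta H g m) * u_vec H g m i))
    \<and> (\<forall>w :: nat \<Rightarrow> real. bounded (range w) \<and> dot (v_vec H g m) w > 0 \<longrightarrow>
          (let c = (1 + m) / enn2real (beta H g m) * dot (v_vec H g m) w in
             \<forall>x>0. \<forall>i. (\<lambda>n. \<P>(\<omega> in P i. dot (counts (Z n \<omega>)) w > real n * x \<bar> Z n \<omega> \<noteq> 0))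
                           \<longlonglongrightarrow> exp (- x / c)))
    \<and> (\<forall>w :: nat \<Rightarrow> real. bounded (range w) \<and> dot (v_vec H g m) w > 0 \<longrightarrow>
          (\<forall>i. weak_conv_m
             (\<lambda>n. distr (uniform_measure (P i) {\<omega> \<in> space (P i). Z n \<omega> \<noteq> 0}) borel
                    (\<lambda>\<omega>. dot (\<lambda>j. counts (Z n \<omega>) j / real n) w))
             (distr (exponential_law ((1 + m) / enn2real (beta H g m))) borel
                    (\<lambda>X. dot (\<lambda>j. X * v_vec H g m j) w))))"
proof -
  interpret lf_params H g m
    using assms(1-3) by unfold_locales
  obtain q where q: "\<And>i. linear_fractional (H i) g m (q i)"
    and bp: "\<And>i. branching_process (P i) q (Poly_Mapping.single i 1) Z"
    using assms(4) by (auto simp: lf_branching_process_def)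
  \<comment> \<open>The hypotheses concern expectations of the process, the analysis concerns the
    algebraic matrix.\<close>
  have mean: "mean_matrix P Z = mean"
  proof (intro ext)
    fix i j
    have "Z 1 \<in> measurable (P i) (count_space UNIV)"
      using bp[of i] by (simp add: branching_process_def)
    then have "mean_matrix P Z i j = integral\<^sup>L (distr (P i) (count_space UNIV) (Z 1)) (\<lambda>z. counts z j)"
      unfolding mean_matrix_def by (subst integral_distr) auto
    also have "\<dots> = mean i j"
      unfolding distr_branching_process[OF bp] by (rule expectation_count[OF q])
    finally show "mean_matrix P Z i j = mean i j" .
  qed
  define \<beta> where "\<beta> = enn2real (beta H g m)"
  interpret critical_lf H g m \<beta>
    using assms(5-8) pk_sums_1 mean_pk_sums by unfold_locales (simp_all add: mean \<beta>_def)
  have R: "R_conv H g m = 1" using malthusian_zero assms(7,8) by blast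
  have u: "u_vec H g m i = (1 + m) / \<beta> * U i" for i
    by (simp add: u_vec_def R \<beta>_def[symmetric] U_def row_sum_eq del: funpow.simps)
  have v: "v_vec H g m j = m / (1 + m) * vsum j" for j
    by (simp add: v_vec_def R vsum_def)
  \<comment> \<open>The factor \<open>c\<close> serves both as the random X of the limit law and as
    1.\<close>
  have vw: "dot (\<lambda>j. c * v_vec H g m j) w = c * (m / (1 + m) * V w)" if w: "bounded (range w)" for w c
  proof -
    have "dot (\<lambda>j. c * v_vec H g m j) w = dot vsum (\<lambda>j. (c * (m / (1 + m))) * w j)"
      by (simp add: dot_def v mult_ac)
    then show ?thesis
      unfolding dot_cmult[OF weight_vsum w] dot_vsum[OF w] by (simp only: mult.assoc)
  qed
  have vw1: "dot (v_vec H g m) w = m / (1 + m) * V w" if "bounded (range w)" for w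
    using vw[OF that, of 1] by simp
  have surv: "(\<lambda>n. \<P>(\<omega> in P i. Z n \<omega> \<noteq> 0)) \<sim>[at_top]
      (\<lambda>n. inverse (real n) * inverse (1 + m) * \<beta> * u_vec H g m i)" for i
  proof (rule asymp_equivI')
    \<comment> \<open>The constants in the asymptotics undo the normalization of \<open>u\<close>,
      leaving \<open>U i / n\<close>.\<close>
    have "inverse (1 + m) * \<beta> * u_vec H g m i = U i"
      using m_pos beta_pos by (simp add: u)
    then have eq: "real n * survival n i / U i =
        \<P>(\<omega> in P i. Z n \<omega> \<noteq> 0) / (inverse (real n) * inverse (1 + m) * \<beta> * u_vec H g m i)" for n
      by (simp add: prob_survival[OF q bp] mult.assoc divide_inverse)
    have "(\<lambda>n. real n * survival n i / U i) \<longlonglongrightarrow> U i / U i"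
      using U_pos[of i] by (intro tendsto_intros survival_tendsto) auto
    then show "(\<lambda>n. \<P>(\<omega> in P i. Z n \<omega> \<noteq> 0) / (inverse (real n) * inverse (1 + m) * \<beta> * u_vec H g m i)) \<longlonglongrightarrow> 1"
      using U_pos[of i] by (simp add: eq)
  qed
  have tail: "(\<lambda>n. \<P>(\<omega> in P i. dot (counts (Z n \<omega>)) w > real n * x \<bar> Z n \<omega> \<noteq> 0))
      \<longlonglongrightarrow> exp (- x / ((1 + m) / \<beta> * dot (v_vec H g m) w))"
    if "bounded (range w)" "0 < dot (v_vec H g m) w" "0 < x" for w x i
    using conditional_tail[OF q bp that(1) _ that(3)] that(2) by (simp only: vw1[OF that(1)])
  have weak: "weak_conv_m
      (\<lambda>n. distr (uniform_measure (P i) {\<omega> \<in> space (P i). Z n \<omega> \<noteq> 0}) borel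
        (\<lambda>\<omega>. dot (\<lambda>j. counts (Z n \<omega>) j / real n) w))
      (distr (exponential_law ((1 + m) / \<beta>)) borel (\<lambda>X. dot (\<lambda>j. X * v_vec H g m j) w))"
    if "bounded (range w)" for w i
    unfolding vw[OF that] by (rule conditional_weak_conv[OF q bp that])
  show ?thesis
    unfolding \<beta>_def[symmetric] Let_def using surv tail weak by blast
qed

end
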